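(* There exist a Zariski open neighbourhood $U\subset\mathbb{C}^2$ of the origin and an algebraic almost closed 1-form $\omega$ on $U$ whose zero scheme $\mathcal{Z}=\mathcal{Z}(\omega)$ is a nonreduced point at the origin (that is, a nonreduced scheme supported at the single point $0$) such that: (i) there is no holomorphic function $\Phi$, defined on a Euclidean open neighbourhood $W\subset U$ of the origin in $\mathbb{C}^2$, with $\mathcal{Z}(d\Phi)=\mathcal{Z}$ as subschemes (analytic subspaces) of $W$; and (ii) for every $n$, $\mathcal{Z}$ is not isomorphic to the critical locus $\mathcal{Z}(d\Phi)$ of any holomorphic function $\Phi$ defined on a Euclidean open subset of $\mathbb{C}^n$.
   Context: For a 1-form $\omega$ on a nonsingular variety (or complex manifold) $V$, the zero scheme $\mathcal{Z}(\omega)\subset V$ is the subscheme (analytic subspace) whose ideal is locally generated by the coefficients of $\omega$ in a local frame of $\Omega_V$. An algebraic 1-form $\omega$ on a nonsingular variety $V$ is almost closed if $d\omega$ vanishes on the scheme $\mathcal{Z}(\omega)$, i.e. the coefficients of $d\omega$ lie in the ideal of $\mathcal{Z}(\omega)$; on an open set $U\subset\mathbb{C}^2$ with $\omega=A\,dx+B\,dy$ this says $A_y-B_x\in(A,B)$, subscripts denoting partial derivatives. The critical locus of a holomorphic function $\Phi$ is the zero scheme $\mathcal{Z}(d\Phi)$. Algebraic schemes supported at a point are regarded as complex analytic spaces when compared with critical loci of holomorphic functions. *)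

theory Defs
  imports "HOL-Analysis.Analysis" "HOL-Algebra.QuotRing" "HOL-Computational_Algebra.Polynomial"
begin

section \<open>Holomorphic functions on open subsets of $\mathbf{C}^n$\<close>

text \<open>
  Since the dimension is quantified inside the theorem, a point of $\mathbf{C}^n$ is a sequence
  vanishing from index $n$ on.  The
  product topology of the function type induces the Euclidean topology on this subspace.  Functions
  are total in the logic; only their values on the open set under consideration are meaningful.
\<close>

type_synonym point = "nat \<Rightarrow> complex"

definition Cn :: "nat \<Rightarrow> point set" where
  "Cn n = {z. \<forall>i\<ge>n. z i = 0}"

abbreviation origin :: point where
  "origin \<equiv> (\<lambda>_. 0)"

definition Cn_open :: "nat \<Rightarrow> point set \<Rightarrow> bool" where
  "Cn_open n V \<longleftrightarrow> openin (top_of_set (Cn n)) V"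

definition holomorphic :: "nat \<Rightarrow> point set \<Rightarrow> (point \<Rightarrow> complex) \<Rightarrow> bool" where
  "holomorphic n V f \<longleftrightarrow>
     continuous_on V f \<and>
     (\<forall>z\<in>V. \<forall>i<n. (\<lambda>t. f (z(i := t))) field_differentiable at (z i))"

definition partial :: "nat \<Rightarrow> (point \<Rightarrow> complex) \<Rightarrow> point \<Rightarrow> complex" where
  "partial i f z = deriv (\<lambda>t. f (z(i := t))) (z i)"

text \<open>
  A 1-form $\sum_{i<n} \omega_i\,dz_i$ is given by its coefficients; \<open>\<omega> i\<close> is irrelevant for
  $i \ge n$.
\<close>

type_synonym form1 = "nat \<Rightarrow> point \<Rightarrow> complex"

definition diff :: "(point \<Rightarrow> complex) \<Rightarrow> form1" where
  "diff \<Phi> = (\<lambda>i. partial i \<Phi>)"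

section \<open>Germs and zero schemes as analytic spaces\<close>

definition hol_near :: "nat \<Rightarrow> point \<Rightarrow> (point \<Rightarrow> complex) ring" where
  "hol_near n p =
     \<lparr>carrier = {f. \<exists>N. Cn_open n N \<and> p \<in> N \<and> holomorphic n N f},
      mult = (\<lambda>f g z. f z * g z), one = (\<lambda>_. 1),
      ring.zero = (\<lambda>_. 0), ring.add = (\<lambda>f g z. f z + g z)\<rparr>"

definition null_near :: "nat \<Rightarrow> point \<Rightarrow> (point \<Rightarrow> complex) set" where
  "null_near n p = {f. \<exists>N. Cn_open n N \<and> p \<in> N \<and> (\<forall>z\<in>N. f z = 0)}"

type_synonym germ = "(point \<Rightarrow> complex) set"

definition germ_ring :: "nat \<Rightarrow> point \<Rightarrow> germ ring" where
  "germ_ring n p = hol_near n p Quot null_near n p"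

definition germ :: "nat \<Rightarrow> point \<Rightarrow> (point \<Rightarrow> complex) \<Rightarrow> germ" where
  "germ n p f = null_near n p +>\<^bsub>hol_near n p\<^esub> f"

text \<open>The stalk at \<open>p\<close> of the ideal sheaf of the zero scheme of \<open>\<omega>\<close>.\<close>

definition zero_ideal :: "nat \<Rightarrow> form1 \<Rightarrow> point \<Rightarrow> germ set" where
  "zero_ideal n \<omega> p = genideal (germ_ring n p) {germ n p (\<omega> i) | i. i < n}"

definition zero_stalk :: "nat \<Rightarrow> form1 \<Rightarrow> point \<Rightarrow> germ set ring" where
  "zero_stalk n \<omega> p = germ_ring n p Quot zero_ideal n \<omega> p"

definition stalk_class :: "nat \<Rightarrow> form1 \<Rightarrow> point \<Rightarrow> (point \<Rightarrow> complex) \<Rightarrow> germ set" where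
  "stalk_class n \<omega> p f = zero_ideal n \<omega> p +>\<^bsub>germ_ring n p\<^esub> germ n p f"

definition zero_set :: "nat \<Rightarrow> point set \<Rightarrow> form1 \<Rightarrow> point set" where
  "zero_set n V \<omega> = {z\<in>V. \<forall>i<n. \<omega> i z = 0}"

text \<open>Two zero schemes are equal as analytic subspaces of \<open>W\<close> iff their ideal sheaves agree.\<close>

definition same_zero_scheme_on :: "nat \<Rightarrow> point set \<Rightarrow> form1 \<Rightarrow> form1 \<Rightarrow> bool" where
  "same_zero_scheme_on n W \<eta> \<omega> \<longleftrightarrow> (\<forall>p\<in>W. zero_ideal n \<eta> p = zero_ideal n \<omega> p)"

text \<open>
  Sections over \<open>S\<close> of the structure sheaf $\mathcal{O}_V/I$ of the zero scheme of \<open>\<omega>\<close> in \<open>V\<close>: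
  families of elements of the stalks that are locally induced by a holomorphic function.
\<close>

definition zero_section ::
    "nat \<Rightarrow> point set \<Rightarrow> form1 \<Rightarrow> point set \<Rightarrow> (point \<Rightarrow> germ set) \<Rightarrow> bool" where
  "zero_section n V \<omega> S s \<longleftrightarrow>
     (\<forall>p\<in>S. \<exists>N f. Cn_open n N \<and> p \<in> N \<and> N \<subseteq> V \<and> holomorphic n N f \<and>
        (\<forall>q\<in>N \<inter> S. s q = stalk_class n \<omega> q f))"

text \<open>
  Isomorphism of the analytic spaces \<open>X\<close> (zero scheme of \<open>\<omega>\<close> in \<open>V\<close>) and \<open>Y\<close> (zero scheme of
  \<open>\<eta>\<close> in \<open>W\<close>) as spaces ringed in $\mathbf{C}$-algebras: a homeomorphism \<open>h\<close> of the underlying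
  spaces together with an isomorphism from the structure sheaf of \<open>Y\<close> to that of \<open>X\<close>, given on the
  etale spaces, i.e. by isomorphisms of stalks under which sections correspond to sections.
\<close>

definition zero_schemes_iso ::
    "nat \<Rightarrow> point set \<Rightarrow> form1 \<Rightarrow> nat \<Rightarrow> point set \<Rightarrow> form1 \<Rightarrow> bool" where
  "zero_schemes_iso n V \<omega> m W \<eta> \<longleftrightarrow>
     (let X = zero_set n V \<omega>; Y = zero_set m W \<eta> in
      \<exists>h k \<phi>. homeomorphism X Y h k \<and>
        (\<forall>p\<in>X. \<phi> p \<in> ring_iso (zero_stalk m \<eta> (h p)) (zero_stalk n \<omega> p) \<and>
           (\<forall>c. \<phi> p (stalk_class m \<eta> (h p) (\<lambda>_. c)) = stalk_class n \<omega> p (\<lambda>_. c))) \<and>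
        (\<forall>S s. openin (top_of_set Y) S \<and> (\<forall>q\<in>S. s q \<in> carrier (zero_stalk m \<eta> q)) \<longrightarrow>
           (zero_section m W \<eta> S s \<longleftrightarrow>
            zero_section n V \<omega> {p\<in>X. h p \<in> S} (\<lambda>p. \<phi> p (s (h p))))))"

section \<open>Algebraic 1-forms on Zariski open subsets of $\mathbf{C}^2$\<close>

text \<open>
  Coordinates are $x = z_0$ and $y = z_1$.  A polynomial in $\mathbf{C}[x,y]$ is represented in
  $\mathbf{C}[x][y]$.
\<close>

definition poly2 :: "complex poly poly \<Rightarrow> point \<Rightarrow> complex" where
  "poly2 P z = poly (poly P [:z 1:]) (z 0)"

definition zariski_open :: "point set \<Rightarrow> bool" where
  "zariski_open U \<longleftrightarrow> (\<exists>S. U = Cn 2 - {z. \<forall>P\<in>S. poly2 P z = 0})"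

definition regular :: "point set \<Rightarrow> (point \<Rightarrow> complex) \<Rightarrow> bool" where
  "regular U f \<longleftrightarrow>
     (\<forall>p\<in>U. \<exists>N P Q. zariski_open N \<and> p \<in> N \<and> N \<subseteq> U \<and>
        (\<forall>z\<in>N. poly2 Q z \<noteq> 0 \<and> f z = poly2 P z / poly2 Q z))"

definition algebraic_form :: "point set \<Rightarrow> form1 \<Rightarrow> bool" where
  "algebraic_form U \<omega> \<longleftrightarrow> (\<forall>i<2. regular U (\<omega> i))"

text \<open>
  The germ of \<open>f\<close> at \<open>p\<close> lies in the stalk of the algebraic ideal sheaf of the zero scheme of
  \<open>\<omega>\<close> on \<open>U\<close>.
\<close>

definition in_alg_ideal_at :: "point set \<Rightarrow> form1 \<Rightarrow> point \<Rightarrow> (point \<Rightarrow> complex) \<Rightarrow> bool" where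
  "in_alg_ideal_at U \<omega> p f \<longleftrightarrow>
     (\<exists>N a b. zariski_open N \<and> p \<in> N \<and> N \<subseteq> U \<and> regular N a \<and> regular N b \<and>
        (\<forall>z\<in>N. f z = a z * \<omega> 0 z + b z * \<omega> 1 z))"

definition almost_closed :: "point set \<Rightarrow> form1 \<Rightarrow> bool" where
  "almost_closed U \<omega> \<longleftrightarrow>
     (\<forall>p\<in>U. in_alg_ideal_at U \<omega> p (\<lambda>z. partial 1 (\<omega> 0) z - partial 0 (\<omega> 1) z))"

text \<open>Nonreduced: the local ring at \<open>p\<close> of the zero scheme has a nonzero nilpotent element.\<close>

definition nonreduced_at :: "point set \<Rightarrow> form1 \<Rightarrow> point \<Rightarrow> bool" where
  "nonreduced_at U \<omega> p \<longleftrightarrow>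
     (\<exists>N f k. zariski_open N \<and> p \<in> N \<and> N \<subseteq> U \<and> regular N f \<and>
        \<not> in_alg_ideal_at U \<omega> p f \<and> in_alg_ideal_at U \<omega> p (\<lambda>z. f z ^ k))"

definition nonreduced_point :: "point set \<Rightarrow> form1 \<Rightarrow> point \<Rightarrow> bool" where
  "nonreduced_point U \<omega> p \<longleftrightarrow> zero_set 2 U \<omega> = {p} \<and> nonreduced_at U \<omega> p"

end

(*
  Put f = x^13 + x^10 y^4 + x^7 y^7 + x^4 y^10 + y^13, A = f_x, and choose B = f_y + (higher order terms)
  with B_x = A_y - x A; then A dx + B dy is almost closed.  Suppose that d psi = M (A, B) for a 2x2 matrix M
  of germs.  Comparing coefficients of d(d psi) = 0 at monomials near the exponents v of f, the exponents
  being so sparse that no others interfere, one obtains M(0) = e * 1, and a polynomial T(i, j) of degree 2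
  with T(0, 0) = 0 and T(-1, -1) = -e that vanishes at the five exponents of f.  Three of the exponents are
  on the line i + j = 14 and the other two are on i + j = 13, so no conic contains them and the origin, and
  e = 0.

  Let I = (A, B), with m the maximal ideal at 0, and suppose that the local algebra O/I is isomorphic to that
  of the critical locus of Phi at p in C^n.  Lift the coordinates of C^n to germs at the origin of the plane,
  giving a map G; then d(Phi o G) has coefficients in I, and the above shows that the classes in I/mI of the
  germs Phi_i o G satisfy the linear relations which place them in the image of the Hessian of Phi.  Changing
  G by elements of I one can therefore arrange that all Phi_i o G lie in mI.  These germs generate I modulo
  mI, so A lies in mI, which is false.  The case of equal zero schemes is the identity isomorphism.
*)

theory Submission
  imports Defs "HOL-Complex_Analysis.Complex_Analysis"
begin

section \<open>Parameter integrals of holomorphic functions\<close>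

text \<open>T has five unknowns, namely e and four coefficients of degree 2 of M, and they
  correspond bijectively to the conics through the origin; this is why f has five monomials. Were
  their exponents all on one line i + j = N, the conics (i + j - N)(r i + s j) would survive and
  leave e free. The four extra unknowns are inevitable: the term x A makes e enter the equations at
  the exponents v of f themselves, where entries of M of degree 2 contribute as well. The powers
  x^13 and y^13 make I contain m^23 locally. A germ modulo I is thus known from finitely many
  coefficients, and a merely algebraic C-linear isomorphism of local algebras is automatically
  composition with a lift G of the coordinates. In (ii) the dimension n is arbitrary and the Hessian
  of Phi at p may have any rank. Splitting off the nondegenerate quadratic part of Phi would need a
  normal form; one Newton step on G does the same work modulo m I, and this precision suffices
  because A is a minimal generator of I.\<close>

lemma continuous_on_locally:
  assumes "\<And>x. x \<in> S \<Longrightarrow> \<exists>U. open U \<and> x \<in> U \<and> continuous_on (S \<inter> U) f"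
  shows "continuous_on S f"
  unfolding continuous_on_def
proof (intro ballI)
  fix x assume x: "x \<in> S"
  then obtain U where U: "open U" "x \<in> U" "continuous_on (S \<inter> U) f"
    using assms by blast
  have "at x within S = at x within (S \<inter> U)"
    by (rule at_within_nhd[OF U(2,1)]) auto
  then show "(f \<longlongrightarrow> f x) (at x within S)"
    using U x unfolding continuous_on_def by auto
qed

text \<open>Cauchy's formula writes the derivative as an integral over a fixed circle of a jointly
  continuous integrand, so joint continuity passes to the derivative. The parameter space is left
  general: it will be an interval and also a polydisc.\<close>

lemma continuous_on_deriv_param:
  fixes g :: "'a::topological_space \<Rightarrow> complex \<Rightarrow> complex"
  assumes cont: "continuous_on (T \<times> ball c r) (\<lambda>(t, s). g t s)"
    and hol: "\<And>t. t \<in> T \<Longrightarrow> g t holomorphic_on ball c r"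
  shows "continuous_on (T \<times> ball c r) (\<lambda>(t, s). deriv (g t) s)"
proof (rule continuous_on_locally)
  fix x assume x: "x \<in> T \<times> ball c r"
  then have "dist c (snd x) < r" by auto
  \<comment> \<open>The circle must enclose the point and stay inside the ball, so its radius
    depends on the point; hence continuity is proved locally.\<close>
  then obtain q where q: "dist c (snd x) < q" "q < r"
    using dense by blast
  then have q0: "q > 0" by (meson le_less_trans zero_le_dist)
  define \<gamma> where "\<gamma> = circlepath c q"
  have \<gamma>: "\<gamma> u \<in> sphere c q" if "u \<in> {0..1}" for u
    using that q0 by (simp add: \<gamma>_def circlepath dist_norm norm_mult)
  have "continuous_on UNIV \<gamma>"
    unfolding \<gamma>_def circlepath_def part_circlepath_def linepath_def
    by (intro continuous_intros)
  then have \<gamma>c: "continuous_on {0..1} \<gamma>"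
    using continuous_on_subset by blast
  define K where "K = (\<lambda>(t, s) u. g t (\<gamma> u) / (\<gamma> u - s)\<^sup>2 * vector_derivative \<gamma> (at u))"
  have vd: "vector_derivative \<gamma> (at u) = 2 * pi * \<i> * q * exp (2 * of_real pi * \<i> * u)" for u
    by (simp add: \<gamma>_def vector_derivative_circlepath)
  have eq: "deriv (g t) s = 1 / (2 * of_real pi * \<i>) * integral {0..1} (K (t, s))"
    if "t \<in> T" "s \<in> ball c q" for t s
  proof -
    have "g t holomorphic_on cball c q"
      by (rule holomorphic_on_subset[OF hol[OF that(1)]]) (use q in auto)
    then have "(g t has_field_derivative (1 / (2 * of_real pi * \<i>) *
                  contour_integral \<gamma> (\<lambda>u. g t u / (u - s)\<^sup>2))) (at s)"
      unfolding \<gamma>_def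
      by (intro Cauchy_derivative_integral_circlepath holomorphic_on_imp_continuous_on that)
        (auto elim: holomorphic_on_subset)
    then show ?thesis
      by (simp add: DERIV_imp_deriv K_def contour_integral_integral)
  qed
  have \<gamma>n: "(\<gamma> (snd y) - snd (fst y))\<^sup>2 \<noteq> 0" if "y \<in> (T \<times> ball c q) \<times> {0..1}" for y
    using that \<gamma>[of "snd y"] by (auto simp: mem_Times_iff)
  have c2: "continuous_on ((T \<times> ball c q) \<times> {0..1::real}) (\<lambda>y. \<gamma> (snd y))"
    by (rule continuous_on_compose2[OF \<gamma>c]) (auto intro!: continuous_intros)
  have c1: "continuous_on ((T \<times> ball c q) \<times> {0..1}) (\<lambda>y. g (fst (fst y)) (\<gamma> (snd y)))"
  proof -
    from c2 have "continuous_on ((T \<times> ball c q) \<times> {0..1})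
           (\<lambda>y. (\<lambda>(t, s). g t s) (fst (fst y), \<gamma> (snd y)))"
      by (intro continuous_on_compose2[OF cont] continuous_intros)
        (use \<gamma> q in auto)
    then show ?thesis by simp
  qed
  have "continuous_on ((T \<times> ball c q) \<times> {0..1}) (\<lambda>y. g (fst (fst y)) (\<gamma> (snd y)) /
      (\<gamma> (snd y) - snd (fst y))\<^sup>2 * (2 * pi * \<i> * q * exp (2 * of_real pi * \<i> * of_real (snd y))))"
    by (intro continuous_intros c1 c2 \<gamma>n ballI)
  then have "continuous_on ((T \<times> ball c q) \<times> {0..1}) (\<lambda>(x, u). K x u)"
    by (simp add: K_def vd case_prod_unfold)
  then have "continuous_on (T \<times> ball c q) (\<lambda>x. integral {0..1} (K x))"
    using integral_continuous_on_param[of "T \<times> ball c q" 0 "1::real" K] by simp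
  then have "continuous_on (T \<times> ball c q) (\<lambda>x. 1 / (2 * of_real pi * \<i>) * integral {0..1} (K x))"
    by (intro continuous_intros)
  then have "continuous_on (T \<times> ball c q) (\<lambda>(t, s). deriv (g t) s)"
    by (rule continuous_on_eq) (auto simp: eq)
  moreover have "T \<times> ball c r \<inter> UNIV \<times> ball c q = T \<times> ball c q"
    using q by auto
  ultimately show "\<exists>U. open U \<and> x \<in> U \<and> continuous_on (T \<times> ball c r \<inter> U) (\<lambda>(t, s). deriv (g t) s)"
    using q by (intro exI[of _ "UNIV \<times> ball c q"]) (auto simp: open_Times mem_Times_iff)
qed

text \<open>Differentiation under the integral sign; the joint continuity of the s-derivative that
  it requires comes from \<open>continuous_on_deriv_param\<close>.\<close>

lemma holomorphic_on_integral_param: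
  fixes g :: "complex \<Rightarrow> real \<Rightarrow> complex"
  assumes cont: "continuous_on (ball c r \<times> {0..1}) (\<lambda>(s, t). g s t)"
    and hol: "\<And>t. t \<in> {0..1} \<Longrightarrow> (\<lambda>s. g s t) holomorphic_on ball c r"
  shows "(\<lambda>s. integral {0..1} (g s)) holomorphic_on ball c r"
proof -
  have "continuous_on ({0..1} \<times> ball c r) (\<lambda>x. (\<lambda>(s, t). g s t) (snd x, fst x))"
    by (intro continuous_on_compose2[OF cont] continuous_intros) auto
  then have "continuous_on ({0..1} \<times> ball c r) (\<lambda>(t, s). deriv (\<lambda>s. g s t) s)"
    by (intro continuous_on_deriv_param) (auto simp: case_prod_unfold hol)
  then have "continuous_on (ball c r \<times> {0..1}) (\<lambda>x. (\<lambda>(t, s). deriv (\<lambda>s. g s t) s) (snd x, fst x))"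
    by (rule continuous_on_compose2) (auto intro!: continuous_intros)
  then have cd: "continuous_on (ball c r \<times> cbox 0 1) (\<lambda>(s, t). deriv (\<lambda>s. g s t) s)"
    by (simp add: case_prod_unfold)
  have int: "g s integrable_on cbox 0 1" if "s \<in> ball c r" for s
  proof -
    have "continuous_on (cbox 0 (1::real)) (\<lambda>t. (\<lambda>(s, t). g s t) (s, t))"
      by (intro continuous_on_compose2[OF cont] continuous_intros) (use that in auto)
    then show ?thesis by (intro integrable_continuous) simp
  qed
  have "((\<lambda>s. g s t) has_field_derivative deriv (\<lambda>s. g s t) s) (at s within ball c r)"
    if "s \<in> ball c r" "t \<in> cbox 0 1" for s t
    using that hol[of t] holomorphic_derivI[OF _ open_ball] by auto
  from leibniz_rule_holomorphic[OF this int cd convex_ball] show ?thesis by simp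
qed

section \<open>Germs of holomorphic functions\<close>

definition polydisc :: "nat \<Rightarrow> point \<Rightarrow> real \<Rightarrow> point set" where
  "polydisc n p r = {z \<in> Cn n. \<forall>i<n. z i \<in> ball (p i) r}"

text \<open>The filter is not punctured, so that eventual equality of functions is exactly equality
  of germs, including the value at \<open>p\<close>.\<close>

abbreviation near :: "nat \<Rightarrow> point \<Rightarrow> point filter" where
  "near n p \<equiv> inf (nhds p) (principal (Cn n))"

lemma Cn_open_polydisc: "Cn_open n (polydisc n p r)"
proof -
  have "polydisc n p r = Cn n \<inter> (\<Inter>i\<in>{..<n}. (\<lambda>z. z i) -` ball (p i) r)"
    by (auto simp: polydisc_def)
  moreover have "open (\<Inter>i\<in>{..<n}. (\<lambda>z::point. z i) -` ball (p i) r)"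
    by (intro open_INT ballI open_vimage) (auto intro: continuous_on_subset)
  ultimately show ?thesis
    unfolding Cn_open_def by (simp add: openin_open_Int)
qed

lemma polydisc_center: "p \<in> Cn n \<Longrightarrow> r > 0 \<Longrightarrow> p \<in> polydisc n p r"
  by (auto simp: polydisc_def)

text \<open>A basic open set of the product restricts single coordinates; those from
  \<open>n\<close> on vanish on \<open>Cn n\<close> and satisfy their restriction automatically, so
  the radii of the first \<open>n\<close> coordinates decide.\<close>

lemma Cn_open_contains_polydisc:
  assumes "Cn_open n N" "p \<in> N"
  shows "\<exists>r>0. polydisc n p r \<subseteq> N"
proof -
  obtain U where U: "open U" "N = Cn n \<inter> U"
    using assms(1) unfolding Cn_open_def openin_open by auto
  then have "openin (product_topology (\<lambda>i::nat. euclidean :: complex topology) UNIV) U"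
    by (simp add: open_fun_def)
  from product_topology_open_contains_basis[OF this, of p] U assms(2)
  obtain X where X: "p \<in> Pi\<^sub>E UNIV X" "\<And>i. open (X i)" "Pi\<^sub>E UNIV X \<subseteq> U" by auto
  have pX: "p i \<in> X i" for i using X(1) by auto
  have p0: "p i = 0" if "i \<ge> n" for i using assms U that by (auto simp: Cn_def)
  have "\<forall>i. \<exists>e>0. ball (p i) e \<subseteq> X i"
    using X(2) pX openE by blast
  then obtain e where e: "\<And>i. e i > 0" "\<And>i. ball (p i) (e i) \<subseteq> X i" by metis
  \<comment> \<open>The element 1 keeps the minimum meaningful for n = 0.\<close>
  define r where "r = Min (insert 1 (e ` {..<n}))"
  have r: "r > 0" "\<And>i. i < n \<Longrightarrow> r \<le> e i"
    using e by (auto simp: r_def)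
  have "polydisc n p r \<subseteq> N"
  proof
    fix z assume z: "z \<in> polydisc n p r"
    have "z i \<in> X i" for i
    proof (cases "i < n")
      case True
      then show ?thesis using z r(2)[OF True] e(2)[of i] by (force simp: polydisc_def)
    next
      case False
      then show ?thesis using z p0[of i] pX[of i] by (auto simp: polydisc_def Cn_def)
    qed
    then show "z \<in> N" using X(3) z U(2) by (auto simp: polydisc_def)
  qed
  then show ?thesis using r by blast
qed

lemma eventually_near:
  assumes "p \<in> Cn n"
  shows "eventually P (near n p) \<longleftrightarrow> (\<exists>N. Cn_open n N \<and> p \<in> N \<and> (\<forall>z\<in>N. P z))"
proof
  assume "eventually P (near n p)"
  then obtain S where "open S" "p \<in> S" "\<And>z. z \<in> S \<Longrightarrow> z \<in> Cn n \<Longrightarrow> P z"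
    by (auto simp: eventually_inf_principal eventually_nhds)
  then show "\<exists>N. Cn_open n N \<and> p \<in> N \<and> (\<forall>z\<in>N. P z)"
    using assms by (intro exI[of _ "Cn n \<inter> S"]) (auto simp: Cn_open_def openin_open_Int)
next
  assume "\<exists>N. Cn_open n N \<and> p \<in> N \<and> (\<forall>z\<in>N. P z)"
  then obtain N U where N: "p \<in> N" "\<forall>z\<in>N. P z" "open U" "N = Cn n \<inter> U"
    unfolding Cn_open_def openin_open by auto
  then show "eventually P (near n p)"
    unfolding eventually_inf_principal eventually_nhds by (intro exI[of _ U]) auto
qed

lemma eventually_near_polydisc:
  assumes "p \<in> Cn n"
  shows "eventually P (near n p) \<longleftrightarrow> (\<exists>r>0. \<forall>z\<in>polydisc n p r. P z)"
  unfolding eventually_near[OF assms]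
  by (meson Cn_open_polydisc Cn_open_contains_polydisc assms polydisc_center subsetD)

lemma near_self: "p \<in> Cn n \<Longrightarrow> eventually P (near n p) \<Longrightarrow> P p"
  by (auto simp: eventually_near)

lemma eventually_near_near:
  assumes "p \<in> Cn n" "eventually P (near n p)"
  shows "eventually (\<lambda>q. q \<in> Cn n \<and> eventually P (near n q)) (near n p)"
proof -
  obtain N where N: "Cn_open n N" "p \<in> N" "\<forall>z\<in>N. P z"
    using assms eventually_near by blast
  then have "N \<subseteq> Cn n" by (metis Cn_open_def openin_imp_subset)
  then show ?thesis unfolding eventually_near[OF assms(1)]
    using N eventually_near[of _ n P] by (intro exI[of _ N]) blast
qed

lemma polydisc_upd: "z \<in> polydisc n p r \<Longrightarrow> i < n \<Longrightarrow> t \<in> ball (p i) r \<Longrightarrow> z(i := t) \<in> polydisc n p r"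
  by (auto simp: polydisc_def Cn_def)

lemma filterlim_upd_near:
  assumes "z \<in> Cn n" "i < n"
  shows "filterlim (\<lambda>t. z(i := t)) (near n z) (nhds (z i))"
  unfolding filterlim_iff
proof (intro allI impI)
  fix P assume "eventually P (near n z)"
  then obtain r where r: "r > 0" "\<forall>w\<in>polydisc n z r. P w"
    using assms(1) eventually_near_polydisc by blast
  have "eventually (\<lambda>t. t \<in> ball (z i) r) (nhds (z i))"
    using r by (intro eventually_nhds_in_open) auto
  then show "eventually (\<lambda>t. P (z(i := t))) (nhds (z i))"
    by eventually_elim (use r assms polydisc_upd[OF polydisc_center] in auto)
qed

lemma partial_cong_near:
  assumes "z \<in> Cn n" "i < n" "eventually (\<lambda>w. f w = g w) (near n z)"
  shows "partial i f z = partial i g z"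
  unfolding partial_def
  by (rule deriv_cong_ev[OF _ refl])
    (use filterlim_upd_near[OF assms(1,2)] assms(3) in \<open>auto simp: filterlim_iff\<close>)

lemma eventually_partial_cong:
  assumes "p \<in> Cn n" "i < n" "eventually (\<lambda>w. f w = g w) (near n p)"
  shows "eventually (\<lambda>w. partial i f w = partial i g w) (near n p)"
  using eventually_near_near[OF assms(1,3)]
  by eventually_elim (use partial_cong_near[OF _ assms(2)] in auto)

section \<open>Holomorphic functions on polydiscs and their partial derivatives\<close>

lemma holomorphic_subset: "holomorphic n V f \<Longrightarrow> V' \<subseteq> V \<Longrightarrow> holomorphic n V' f"
  unfolding holomorphic_def using continuous_on_subset by blast

lemma Cn_open_near: "Cn_open n V \<Longrightarrow> z \<in> V \<Longrightarrow> eventually (\<lambda>w. w \<in> V) (near n z)"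
  using eventually_near[of z n] by (metis Cn_open_def openin_imp_subset subsetD)

lemma Cn_open_subset: "Cn_open n V \<Longrightarrow> V \<subseteq> Cn n"
  by (metis Cn_open_def openin_imp_subset)

text \<open>Functions are total, so a coordinate slice could leave \<open>V\<close> and meet
  unrelated values; openness of \<open>V\<close> excludes this near each point.\<close>

lemma holomorphic_cong:
  assumes V: "Cn_open n V" and eq: "\<And>z. z \<in> V \<Longrightarrow> f z = g z" and f: "holomorphic n V f"
  shows "holomorphic n V g"
  unfolding holomorphic_def
proof (intro conjI ballI allI impI)
  show "continuous_on V g"
    using f eq unfolding holomorphic_def by (metis continuous_on_cong)
next
  fix z i assume z: "z \<in> V" "i < n"
  have zC: "z \<in> Cn n" using V z Cn_open_subset by blast
  have "eventually (\<lambda>t. z(i := t) \<in> V) (nhds (z i))"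
    using filterlim_upd_near[OF zC z(2)] Cn_open_near[OF V z(1)] by (auto simp: filterlim_iff)
  then have "eventually (\<lambda>t. f (z(i := t)) = g (z(i := t))) (nhds (z i))"
    by eventually_elim (rule eq)
  moreover obtain D where "((\<lambda>t. f (z(i := t))) has_field_derivative D) (at (z i))"
    using f z unfolding holomorphic_def field_differentiable_def by blast
  ultimately have "((\<lambda>t. g (z(i := t))) has_field_derivative D) (at (z i))"
    using DERIV_cong_ev[OF refl _ refl, of "\<lambda>t. f (z(i := t))" "\<lambda>t. g (z(i := t))"] by simp
  then show "(\<lambda>t. g (z(i := t))) field_differentiable at (z i)"
    by (auto simp: field_differentiable_def)
qed

lemma holomorphic_const: "holomorphic n V (\<lambda>_. c)"
  by (auto simp: holomorphic_def)

lemma holomorphic_coord: "holomorphic n V (\<lambda>z. z k)"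
  unfolding holomorphic_def
proof (intro conjI ballI allI impI)
  show "continuous_on V (\<lambda>z::point. z k)"
    by (rule continuous_on_subset[OF continuous_on_product_coordinates]) auto
  show "(\<lambda>t. (z(i := t)) k) field_differentiable at (z i)" for z :: point and i
    by (cases "i = k") auto
qed

lemma holomorphic_add: "holomorphic n V f \<Longrightarrow> holomorphic n V g \<Longrightarrow> holomorphic n V (\<lambda>z. f z + g z)"
  unfolding holomorphic_def by (auto intro!: continuous_intros field_differentiable_add)

lemma holomorphic_mult: "holomorphic n V f \<Longrightarrow> holomorphic n V g \<Longrightarrow> holomorphic n V (\<lambda>z. f z * g z)"
  unfolding holomorphic_def by (auto intro!: continuous_intros field_differentiable_mult)

lemma holomorphic_inverse:
  "holomorphic n V f \<Longrightarrow> (\<And>z. z \<in> V \<Longrightarrow> f z \<noteq> 0) \<Longrightarrow> holomorphic n V (\<lambda>z. inverse (f z))"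
  unfolding holomorphic_def by (auto intro!: continuous_intros field_differentiable_inverse)

lemma holomorphic_slice:
  assumes "holomorphic n (polydisc n p r) f" "z \<in> polydisc n p r" "i < n"
  shows "(\<lambda>t. f (z(i := t))) holomorphic_on ball (p i) r"
  unfolding holomorphic_on_def
proof
  fix t assume t: "t \<in> ball (p i) r"
  have "(\<lambda>s. f (z(i := t, i := s))) field_differentiable at ((z(i := t)) i)"
    using assms t polydisc_upd unfolding holomorphic_def by blast
  then show "(\<lambda>t. f (z(i := t))) field_differentiable at t within ball (p i) r"
    by (simp add: field_differentiable_at_within)
qed

lemma continuous_on_upd:
  assumes "continuous_on S f" "continuous_on S g"
  shows "continuous_on S (\<lambda>x. (f x :: point)(i := g x))"
proof (rule continuous_on_coordinatewise_then_product)
  fix k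
  show "continuous_on S (\<lambda>x. ((f x)(i := g x)) k)"
    using assms continuous_on_product_then_coordinatewise[OF assms(1), of k]
    by (cases "k = i") auto
qed

lemma continuous_on_partial:
  assumes f: "holomorphic n (polydisc n p r) f" and i: "i < n"
  shows "continuous_on (polydisc n p r) (partial i f)"
proof -
  let ?P = "polydisc n p r"
  have "continuous_on (?P \<times> ball (p i) r) (\<lambda>x. (fst x)(i := snd x))"
    by (intro continuous_on_upd continuous_intros)
  then have "continuous_on (?P \<times> ball (p i) r) (\<lambda>x. f ((fst x)(i := snd x)))"
    by (rule continuous_on_compose2[of ?P f, rotated])
      (use f i polydisc_upd in \<open>auto simp: holomorphic_def\<close>)
  then have "continuous_on (?P \<times> ball (p i) r) (\<lambda>(z, s). f (z(i := s)))"
    by (simp add: case_prod_unfold)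
  then have "continuous_on (?P \<times> ball (p i) r) (\<lambda>(z, s). deriv (\<lambda>s. f (z(i := s))) s)"
    by (rule continuous_on_deriv_param) (use holomorphic_slice[OF f _ i] in auto)
  moreover have "continuous_on ?P (\<lambda>z. (z, z i))"
    by (intro continuous_intros continuous_on_product_then_coordinatewise[OF continuous_on_id])
  ultimately have "continuous_on ?P (\<lambda>z. (\<lambda>(z, s). deriv (\<lambda>s. f (z(i := s))) s) (z, z i))"
    by (rule continuous_on_compose2) (use i in \<open>auto simp: polydisc_def\<close>)
  then show ?thesis by (simp add: partial_def[abs_def])
qed

text \<open>Holomorphy is defined by continuity and differentiability in each variable separately,
  which says nothing direct about differentiating \<open>partial i f\<close> in another variable k.
  Cauchy's formula in the variable i turns it into an integral whose integrand is holomorphic in the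
  variable k.\<close>

lemma holomorphic_partial_polydisc:
  assumes f: "holomorphic n (polydisc n p r) f" and i: "i < n"
  shows "holomorphic n (polydisc n p r) (partial i f)"
  unfolding holomorphic_def
proof (intro conjI ballI allI impI)
  show "continuous_on (polydisc n p r) (partial i f)"
    by (rule continuous_on_partial[OF f i])
next
  let ?P = "polydisc n p r"
  fix z k assume z: "z \<in> ?P" and k: "k < n"
  have zi: "z i \<in> ball (p i) r" "z k \<in> ball (p k) r" using z i k by (auto simp: polydisc_def)
  show "(\<lambda>t. partial i f (z(k := t))) field_differentiable at (z k)"
  proof (cases "k = i")
    case True
    have "deriv (\<lambda>t. f (z(i := t))) holomorphic_on ball (p i) r"
      by (rule holomorphic_deriv[OF holomorphic_slice[OF f z i]]) simp
    then have "deriv (\<lambda>t. f (z(i := t))) field_differentiable at (z i)"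
      using holomorphic_on_imp_differentiable_at zi(1) by blast
    moreover have "(\<lambda>t. partial i f (z(k := t))) = deriv (\<lambda>t. f (z(i := t)))"
      using True by (simp add: partial_def fun_eq_iff)
    ultimately show ?thesis using True by simp
  next
    case False
    have "dist (p i) (z i) < r" using zi by auto
    then obtain q where q: "dist (p i) (z i) < q" "q < r"
      using dense by blast
    then have q0: "q > 0" by (meson le_less_trans zero_le_dist)
    define \<gamma> where "\<gamma> = circlepath (p i) q"
    have \<gamma>: "\<gamma> u \<in> sphere (p i) q" if "u \<in> {0..1}" for u
      using that q0 by (simp add: \<gamma>_def circlepath dist_norm norm_mult)
    have \<gamma>b: "\<gamma> u \<in> ball (p i) r" "\<gamma> u \<noteq> z i" if "u \<in> {0..1}" for u
      using \<gamma>[OF that] q by auto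
    have "continuous_on UNIV \<gamma>"
      unfolding \<gamma>_def circlepath_def part_circlepath_def linepath_def
      by (intro continuous_intros)
    then have \<gamma>c: "continuous_on {0..1} \<gamma>"
      using continuous_on_subset by blast
    \<comment> \<open>The Cauchy kernel pulled back to the unit interval; only the factor
      \<open>f\<close> depends on \<open>s\<close>.\<close>
    define K where "K = (\<lambda>s u. f (z(k := s, i := \<gamma> u)) / (\<gamma> u - z i)\<^sup>2 *
       (2 * pi * \<i> * q * exp (2 * of_real pi * \<i> * of_real u)))"
    have vd: "vector_derivative \<gamma> (at u) = 2 * pi * \<i> * q * exp (2 * of_real pi * \<i> * u)" for u
      by (simp add: \<gamma>_def vector_derivative_circlepath)
    have up: "z(k := s, i := u) \<in> ?P" if "s \<in> ball (p k) r" "u \<in> ball (p i) r" for s u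
      using that polydisc_upd z i k by blast
    have eq: "partial i f (z(k := s)) = 1 / (2 * of_real pi * \<i>) * integral {0..1} (K s)"
      if "s \<in> ball (p k) r" for s
    proof -
      have "(\<lambda>t. f (z(k := s, i := t))) holomorphic_on ball (p i) r"
        by (rule holomorphic_slice[OF f _ i]) (use polydisc_upd[OF z k that] in simp)
      then have "(\<lambda>t. f (z(k := s, i := t))) holomorphic_on cball (p i) q"
        by (rule holomorphic_on_subset) (use q in auto)
      then have "((\<lambda>t. f (z(k := s, i := t))) has_field_derivative (1 / (2 * of_real pi * \<i>) *
                    contour_integral \<gamma> (\<lambda>u. f (z(k := s, i := u)) / (u - z i)\<^sup>2))) (at (z i))"
        unfolding \<gamma>_def
        by (intro Cauchy_derivative_integral_circlepath holomorphic_on_imp_continuous_on)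
          (use q in \<open>auto elim: holomorphic_on_subset\<close>)
      then show ?thesis
        using False by (simp add: partial_def DERIV_imp_deriv K_def contour_integral_integral vd)
    qed
    have fc: "continuous_on ?P f" using f by (simp add: holomorphic_def)
    let ?S = "ball (p k) r \<times> {0..1::real}"
    have c1: "continuous_on ?S (\<lambda>x. \<gamma> (snd x))"
      by (rule continuous_on_compose2[OF \<gamma>c]) (auto intro!: continuous_intros)
    have "continuous_on ?S (\<lambda>x. z(k := fst x, i := \<gamma> (snd x)))"
      by (intro continuous_on_upd continuous_intros c1)
    then have c2: "continuous_on ?S (\<lambda>x. f (z(k := fst x, i := \<gamma> (snd x))))"
      by (rule continuous_on_compose2[OF fc]) (use \<gamma>b up in auto)
    have nz: "(\<gamma> (snd x) - z i)\<^sup>2 \<noteq> 0" if "x \<in> ?S" for x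
      using \<gamma>b(2)[of "snd x"] that by (auto simp: mem_Times_iff)
    have "continuous_on ?S (\<lambda>(s, u). K s u)"
      unfolding K_def case_prod_unfold
      by (intro continuous_intros c1 c2 nz ballI)
    moreover have "(\<lambda>s. K s u) holomorphic_on ball (p k) r" if "u \<in> {0..1}" for u
    proof -
      have "(\<lambda>s. f (z(i := \<gamma> u, k := s))) holomorphic_on ball (p k) r"
        by (rule holomorphic_slice[OF f _ k]) (use polydisc_upd[OF z i \<gamma>b(1)[OF that]] in simp)
      then have "(\<lambda>s. f (z(k := s, i := \<gamma> u))) holomorphic_on ball (p k) r"
        using False by (simp add: fun_upd_twist)
      then show ?thesis
        unfolding K_def by (intro holomorphic_intros) (use \<gamma>b(2)[OF that] in auto)
    qed
    ultimately have "(\<lambda>s. integral {0..1} (K s)) holomorphic_on ball (p k) r"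
      by (rule holomorphic_on_integral_param)
    then have "(\<lambda>s. 1 / (2 * of_real pi * \<i>) * integral {0..1} (K s)) holomorphic_on ball (p k) r"
      by (intro holomorphic_intros)
    then have "(\<lambda>s. partial i f (z(k := s))) holomorphic_on ball (p k) r"
      by (rule holomorphic_transform) (use eq in simp)
    then show ?thesis
      using holomorphic_on_imp_differentiable_at zi(2) by blast
  qed
qed

section \<open>Germs at a point and the rules of differentiation\<close>

definition holo_at :: "nat \<Rightarrow> point \<Rightarrow> (point \<Rightarrow> complex) \<Rightarrow> bool" where
  "holo_at n p f \<longleftrightarrow> (\<exists>N. Cn_open n N \<and> p \<in> N \<and> holomorphic n N f)"

lemma holo_at_Cn: "holo_at n p f \<Longrightarrow> p \<in> Cn n"
  unfolding holo_at_def using Cn_open_subset by blast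

lemma holo_at_polydisc:
  assumes "holo_at n p f"
  obtains r where "r > 0" "holomorphic n (polydisc n p r) f"
  using assms Cn_open_contains_polydisc holomorphic_subset unfolding holo_at_def by metis

lemma holo_at_polydiscI:
  "p \<in> Cn n \<Longrightarrow> r > 0 \<Longrightarrow> holomorphic n (polydisc n p r) f \<Longrightarrow> holo_at n p f"
  unfolding holo_at_def using Cn_open_polydisc polydisc_center by blast

lemma holo_at_tendsto:
  assumes "holo_at n p f"
  shows "(f \<longlongrightarrow> f p) (near n p)"
proof -
  obtain N where N: "Cn_open n N" "p \<in> N" "continuous_on N f"
    using assms unfolding holo_at_def holomorphic_def by blast
  obtain U where U: "open U" "N = Cn n \<inter> U"
    using N(1) unfolding Cn_open_def openin_open by auto
  have l: "(f \<longlongrightarrow> f p) (at p within N)"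
    using N by (auto simp: continuous_on_def)
  show ?thesis
  proof (rule topological_tendstoI)
    fix S assume S: "open S" "f p \<in> S"
    then obtain T where T: "open T" "p \<in> T" "\<forall>x\<in>T. x \<noteq> p \<longrightarrow> x \<in> N \<longrightarrow> f x \<in> S"
      using topological_tendstoD[OF l] unfolding eventually_at_topological by blast
    show "eventually (\<lambda>x. f x \<in> S) (near n p)"
      unfolding eventually_inf_principal eventually_nhds
      using T U S N(2) by (intro exI[of _ "T \<inter> U"]) auto
  qed
qed

lemma holo_at_differentiable:
  "holo_at n p f \<Longrightarrow> i < n \<Longrightarrow> (\<lambda>t. f (p(i := t))) field_differentiable at (p i)"
  unfolding holo_at_def holomorphic_def by blast

lemma holo_at_partial_deriv:
  "holo_at n p f \<Longrightarrow> i < n \<Longrightarrow> ((\<lambda>t. f (p(i := t))) has_field_derivative partial i f p) (at (p i))"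
  unfolding partial_def using holo_at_differentiable field_differentiable_derivI by blast

lemma eventually_holo_at:
  assumes "holo_at n p f"
  shows "eventually (\<lambda>q. holo_at n q f) (near n p)"
  unfolding eventually_near[OF holo_at_Cn[OF assms]]
  using assms unfolding holo_at_def by blast

lemma tendsto_at_within_near:
  assumes "S \<subseteq> Cn n" "(f \<longlongrightarrow> l) (near n p)"
  shows "(f \<longlongrightarrow> l) (at p within S)"
proof (rule tendsto_mono[OF _ assms(2)])
  show "at p within S \<le> near n p"
    unfolding at_within_def using assms(1)
    by (intro inf_mono order_refl) auto
qed

lemma holo_atI:
  assumes p: "p \<in> Cn n"
    and ev: "eventually (\<lambda>z. (f \<longlongrightarrow> f z) (near n z) \<and>
      (\<forall>i<n. (\<lambda>t. f (z(i := t))) field_differentiable at (z i))) (near n p)"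
  shows "holo_at n p f"
proof -
  obtain N where N: "Cn_open n N" "p \<in> N" "\<And>z. z \<in> N \<Longrightarrow> (f \<longlongrightarrow> f z) (near n z)"
    "\<And>z i. z \<in> N \<Longrightarrow> i < n \<Longrightarrow> (\<lambda>t. f (z(i := t))) field_differentiable at (z i)"
    using ev unfolding eventually_near[OF p] by blast
  have "continuous_on N f"
    unfolding continuous_on_def
    using N(3) tendsto_at_within_near[OF Cn_open_subset[OF N(1)]] by blast
  then show ?thesis using N unfolding holo_at_def holomorphic_def by blast
qed

lemma holo_at_common:
  assumes "holo_at n p f" "holo_at n p g"
  obtains N where "Cn_open n N" "p \<in> N" "holomorphic n N f" "holomorphic n N g"
proof -
  obtain M N where MN: "Cn_open n M" "p \<in> M" "holomorphic n M f"
    "Cn_open n N" "p \<in> N" "holomorphic n N g"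
    using assms unfolding holo_at_def by blast
  show ?thesis
    by (rule that[of "M \<inter> N"])
      (use MN holomorphic_subset in \<open>auto simp: Cn_open_def\<close>)
qed

lemma holo_at_add: "holo_at n p f \<Longrightarrow> holo_at n p g \<Longrightarrow> holo_at n p (\<lambda>z. f z + g z)"
  by (erule (1) holo_at_common) (auto simp: holo_at_def intro: holomorphic_add)

lemma holo_at_mult: "holo_at n p f \<Longrightarrow> holo_at n p g \<Longrightarrow> holo_at n p (\<lambda>z. f z * g z)"
  by (erule (1) holo_at_common) (auto simp: holo_at_def intro: holomorphic_mult)

lemma holo_at_const: "p \<in> Cn n \<Longrightarrow> holo_at n p (\<lambda>_. c)"
  by (rule holo_at_polydiscI[of _ _ 1]) (auto intro: holomorphic_const)

lemma holo_at_coord: "p \<in> Cn n \<Longrightarrow> holo_at n p (\<lambda>z. z k)"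
  by (rule holo_at_polydiscI[of _ _ 1]) (auto intro: holomorphic_coord)

lemma holo_at_uminus: "holo_at n p f \<Longrightarrow> holo_at n p (\<lambda>z. - f z)"
  using holo_at_mult[OF holo_at_const[of p n "-1"], of f] holo_at_Cn by simp

lemma holo_at_diff: "holo_at n p f \<Longrightarrow> holo_at n p g \<Longrightarrow> holo_at n p (\<lambda>z. f z - g z)"
  using holo_at_add[OF _ holo_at_uminus, of n p f g] by simp

lemma holo_at_sum:
  "p \<in> Cn n \<Longrightarrow> (\<And>i. i \<in> I \<Longrightarrow> holo_at n p (f i)) \<Longrightarrow> holo_at n p (\<lambda>z. \<Sum>i\<in>I. f i z)"
  by (induction I rule: infinite_finite_induct) (auto intro: holo_at_const holo_at_add)

lemma holo_at_power: "holo_at n p f \<Longrightarrow> holo_at n p (\<lambda>z. f z ^ k)"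
  by (induction k) (auto intro: holo_at_const holo_at_mult holo_at_Cn)

lemmas holo_intros = holo_at_add holo_at_mult holo_at_diff holo_at_uminus holo_at_sum
  holo_at_power holo_at_const holo_at_coord

lemma holo_at_cong:
  assumes "holo_at n p f" "eventually (\<lambda>z. f z = g z) (near n p)"
  shows "holo_at n p g"
proof -
  obtain N where N: "Cn_open n N" "p \<in> N" "\<forall>z\<in>N. f z = g z"
    using assms(2) eventually_near[OF holo_at_Cn[OF assms(1)]] by blast
  obtain M where M: "Cn_open n M" "p \<in> M" "holomorphic n M f"
    using assms(1) unfolding holo_at_def by blast
  have o: "Cn_open n (M \<inter> N)" using M N by (auto simp: Cn_open_def)
  have "holomorphic n (M \<inter> N) g"
    by (rule holomorphic_cong[OF o _ holomorphic_subset[OF M(3)]]) (use N in auto)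
  then show ?thesis unfolding holo_at_def using o M N by blast
qed

lemma holo_at_inverse:
  assumes "holo_at n p f" "f p \<noteq> 0"
  shows "holo_at n p (\<lambda>z. inverse (f z))"
proof -
  have "eventually (\<lambda>z. f z \<noteq> 0) (near n p)"
    using tendsto_imp_eventually_ne[OF holo_at_tendsto[OF assms(1)] assms(2)] .
  then obtain N where N: "Cn_open n N" "p \<in> N" "\<forall>z\<in>N. f z \<noteq> 0"
    using eventually_near[OF holo_at_Cn[OF assms(1)]] by blast
  obtain M where M: "Cn_open n M" "p \<in> M" "holomorphic n M f"
    using assms(1) unfolding holo_at_def by blast
  have "holomorphic n (M \<inter> N) (\<lambda>z. inverse (f z))"
    by (rule holomorphic_inverse[OF holomorphic_subset[OF M(3)]]) (use N in auto)
  moreover have "Cn_open n (M \<inter> N)" using M N by (auto simp: Cn_open_def)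
  ultimately show ?thesis unfolding holo_at_def using M N by blast
qed

lemma holo_at_partial:
  assumes "holo_at n p f" "i < n"
  shows "holo_at n p (partial i f)"
  using assms holo_at_polydisc holo_at_polydiscI holomorphic_partial_polydisc holo_at_Cn by metis

lemma partial_add:
  assumes "holo_at n p f" "holo_at n p g" "i < n"
  shows "partial i (\<lambda>z. f z + g z) p = partial i f p + partial i g p"
  using DERIV_add[OF holo_at_partial_deriv[OF assms(1,3)] holo_at_partial_deriv[OF assms(2,3)]]
  unfolding partial_def[of i "\<lambda>z. f z + g z"] by (rule DERIV_imp_deriv)

lemma partial_mult:
  assumes "holo_at n p f" "holo_at n p g" "i < n"
  shows "partial i (\<lambda>z. f z * g z) p = partial i f p * g p + f p * partial i g p"
  using DERIV_mult[OF holo_at_partial_deriv[OF assms(1,3)] holo_at_partial_deriv[OF assms(2,3)]]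
  unfolding partial_def[of i "\<lambda>z. f z * g z"] by (auto intro!: DERIV_imp_deriv simp: mult.commute)

lemma partial_const: "partial i (\<lambda>_. c) p = 0"
  by (simp add: partial_def)

lemma partial_coord: "partial i (\<lambda>z. z j) p = (if i = j then 1 else 0)"
  by (simp add: partial_def)

lemma partial_coord_diff: "partial i (\<lambda>z. z j - c) p = (if i = j then 1 else 0)"
  unfolding partial_def by (auto intro!: DERIV_imp_deriv derivative_eq_intros)

lemma partial_cmult:
  assumes "holo_at n p f" "i < n"
  shows "partial i (\<lambda>z. c * f z) p = c * partial i f p"
  using partial_mult[OF holo_at_const[OF holo_at_Cn[OF assms(1)]] assms, of c]
  by (simp add: partial_const)

lemma partial_sum:
  assumes "p \<in> Cn n" "\<And>j. j \<in> J \<Longrightarrow> holo_at n p (f j)" "i < n"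
  shows "partial i (\<lambda>z. \<Sum>j\<in>J. f j z) p = (\<Sum>j\<in>J. partial i (f j) p)"
  using assms
proof (induction J rule: infinite_finite_induct)
  case (insert x F)
  then show ?case using partial_add[of n p "f x" "\<lambda>z. \<Sum>j\<in>F. f j z" i]
    by (simp add: holo_at_sum)
qed (auto simp: partial_const)

section \<open>Hadamard's lemma and the symmetry of second derivatives\<close>

lemma holomorphic_subst_center:
  assumes f: "holomorphic n (polydisc n p r) f" and i: "i < n" and r: "r > 0"
  shows "holomorphic n (polydisc n p r) (\<lambda>z. f (z(i := p i)))"
  unfolding holomorphic_def
proof (intro conjI ballI allI impI)
  have up: "z(i := p i) \<in> polydisc n p r" if "z \<in> polydisc n p r" for z
    using polydisc_upd that i r by auto
  have "continuous_on (polydisc n p r) (\<lambda>z. z(i := p i))"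
    by (intro continuous_on_upd continuous_intros)
  then show "continuous_on (polydisc n p r) (\<lambda>z. f (z(i := p i)))"
    by (rule continuous_on_compose2[of "polydisc n p r" f, rotated])
      (use f up in \<open>auto simp: holomorphic_def\<close>)
  fix z k assume z: "z \<in> polydisc n p r" and k: "k < n"
  show "(\<lambda>t. f (z(k := t, i := p i))) field_differentiable at (z k)"
  proof (cases "k = i")
    case False
    then have "(\<lambda>t. f (z(k := t, i := p i))) = (\<lambda>t. f (z(i := p i, k := t)))"
      by (simp add: fun_upd_twist)
    moreover have "(\<lambda>t. f (z(i := p i, k := t))) field_differentiable at ((z(i := p i)) k)"
      using f up[OF z] k unfolding holomorphic_def by blast
    ultimately show ?thesis using False by simp
  qed simp
qed

text \<open>The quotient is taken as the mean of \<open>partial i f\<close> over the segment from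
  \<open>p i\<close> to \<open>z i\<close>, which is holomorphic also where z i = p i and the naive
  quotient is undefined.\<close>

lemma difference_quotient:
  assumes f: "holomorphic n (polydisc n p r) f" and i: "i < n" and r: "r > 0"
  obtains k where "holomorphic n (polydisc n p r) k"
    "\<And>z. z \<in> polydisc n p r \<Longrightarrow> f z = f (z(i := p i)) + (z i - p i) * k z"
proof -
  let ?P = "polydisc n p r"
  define w where "w = (\<lambda>s (t::real). p i + of_real t * (s - p i))"
  have wb: "w s t \<in> ball (p i) r" if "s \<in> ball (p i) r" "t \<in> {0..1}" for s t
  proof -
    have "norm (of_real t * (s - p i)) \<le> 1 * norm (s - p i)"
      unfolding norm_mult using that by (intro mult_right_mono) auto
    then show ?thesis using that by (simp add: w_def dist_norm norm_minus_commute)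
  qed
  have up: "z(i := w (z i) t) \<in> ?P" if "z \<in> ?P" "t \<in> {0..1}" for z t
    using polydisc_upd[OF that(1) i wb] that i by (auto simp: polydisc_def)
  define g where "g = (\<lambda>z t. partial i f (z(i := w (z i) t)))"
  have pf: "holomorphic n ?P (partial i f)" by (rule holomorphic_partial_polydisc[OF f i])
  then have pc: "continuous_on ?P (partial i f)" by (simp add: holomorphic_def)
  have gc: "continuous_on (S \<times> {0..1}) (\<lambda>(x, t). g (z x) t)"
    if "continuous_on S z" "z ` S \<subseteq> ?P" for z and S :: "'b::topological_space set"
  proof -
    have c: "continuous_on (S \<times> {0..1::real}) (\<lambda>x. z (fst x))"
      by (rule continuous_on_compose2[OF that(1)]) (auto intro!: continuous_intros)
    have "continuous_on (S \<times> {0..1::real}) (\<lambda>x. (z (fst x))(i := w (z (fst x) i) (snd x)))"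
      unfolding w_def
      by (intro continuous_on_upd continuous_intros continuous_on_product_then_coordinatewise[OF c] c)
    then have "continuous_on (S \<times> {0..1::real}) (\<lambda>x. g (z (fst x)) (snd x))"
      unfolding g_def by (rule continuous_on_compose2[OF pc]) (use up that in auto)
    then show ?thesis by (simp add: case_prod_unfold)
  qed
  define k where "k = (\<lambda>z. integral {0..1} (g z))"
  have "holomorphic n ?P k"
    unfolding holomorphic_def
  proof (intro conjI ballI allI impI)
    have "continuous_on (?P \<times> cbox 0 1) (\<lambda>(z, t). g z t)"
      using gc[of ?P "\<lambda>z. z"] by simp
    then show "continuous_on ?P k"
      unfolding k_def using integral_continuous_on_param[of ?P 0 "1::real" g] by simp
  next
    fix z l assume z: "z \<in> ?P" and l: "l < n"
    have zl: "z l \<in> ball (p l) r" "z i \<in> ball (p i) r" using z l i by (auto simp: polydisc_def)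
    have "continuous_on (ball (p l) r) (\<lambda>s. z(l := s))"
      by (intro continuous_on_upd continuous_intros)
    then have "continuous_on (ball (p l) r \<times> {0..1}) (\<lambda>(s, t). g (z(l := s)) t)"
      by (rule gc) (use polydisc_upd[OF z l] in auto)
    moreover have "(\<lambda>s. g (z(l := s)) t) holomorphic_on ball (p l) r" if t: "t \<in> {0..1}" for t
    proof (cases "l = i")
      case True
      have "(\<lambda>s. partial i f (z(i := s))) holomorphic_on ball (p i) r"
        by (rule holomorphic_slice[OF pf z i])
      then have "((\<lambda>s. partial i f (z(i := s))) \<circ> (\<lambda>s. w s t)) holomorphic_on ball (p i) r"
        by (rule holomorphic_on_compose_gen[rotated])
          (use wb t in \<open>auto simp: w_def intro!: holomorphic_intros\<close>)
      then show ?thesis using True by (simp add: g_def o_def)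
    next
      case False
      have "(\<lambda>s. partial i f (z(i := w (z i) t, l := s))) holomorphic_on ball (p l) r"
        by (rule holomorphic_slice[OF pf up[OF z t] l])
      then show ?thesis using False by (simp add: g_def fun_upd_twist)
    qed
    ultimately have "(\<lambda>s. integral {0..1} (g (z(l := s)))) holomorphic_on ball (p l) r"
      by (rule holomorphic_on_integral_param)
    then show "(\<lambda>t. k (z(l := t))) field_differentiable at (z l)"
      unfolding k_def using holomorphic_on_imp_differentiable_at zl(1) by blast
  qed
  moreover have "f z = f (z(i := p i)) + (z i - p i) * k z" if z: "z \<in> ?P" for z
  proof -
    have zi: "z i \<in> ball (p i) r" using z i by (auto simp: polydisc_def)
    have "((\<lambda>t. f (z(i := w (z i) t))) has_vector_derivative (z i - p i) * g z t) (at t within {0..1})"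
      if t: "t \<in> {0..1}" for t
    proof -
      have "((\<lambda>s. f (z(i := s))) has_field_derivative partial i f (z(i := w (z i) t))) (at (w (z i) t))"
        using holomorphic_derivI[OF holomorphic_slice[OF f z i] open_ball wb[OF zi t], of UNIV]
        by (simp add: partial_def)
      moreover have "(w (z i) has_vector_derivative (z i - p i)) (at t)"
        unfolding w_def by (auto intro!: derivative_eq_intros)
      ultimately have "((\<lambda>s. f (z(i := s))) \<circ> w (z i) has_vector_derivative (z i - p i) * g z t) (at t)"
        unfolding g_def by (intro field_vector_diff_chain_at)
      then show ?thesis
        by (auto simp: o_def intro: has_vector_derivative_at_within)
    qed
    from fundamental_theorem_of_calculus[OF _ this]
    have "((\<lambda>t. (z i - p i) * g z t) has_integral f (z(i := w (z i) 1)) - f (z(i := w (z i) 0))) {0..1}"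
      by simp
    then have "(z i - p i) * k z = f (z(i := w (z i) 1)) - f (z(i := w (z i) 0))"
      unfolding k_def by (metis integral_mult_right integral_unique)
    then show ?thesis by (simp add: w_def)
  qed
  ultimately show ?thesis by (rule that)
qed

text \<open>The coordinates are frozen at \<open>p\<close> one after another, each at the cost of
  one difference quotient. First-order expansions of this kind do the work of power series: they
  yield the chain rule, the symmetry of second derivatives and the comparison of lifts.\<close>

lemma hadamard:
  assumes "holo_at n p f"
  obtains h where "\<And>i. i < n \<Longrightarrow> holo_at n p (h i)"
    "eventually (\<lambda>z. f z = f p + (\<Sum>i<n. (z i - p i) * h i z)) (near n p)"
proof -
  have p: "p \<in> Cn n" by (rule holo_at_Cn[OF assms])
  obtain r where r: "r > 0" "holomorphic n (polydisc n p r) f"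
    using holo_at_polydisc[OF assms] .
  let ?P = "polydisc n p r"
  have "\<exists>h. (\<forall>i<m. holomorphic n ?P (h i)) \<and>
     (\<forall>z\<in>?P. f z = f (\<lambda>j. if j < m then p j else z j) + (\<Sum>i<m. (z i - p i) * h i z)) \<and>
     holomorphic n ?P (\<lambda>z. f (\<lambda>j. if j < m then p j else z j))" if "m \<le> n" for m
    using that
  proof (induction m)
    case 0
    then show ?case using r by simp
  next
    case (Suc m)
    let ?g = "\<lambda>z. f (\<lambda>j. if j < m then p j else z j)"
    obtain h where h: "\<forall>i<m. holomorphic n ?P (h i)"
     "\<forall>z\<in>?P. f z = ?g z + (\<Sum>i<m. (z i - p i) * h i z)" "holomorphic n ?P ?g"
      using Suc by auto
    have m: "m < n" using Suc by simp
    obtain k where k: "holomorphic n ?P k"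
      "\<And>z. z \<in> ?P \<Longrightarrow> ?g z = ?g (z(m := p m)) + (z m - p m) * k z"
      by (rule difference_quotient[OF h(3) m r(1)]) (rule that)
    have eq: "(\<lambda>j. if j < m then p j else (z(m := p m)) j) = (\<lambda>j. if j < Suc m then p j else z j)" for z
      by (auto simp: less_Suc_eq)
    have "holomorphic n ?P (\<lambda>z. f (\<lambda>j. if j < Suc m then p j else z j))"
      using holomorphic_subst_center[OF h(3) m r(1)] unfolding eq .
    then show ?case
      using h(1,2) k eq by (intro exI[of _ "h(m := k)"]) (auto simp: less_Suc_eq)
  qed
  from this[of n] obtain h where h: "\<And>i. i < n \<Longrightarrow> holomorphic n ?P (h i)"
     "\<And>z. z \<in> ?P \<Longrightarrow> f z = f (\<lambda>j. if j < n then p j else z j) + (\<Sum>i<n. (z i - p i) * h i z)"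
    by auto
  have "f (\<lambda>j. if j < n then p j else z j) = f p" if "z \<in> ?P" for z
    using that p by (intro arg_cong[of _ _ f]) (auto simp: polydisc_def Cn_def)
  then have "f z = f p + (\<Sum>i<n. (z i - p i) * h i z)" if "z \<in> ?P" for z
    using h(2)[OF that] that by (simp only:)
  then have "eventually (\<lambda>z. f z = f p + (\<Sum>i<n. (z i - p i) * h i z)) (near n p)"
    unfolding eventually_near_polydisc[OF p] using r(1) by blast
  with h(1) show ?thesis
    using that holo_at_polydiscI[OF p r(1)] by blast
qed

text \<open>The centre \<open>a\<close> may differ from \<open>p\<close>: second derivatives require
  the formula at all points near the centre of the expansion.\<close>

lemma partial_hadamard:
  assumes f: "p \<in> Cn n" "\<And>i. i < n \<Longrightarrow> holo_at n p (h i)" "j < n"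
    and ev: "eventually (\<lambda>z. f z = c + (\<Sum>i<n. (z i - a i) * h i z)) (near n p)"
  shows "partial j f p = h j p + (\<Sum>i<n. (p i - a i) * partial j (h i) p)"
proof -
  have "partial j f p = partial j (\<lambda>z. c + (\<Sum>i<n. (z i - a i) * h i z)) p"
    by (rule partial_cong_near[OF f(1,3) ev])
  also have "\<dots> = (\<Sum>i<n. partial j (\<lambda>z. (z i - a i) * h i z) p)"
    using f by (subst partial_add[of n] partial_sum[of _ n], auto intro!: holo_intros simp: partial_const)+
  also have "\<dots> = (\<Sum>i<n. (if j = i then 1 else 0) * h i p + (p i - a i) * partial j (h i) p)"
    using f by (intro sum.cong refl, subst partial_mult[of n])
      (auto intro!: holo_intros simp: partial_coord_diff)
  also have "\<dots> = h j p + (\<Sum>i<n. (p i - a i) * partial j (h i) p)"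
    using f(3) by (simp add: sum.distrib if_distrib[of "\<lambda>x. x * _"] cong: if_cong)
  finally show ?thesis .
qed

text \<open>Differentiating a Hadamard expansion twice at its centre gives the derivative of h_l in
  direction k plus that of h_k in direction l, which is symmetric in k and l.\<close>

lemma partial_commute:
  assumes f: "holo_at n p f" "i < n" "j < n"
  shows "partial i (partial j f) p = partial j (partial i f) p"
proof -
  have p: "p \<in> Cn n" by (rule holo_at_Cn[OF f(1)])
  obtain h where h: "\<And>i. i < n \<Longrightarrow> holo_at n p (h i)"
    "eventually (\<lambda>z. f z = f p + (\<Sum>i<n. (z i - p i) * h i z)) (near n p)"
    by (rule hadamard[OF f(1)]) (rule that)
  have *: "partial k (partial l f) p = partial k (h l) p + partial l (h k) p" if "k < n" "l < n" for k l
  proof -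
    have "eventually (\<lambda>q. \<forall>i\<in>{..<n}. holo_at n q (h i)) (near n p)"
      using h(1) eventually_holo_at by (intro eventually_ball_finite) auto
    with eventually_near_near[OF p h(2)]
    have "eventually (\<lambda>q. partial l f q = h l q + (\<Sum>i<n. (q i - p i) * partial l (h i) q)) (near n p)"
      by eventually_elim (use partial_hadamard[OF _ _ that(2)] in auto)
    then have "partial k (partial l f) p =
        partial k (\<lambda>q. h l q + (\<Sum>i<n. (q i - p i) * partial l (h i) q)) p"
      by (rule partial_cong_near[OF p that(1)])
    also have "\<dots> = partial k (h l) p + partial k (\<lambda>q. 0 + (\<Sum>i<n. (q i - p i) * partial l (h i) q)) p"
      using h that p by (subst partial_add[of n]) (auto intro!: holo_intros holo_at_partial)
    also have "partial k (\<lambda>q. 0 + (\<Sum>i<n. (q i - p i) * partial l (h i) q)) p = partial l (h k) p"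
      using partial_hadamard[OF p, of "\<lambda>i. partial l (h i)" k
          "\<lambda>q. 0 + (\<Sum>i<n. (q i - p i) * partial l (h i) q)" 0 p] h(1) that
      by (simp add: holo_at_partial)
    finally show ?thesis .
  qed
  show ?thesis using *[OF f(2,3)] *[OF f(3,2)] by simp
qed

section \<open>Composition\<close>

definition subst :: "nat \<Rightarrow> (nat \<Rightarrow> point \<Rightarrow> complex) \<Rightarrow> point \<Rightarrow> point" where
  "subst n \<gamma> z = (\<lambda>i. if i < n then \<gamma> i z else 0)"

lemma subst_in_Cn: "subst n \<gamma> z \<in> Cn n"
  by (auto simp: subst_def Cn_def)

lemma filterlim_subst:
  assumes "\<And>i. i < n \<Longrightarrow> holo_at m p (\<gamma> i)"
  shows "filterlim (subst n \<gamma>) (near n (subst n \<gamma> p)) (near m p)"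
  unfolding filterlim_iff
proof (intro allI impI)
  fix P assume "eventually P (near n (subst n \<gamma> p))"
  then obtain r where r: "r > 0" "\<forall>w\<in>polydisc n (subst n \<gamma> p) r. P w"
    using eventually_near_polydisc[OF subst_in_Cn] by blast
  have "eventually (\<lambda>z. \<forall>i\<in>{..<n}. \<gamma> i z \<in> ball (\<gamma> i p) r) (near m p)"
    using holo_at_tendsto[OF assms] r(1)
    by (intro eventually_ball_finite ballI topological_tendstoD[of "\<gamma> _"]) auto
  then show "eventually (\<lambda>z. P (subst n \<gamma> z)) (near m p)"
    by eventually_elim (use r(2) in \<open>auto simp: polydisc_def subst_def Cn_def\<close>)
qed

text \<open>By Hadamard's lemma for \<open>f\<close>, the difference quotient of the composite is a
  sum of difference quotients of the \<gamma>_i times continuous factors h_i. No total derivative is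
  involved.\<close>

lemma chain_rule:
  assumes g: "\<And>i. i < n \<Longrightarrow> holo_at m p (\<gamma> i)" and f: "holo_at n (subst n \<gamma> p) f"
    and p: "p \<in> Cn m" and k: "k < m"
  shows "((\<lambda>t. f (subst n \<gamma> (p(k := t)))) has_field_derivative
     (\<Sum>i<n. partial i f (subst n \<gamma> p) * partial k (\<gamma> i) p)) (at (p k))"
proof -
  let ?q = "subst n \<gamma> p" and ?G = "\<lambda>t. subst n \<gamma> (p(k := t))"
  obtain h where h: "\<And>i. i < n \<Longrightarrow> holo_at n ?q (h i)"
    "eventually (\<lambda>z. f z = f ?q + (\<Sum>i<n. (z i - ?q i) * h i z)) (near n ?q)"
    by (rule hadamard[OF f]) (rule that)
  have G: "filterlim ?G (near n ?q) (nhds (p k))"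
    by (rule filterlim_compose[OF filterlim_subst[OF g] filterlim_upd_near[OF p k]])
  have "eventually (\<lambda>t. f (?G t) = f ?q + (\<Sum>i<n. (?G t i - ?q i) * h i (?G t))) (nhds (p k))"
    using G h(2) unfolding filterlim_iff by blast
  then have ev: "eventually (\<lambda>t. f (?G t) = f ?q + (\<Sum>i<n. (\<gamma> i (p(k := t)) - \<gamma> i p) * h i (?G t))) (nhds (p k))"
    by eventually_elim (simp add: subst_def)
  have d: "((\<lambda>t. (\<gamma> i (p(k := t)) - \<gamma> i p) * h i (?G t)) has_field_derivative
      partial i f ?q * partial k (\<gamma> i) p) (at (p k))" if i: "i < n" for i
  proof -
    have a: "partial i f ?q = h i ?q"
      using partial_hadamard[OF subst_in_Cn h(1) i h(2)] by simp
    have b: "((\<lambda>t. h i (?G t)) \<longlongrightarrow> h i ?q) (at (p k))"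
      by (rule tendsto_mono[OF at_within_le_nhds])
        (rule filterlim_compose[OF holo_at_tendsto[OF h(1)[OF i]] G])
    have c: "((\<lambda>t. (\<gamma> i (p(k := t)) - \<gamma> i p) / (t - p k)) \<longlongrightarrow> partial k (\<gamma> i) p) (at (p k))"
      using holo_at_partial_deriv[OF g[OF i] k] by (simp add: has_field_derivative_iff)
    show ?thesis
      using tendsto_mult[OF c b] by (simp add: a has_field_derivative_iff mult.commute)
  qed
  have "((\<lambda>t. f ?q + (\<Sum>i<n. (\<gamma> i (p(k := t)) - \<gamma> i p) * h i (?G t))) has_field_derivative
      0 + (\<Sum>i<n. partial i f ?q * partial k (\<gamma> i) p)) (at (p k))"
    by (intro DERIV_add DERIV_const DERIV_sum d) auto
  then show ?thesis
    using DERIV_cong_ev[OF refl ev refl] by simp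
qed

lemma holo_at_compose:
  assumes g: "\<And>i. i < n \<Longrightarrow> holo_at m p (\<gamma> i)" and f: "holo_at n (subst n \<gamma> p) f"
    and p: "p \<in> Cn m"
  shows "holo_at m p (\<lambda>z. f (subst n \<gamma> z))"
proof (rule holo_atI[OF p])
  have "eventually (\<lambda>z. z \<in> Cn m) (near m p)"
    by (simp add: eventually_inf_principal)
  moreover have "eventually (\<lambda>z. \<forall>i\<in>{..<n}. holo_at m z (\<gamma> i)) (near m p)"
    using g eventually_holo_at by (intro eventually_ball_finite) auto
  moreover have "eventually (\<lambda>z. holo_at n (subst n \<gamma> z) f) (near m p)"
    by (rule eventually_compose_filterlim[OF eventually_holo_at[OF f] filterlim_subst[OF g]])
  ultimately show "eventually (\<lambda>z. ((\<lambda>z. f (subst n \<gamma> z)) \<longlongrightarrow> f (subst n \<gamma> z)) (near m z) \<and>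
      (\<forall>i<m. (\<lambda>t. f (subst n \<gamma> (z(i := t)))) field_differentiable at (z i))) (near m p)"
  proof eventually_elim
    case (elim z)
    then show ?case
      using chain_rule[of n m z \<gamma> f] filterlim_compose[OF holo_at_tendsto filterlim_subst, of n \<gamma> z f m]
      unfolding field_differentiable_def by blast
  qed
qed

lemma partial_compose:
  assumes g: "\<And>i. i < n \<Longrightarrow> holo_at m p (\<gamma> i)" and f: "holo_at n (subst n \<gamma> p) f"
    and p: "p \<in> Cn m" and k: "k < m"
  shows "eventually (\<lambda>z. partial k (\<lambda>z. f (subst n \<gamma> z)) z =
     (\<Sum>i<n. partial i f (subst n \<gamma> z) * partial k (\<gamma> i) z)) (near m p)"
proof -
  have "eventually (\<lambda>z. z \<in> Cn m) (near m p)"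
    by (simp add: eventually_inf_principal)
  moreover have "eventually (\<lambda>z. \<forall>i\<in>{..<n}. holo_at m z (\<gamma> i)) (near m p)"
    using g eventually_holo_at by (intro eventually_ball_finite) auto
  moreover have "eventually (\<lambda>z. holo_at n (subst n \<gamma> z) f) (near m p)"
    by (rule eventually_compose_filterlim[OF eventually_holo_at[OF f] filterlim_subst[OF g]])
  ultimately show ?thesis
    by eventually_elim
      (unfold partial_def[of k "\<lambda>z. f (subst n \<gamma> z)"], rule DERIV_imp_deriv, rule chain_rule[OF _ _ _ k], auto)
qed

section \<open>Taylor coefficients at the origin of the plane\<close>

lemma origin_Cn [simp]: "origin \<in> Cn n"
  by (simp add: Cn_def)

lemma holo_at_funpow_partial: "holo_at n p f \<Longrightarrow> i < n \<Longrightarrow> holo_at n p ((partial i ^^ k) f)"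
  by (induction k) (auto intro: holo_at_partial)

lemma eventually_funpow_partial_cong:
  assumes "p \<in> Cn n" "i < n" "eventually (\<lambda>z. f z = g z) (near n p)"
  shows "eventually (\<lambda>z. (partial i ^^ k) f z = (partial i ^^ k) g z) (near n p)"
  by (induction k) (use assms in \<open>auto intro: eventually_partial_cong\<close>)

lemma eventually_funpow_partial_add:
  assumes "holo_at n p f" "holo_at n p g" "i < n"
  shows "eventually (\<lambda>z. (partial i ^^ k) (\<lambda>z. f z + g z) z = (partial i ^^ k) f z + (partial i ^^ k) g z) (near n p)"
proof (induction k)
  case (Suc k)
  have "eventually (\<lambda>z. partial i ((partial i ^^ k) (\<lambda>z. f z + g z)) z =
      partial i (\<lambda>z. (partial i ^^ k) f z + (partial i ^^ k) g z) z) (near n p)"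
    by (rule eventually_partial_cong[OF holo_at_Cn[OF assms(1)] assms(3) Suc])
  moreover have "eventually (\<lambda>z. holo_at n z ((partial i ^^ k) f) \<and> holo_at n z ((partial i ^^ k) g)) (near n p)"
    using assms by (intro eventually_conj eventually_holo_at holo_at_funpow_partial)
  ultimately show ?case
    by eventually_elim (use partial_add[OF _ _ assms(3)] in auto)
qed simp

lemma eventually_funpow_partial_cmult:
  assumes "holo_at n p f" "i < n"
  shows "eventually (\<lambda>z. (partial i ^^ k) (\<lambda>z. c * f z) z = c * (partial i ^^ k) f z) (near n p)"
proof (induction k)
  case (Suc k)
  have "eventually (\<lambda>z. partial i ((partial i ^^ k) (\<lambda>z. c * f z)) z =
      partial i (\<lambda>z. c * (partial i ^^ k) f z) z) (near n p)"
    by (rule eventually_partial_cong[OF holo_at_Cn[OF assms(1)] assms(2) Suc])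
  moreover have "eventually (\<lambda>z. holo_at n z ((partial i ^^ k) f)) (near n p)"
    using assms by (intro eventually_holo_at holo_at_funpow_partial)
  ultimately show ?case
    by eventually_elim (use assms(2) in \<open>simp add: partial_cmult\<close>)
qed simp

text \<open>Leibniz rule with a linear factor, hence only two terms. The truncated
  \<open>k - 1\<close> at k = 0 is harmless since it is multiplied by 0.\<close>

lemma eventually_funpow_partial_coord_mult:
  assumes "holo_at n p f" "i < n"
  shows "eventually (\<lambda>z. (partial i ^^ k) (\<lambda>z. z j * f z) z =
     z j * (partial i ^^ k) f z + (if i = j then of_nat k * (partial i ^^ (k - 1)) f z else 0)) (near n p)"
proof (induction k)
  case (Suc k)
  have "eventually (\<lambda>z. partial i ((partial i ^^ k) (\<lambda>z. z j * f z)) z =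
      partial i (\<lambda>z. z j * (partial i ^^ k) f z +
         (if i = j then of_nat k * (partial i ^^ (k - 1)) f z else 0)) z) (near n p)"
    by (rule eventually_partial_cong[OF holo_at_Cn[OF assms(1)] assms(2) Suc])
  moreover have "eventually (\<lambda>z. holo_at n z ((partial i ^^ k) f) \<and> holo_at n z ((partial i ^^ (k - 1)) f)) (near n p)"
    using assms by (intro eventually_conj eventually_holo_at holo_at_funpow_partial)
  ultimately show ?case
  proof eventually_elim
    case (elim z)
    have z: "z \<in> Cn n" using elim holo_at_Cn by blast
    have "partial i (\<lambda>z. z j * (partial i ^^ k) f z) z =
        (if i = j then 1 else 0) * (partial i ^^ k) f z + z j * partial i ((partial i ^^ k) f) z"
      using elim(2) assms(2) z by (subst partial_mult[of n]) (auto simp: partial_coord intro: holo_at_coord)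
    moreover have "partial i (\<lambda>z. of_nat k * (partial i ^^ (k - 1)) f z) z = of_nat k * (partial i ^^ k) f z"
      using elim(2) assms(2) by (cases k) (auto simp: partial_cmult partial_const)
    moreover have "partial i (\<lambda>z. z j * (partial i ^^ k) f z + of_nat k * (partial i ^^ (k - 1)) f z) z =
       partial i (\<lambda>z. z j * (partial i ^^ k) f z) z + partial i (\<lambda>z. of_nat k * (partial i ^^ (k - 1)) f z) z"
      using elim(2) assms(2) z by (intro partial_add[of n]) (auto intro!: holo_intros)
    ultimately show ?case using elim(1) by (auto simp: algebra_simps)
  qed
qed auto

lemma eventually_funpow_partial_commute:
  assumes "holo_at n p f" "i < n" "j < n"
  shows "eventually (\<lambda>z. (partial i ^^ k) (partial j f) z = partial j ((partial i ^^ k) f) z) (near n p)"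
proof (induction k)
  case (Suc k)
  have "eventually (\<lambda>z. partial i ((partial i ^^ k) (partial j f)) z =
      partial i (partial j ((partial i ^^ k) f)) z) (near n p)"
    by (rule eventually_partial_cong[OF holo_at_Cn[OF assms(1)] assms(2) Suc])
  moreover have "eventually (\<lambda>z. holo_at n z ((partial i ^^ k) f)) (near n p)"
    using assms by (intro eventually_holo_at holo_at_funpow_partial)
  ultimately show ?case
    by eventually_elim (use partial_commute assms in simp)
qed simp

abbreviation holo2 :: "(point \<Rightarrow> complex) \<Rightarrow> bool" where
  "holo2 \<equiv> holo_at 2 origin"

text \<open>The Taylor coefficient of x^i y^j. Defined by derivatives, it obeys the product and
  shift rules of power series without any question of convergence.\<close>

definition coef :: "nat \<Rightarrow> nat \<Rightarrow> (point \<Rightarrow> complex) \<Rightarrow> complex" where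
  "coef i j f = (partial 0 ^^ i) ((partial 1 ^^ j) f) origin / (fact i * fact j)"

lemma coef_00 [simp]: "coef 0 0 f = f origin"
  by (simp add: coef_def)

lemma eventually_iterated_partial_cong:
  assumes "eventually (\<lambda>z. (partial 1 ^^ j) f z = g z) (near 2 origin)"
  shows "(partial 0 ^^ i) ((partial 1 ^^ j) f) origin = (partial 0 ^^ i) g origin"
  using near_self[OF _ eventually_funpow_partial_cong[OF _ _ assms]] by simp

lemma coef_cong:
  assumes "eventually (\<lambda>z. f z = g z) (near 2 origin)"
  shows "coef i j f = coef i j g"
  unfolding coef_def
  by (subst eventually_iterated_partial_cong[OF eventually_funpow_partial_cong[OF _ _ assms]]) auto

lemma coef_add:
  assumes "holo2 f" "holo2 g"
  shows "coef i j (\<lambda>z. f z + g z) = coef i j f + coef i j g"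
proof -
  have "(partial 0 ^^ i) (\<lambda>z. (partial 1 ^^ j) f z + (partial 1 ^^ j) g z) origin =
      (partial 0 ^^ i) ((partial 1 ^^ j) f) origin + (partial 0 ^^ i) ((partial 1 ^^ j) g) origin"
    by (rule near_self[OF _ eventually_funpow_partial_add])
      (use assms in \<open>auto intro: holo_at_funpow_partial\<close>)
  then show ?thesis
    unfolding coef_def
    by (subst eventually_iterated_partial_cong[OF eventually_funpow_partial_add[OF assms]])
      (auto simp: add_divide_distrib)
qed

lemma coef_cmult:
  assumes "holo2 f"
  shows "coef i j (\<lambda>z. c * f z) = c * coef i j f"
proof -
  have "(partial 0 ^^ i) (\<lambda>z. c * (partial 1 ^^ j) f z) origin =
      c * (partial 0 ^^ i) ((partial 1 ^^ j) f) origin"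
    by (rule near_self[OF _ eventually_funpow_partial_cmult])
      (use assms in \<open>auto intro: holo_at_funpow_partial\<close>)
  then show ?thesis
    unfolding coef_def
    by (subst eventually_iterated_partial_cong[OF eventually_funpow_partial_cmult[OF assms]]) auto
qed

lemma coef_coord0:
  assumes "holo2 f"
  shows "coef i j (\<lambda>z. z 0 * f z) = (if i = 0 then 0 else coef (i - 1) j f)"
proof -
  have "eventually (\<lambda>z. (partial 1 ^^ j) (\<lambda>z. z 0 * f z) z = z 0 * (partial 1 ^^ j) f z) (near 2 origin)"
    using eventually_funpow_partial_coord_mult[OF assms, of 1 j 0] by simp
  then have "coef i j (\<lambda>z. z 0 * f z) = (partial 0 ^^ i) (\<lambda>z. z 0 * (partial 1 ^^ j) f z) origin / (fact i * fact j)"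
    unfolding coef_def by (subst eventually_iterated_partial_cong) auto
  also have "(partial 0 ^^ i) (\<lambda>z. z 0 * (partial 1 ^^ j) f z) origin =
     of_nat i * (partial 0 ^^ (i - 1)) ((partial 1 ^^ j) f) origin"
    using near_self[OF _ eventually_funpow_partial_coord_mult[OF holo_at_funpow_partial[OF assms, of 1 j], of 0 i 0]]
    by simp
  also have "\<dots> / (fact i * fact j) = (if i = 0 then 0 else coef (i - 1) j f)"
    by (cases i) (auto simp: coef_def field_simps simp del: of_nat_Suc)
  finally show ?thesis .
qed

lemma coef_coord1:
  assumes "holo2 f"
  shows "coef i j (\<lambda>z. z 1 * f z) = (if j = 0 then 0 else coef i (j - 1) f)"
proof -
  let ?g = "\<lambda>k. (partial 1 ^^ k) f"
  have h: "holo2 (?g k)" for k using assms by (auto intro: holo_at_funpow_partial)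
  have "eventually (\<lambda>z. (partial 1 ^^ j) (\<lambda>z. z 1 * f z) z = z 1 * ?g j z + of_nat j * ?g (j - 1) z) (near 2 origin)"
    using eventually_funpow_partial_coord_mult[OF assms, of 1 j 1] by simp
  then have "coef i j (\<lambda>z. z 1 * f z) =
     (partial 0 ^^ i) (\<lambda>z. z 1 * ?g j z + of_nat j * ?g (j - 1) z) origin / (fact i * fact j)"
    unfolding coef_def by (subst eventually_iterated_partial_cong) auto
  also have "(partial 0 ^^ i) (\<lambda>z. z 1 * ?g j z + of_nat j * ?g (j - 1) z) origin =
      (partial 0 ^^ i) (\<lambda>z. z 1 * ?g j z) origin + (partial 0 ^^ i) (\<lambda>z. of_nat j * ?g (j - 1) z) origin"
    by (rule near_self[OF _ eventually_funpow_partial_add]) (use h in \<open>auto intro!: holo_intros\<close>)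
  also have "(partial 0 ^^ i) (\<lambda>z. z 1 * ?g j z) origin = 0"
    using near_self[OF _ eventually_funpow_partial_coord_mult[OF h[of j], of 0 i 1]] by simp
  also have "(partial 0 ^^ i) (\<lambda>z. of_nat j * ?g (j - 1) z) origin =
      of_nat j * (partial 0 ^^ i) (?g (j - 1)) origin"
    by (rule near_self[OF _ eventually_funpow_partial_cmult]) (use h in auto)
  also have "(0 + of_nat j * (partial 0 ^^ i) (?g (j - 1)) origin) / (fact i * fact j) =
     (if j = 0 then 0 else coef i (j - 1) f)"
    by (cases j) (auto simp: coef_def field_simps simp del: of_nat_Suc)
  finally show ?thesis .
qed

lemma coef_partial0:
  assumes "holo2 f"
  shows "coef i j (partial 0 f) = of_nat (i + 1) * coef (i + 1) j f"
proof -
  have "coef i j (partial 0 f) = (partial 0 ^^ i) (partial 0 ((partial 1 ^^ j) f)) origin / (fact i * fact j)"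
    unfolding coef_def
    by (subst eventually_iterated_partial_cong[OF eventually_funpow_partial_commute[OF assms]]) auto
  also have "\<dots> = of_nat (i + 1) * coef (i + 1) j f"
    unfolding coef_def by (simp add: funpow_swap1 field_simps del: of_nat_Suc)
  finally show ?thesis .
qed

lemma coef_partial1: "coef i j (partial 1 f) = of_nat (j + 1) * coef i (j + 1) f"
  unfolding coef_def by (simp add: funpow_swap1 field_simps del: of_nat_Suc)

lemma coef_monomial_mult:
  assumes "holo2 f"
  shows "coef i j (\<lambda>z. f z * (z 0 ^ k * z 1 ^ l)) = (if k \<le> i \<and> l \<le> j then coef (i - k) (j - l) f else 0)"
proof (induction k arbitrary: i)
  case 0
  show ?case
  proof (induction l arbitrary: j)
    case (Suc l)
    have "holo2 (\<lambda>z. f z * (z 0 ^ 0 * z 1 ^ l))"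
      using assms by (intro holo_intros) auto
    then have "coef i j (\<lambda>z. z 1 * (f z * (z 0 ^ 0 * z 1 ^ l))) =
        (if j = 0 then 0 else coef i (j - 1) (\<lambda>z. f z * (z 0 ^ 0 * z 1 ^ l)))"
      by (rule coef_coord1)
    also have "\<dots> = (if 0 \<le> i \<and> Suc l \<le> j then coef (i - 0) (j - Suc l) f else 0)"
      unfolding Suc by auto
    finally show ?case by (simp only: power_Suc mult_ac)
  qed simp
next
  case (Suc k)
  have "holo2 (\<lambda>z. f z * (z 0 ^ k * z 1 ^ l))"
    using assms by (intro holo_intros) auto
  then have "coef i j (\<lambda>z. z 0 * (f z * (z 0 ^ k * z 1 ^ l))) =
      (if i = 0 then 0 else coef (i - 1) j (\<lambda>z. f z * (z 0 ^ k * z 1 ^ l)))"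
    by (rule coef_coord0)
  also have "\<dots> = (if Suc k \<le> i \<and> l \<le> j then coef (i - Suc k) (j - l) f else 0)"
    unfolding Suc by auto
  finally show ?case by (simp only: power_Suc mult_ac)
qed

section \<open>The form\<close>

definition formA :: "point \<Rightarrow> complex" where
  "formA z = 13 * (z 0 ^ 12 * z 1 ^ 0) + 4 * (z 0 ^ 3 * z 1 ^ 10) + 7 * (z 0 ^ 6 * z 1 ^ 7) + 10 * (z 0 ^ 9 * z 1 ^ 4)"

text \<open>The first four terms are f_y; the last four are minus the antiderivative of x A with
  respect to x, whence the denominators 14, 5, 8 and 11. Zero exponents are written out so that all
  terms have the same monomial shape.\<close>

definition formB :: "point \<Rightarrow> complex" where
  "formB z = 13 * (z 0 ^ 0 * z 1 ^ 12) + 10 * (z 0 ^ 4 * z 1 ^ 9) + 7 * (z 0 ^ 7 * z 1 ^ 6) + 4 * (z 0 ^ 10 * z 1 ^ 3)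
     - 13 / 14 * (z 0 ^ 14 * z 1 ^ 0) - 4 / 5 * (z 0 ^ 5 * z 1 ^ 10) - 7 / 8 * (z 0 ^ 8 * z 1 ^ 7) - 10 / 11 * (z 0 ^ 11 * z 1 ^ 4)"

lemma holo_formA: "p \<in> Cn n \<Longrightarrow> holo_at n p formA"
  unfolding formA_def[abs_def] by (intro holo_intros)

lemma holo_formB: "p \<in> Cn n \<Longrightarrow> holo_at n p formB"
  unfolding formB_def[abs_def] by (intro holo_intros)

section \<open>Coefficient equations for exact forms with coefficients in the ideal\<close>

definition shift :: "nat \<Rightarrow> nat \<Rightarrow> nat \<Rightarrow> nat \<Rightarrow> (point \<Rightarrow> complex) \<Rightarrow> complex" where
  "shift i j k l f = (if k \<le> i \<and> l \<le> j then coef (i - k) (j - l) f else 0)"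

lemma coef_term:
  assumes "holo2 f"
  shows "coef i j (\<lambda>z. c * (f z * (z 0 ^ k * z 1 ^ l))) = c * shift i j k l f"
proof -
  have "holo2 (\<lambda>z. f z * (z 0 ^ k * z 1 ^ l))"
    using assms by (intro holo_intros) auto
  then show ?thesis
    by (simp only: coef_cmult coef_monomial_mult[OF assms] shift_def)
qed

lemma coef_mult_form:
  assumes a: "holo2 a" and b: "holo2 b"
  shows "coef i j (\<lambda>z. a z * formA z + b z * formB z) =
     13 * shift i j 12 0 a + 4 * shift i j 3 10 a + 7 * shift i j 6 7 a + 10 * shift i j 9 4 a +
     (13 * shift i j 0 12 b + 10 * shift i j 4 9 b + 7 * shift i j 7 6 b + 4 * shift i j 10 3 b +
      (- 13 / 14) * shift i j 14 0 b + (- 4 / 5) * shift i j 5 10 b + (- 7 / 8) * shift i j 8 7 b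
      + (- 10 / 11) * shift i j 11 4 b)"
proof -
  have e: "(\<lambda>z. a z * formA z + b z * formB z) = (\<lambda>z.
     13 * (a z * (z 0 ^ 12 * z 1 ^ 0)) + 4 * (a z * (z 0 ^ 3 * z 1 ^ 10)) +
     7 * (a z * (z 0 ^ 6 * z 1 ^ 7)) + 10 * (a z * (z 0 ^ 9 * z 1 ^ 4)) +
     (13 * (b z * (z 0 ^ 0 * z 1 ^ 12)) + 10 * (b z * (z 0 ^ 4 * z 1 ^ 9)) + 7 * (b z * (z 0 ^ 7 * z 1 ^ 6)) +
     4 * (b z * (z 0 ^ 10 * z 1 ^ 3)) + (- 13 / 14) * (b z * (z 0 ^ 14 * z 1 ^ 0)) +
     (- 4 / 5) * (b z * (z 0 ^ 5 * z 1 ^ 10)) +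
     (- 7 / 8) * (b z * (z 0 ^ 8 * z 1 ^ 7)) + (- 10 / 11) * (b z * (z 0 ^ 11 * z 1 ^ 4))))"
    by (rule ext) (simp add: formA_def formB_def algebra_simps)
  have t: "holo2 (\<lambda>z. c * (f z * (z 0 ^ k * z 1 ^ l)))" if "holo2 f" for c f k l
    using that by (auto intro!: holo_intros)
  show ?thesis
    unfolding e
    by (simp only: coef_add coef_term[OF a] coef_term[OF b] t[OF a] t[OF b] holo_at_add)
qed

lemma coef_form_at:
  assumes "holo2 a" "holo2 b" "eventually (\<lambda>z. f z = a z * formA z + b z * formB z) (near 2 origin)"
  shows "coef i j f =
     13 * shift i j 12 0 a + 4 * shift i j 3 10 a + 7 * shift i j 6 7 a + 10 * shift i j 9 4 a +
     (13 * shift i j 0 12 b + 10 * shift i j 4 9 b + 7 * shift i j 7 6 b + 4 * shift i j 10 3 b +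
      (- 13 / 14) * shift i j 14 0 b + (- 4 / 5) * shift i j 5 10 b + (- 7 / 8) * shift i j 8 7 b
      + (- 10 / 11) * shift i j 11 4 b)"
  using coef_cong[OF assms(3), of i j] coef_mult_form[OF assms(1,2), of i j] by simp

text \<open>Here T(i, j) = (j + 1)(i \<alpha> + j \<beta>) - (i + 1)(i \<gamma> + j \<delta>) + i e,
  and the hypotheses are T = 0 at (13, 0), (0, 13), (4, 10), (7, 7) and (10, 4), the second one
  divided by 13.\<close>

lemma linear_system_trivial:
  fixes \<alpha> \<beta> \<gamma> \<delta> e :: complex
  assumes "13 * \<alpha> = 182 * \<gamma> - 13 * e" "14 * \<beta> = \<delta>"
    and "44 * \<alpha> + 110 * \<beta> = 20 * \<gamma> + (50 * \<delta> - 4 * e)"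
    and "56 * \<alpha> + 56 * \<beta> = 56 * \<gamma> + (56 * \<delta> - 7 * e)"
    and "50 * \<alpha> + 20 * \<beta> = 110 * \<gamma> + (44 * \<delta> - 10 * e)"
  shows "e = 0"
proof -
  have "\<alpha> = (13 * \<alpha>) / 13" by simp
  also have "\<dots> = 14 * \<gamma> - e" unfolding assms(1) by (simp add: diff_divide_distrib)
  finally have \<alpha>: "\<alpha> = 14 * \<gamma> - e" .
  note \<delta> = assms(2)[symmetric]
  have 3: "596 * \<gamma> - 590 * \<beta> - 40 * e = 0"
    using assms(3) unfolding \<alpha> \<delta> by (simp add: algebra_simps)
  have 4: "728 * \<gamma> - 728 * \<beta> - 49 * e = 0"
    using assms(4) unfolding \<alpha> \<delta> by (simp add: algebra_simps)
  have 5: "590 * \<gamma> - 596 * \<beta> - 40 * e = 0"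
    using assms(5) unfolding \<alpha> \<delta> by (simp add: algebra_simps)
  \<comment> \<open>The third and fifth equations add up to 1186 (\<gamma> - \<beta>) - 80 e = 0,
    the fourth is 728 (\<gamma> - \<beta>) - 49 e = 0. Eliminating \<gamma> - \<beta> leaves 728 *
    80 - 1186 * 49 = 126 as the coefficient of e.\<close>
  have "126 * e = 1186 * (728 * \<gamma> - 728 * \<beta> - 49 * e) - 728 * (596 * \<gamma> - 590 * \<beta> - 40 * e)
      - 728 * (590 * \<gamma> - 596 * \<beta> - 40 * e)"
    by (simp add: algebra_simps)
  also have "\<dots> = 0" unfolding 3 4 5 by simp
  finally show ?thesis by simp
qed

text \<open>The matrix M has rows (a, b) and (c, e), and the equations are the coefficients of the
  equality of mixed derivatives of \<psi>. Any two exponents of f differ by at least 3 in both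
  coordinates and in opposite directions, while the entries of M are met only in degree at most 2;
  therefore each equation involves a single monomial of f.\<close>

lemma exact_in_ideal_imp_zero:
  assumes holo: "holo2 a" "holo2 b" "holo2 c" "holo2 e" "holo2 \<psi>"
    and x: "eventually (\<lambda>z. partial 0 \<psi> z = a z * formA z + b z * formB z) (near 2 origin)"
    and y: "eventually (\<lambda>z. partial 1 \<psi> z = c z * formA z + e z * formB z) (near 2 origin)"
  shows "a origin = 0" "b origin = 0" "c origin = 0" "e origin = 0"
proof -
  have eq: "of_nat (j + 1) * coef i (j + 1) (partial 0 \<psi>) = of_nat (i + 1) * coef (i + 1) j (partial 1 \<psi>)" for i j
    by (simp only: coef_partial0[OF holo(5)] coef_partial1 mult_ac)
  note E = eq[unfolded coef_form_at[OF holo(1,2) x] coef_form_at[OF holo(3,4) y]]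
  \<comment> \<open>\<open>E\<close> takes the exponent of y first. The monomials are x^4 y^8, x^2
    y^10 and x^3 y^9, that is (4, 10) shifted by (0, -2), (-2, 0) and (-1, -1): there only constant
    terms of entries of M survive.\<close>
  have b: "b origin = 0" using E[of 8 4] by (simp add: shift_def)
  have c: "c origin = 0" using E[of 10 2] by (simp add: shift_def)
  have s: "a origin = e origin" using E[of 9 3] by (simp add: shift_def)
  \<comment> \<open>At the exponents of f themselves, the coefficients of degree 2 of M meet the
    partial derivatives of f, and the constant term of \<open>e\<close> meets the additional terms
    of B.\<close>
  note e1 = E[of 0 13, simplified shift_def, simplified]
  note e2 = E[of 13 0, simplified shift_def, simplified]
  note e3 = E[of 10 4, simplified shift_def, simplified]
  note e4 = E[of 7 7, simplified shift_def, simplified]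
  note e5 = E[of 4 10, simplified shift_def, simplified]
  have e: "e origin = 0"
    by (rule linear_system_trivial[of "coef 1 1 a" "coef 2 0 c" "e origin" "coef 0 2 b" "coef 1 1 e"])
      (use s e1 e2 e3 e4 e5 in simp_all)
  show "a origin = 0" "b origin = 0" "c origin = 0" "e origin = 0"
    using b c s e by auto
qed

definition in_ideal :: "(point \<Rightarrow> complex) \<Rightarrow> bool" where
  "in_ideal f \<longleftrightarrow> (\<exists>a b. holo2 a \<and> holo2 b \<and>
     eventually (\<lambda>z. f z = a z * formA z + b z * formB z) (near 2 origin))"

text \<open>A and B have no terms of degree below 12. This keeps the coordinate x outside the ideal
  and makes the scheme nonreduced.\<close>

lemma in_ideal_coef_10: "in_ideal f \<Longrightarrow> coef 1 0 f = 0"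
  unfolding in_ideal_def by (auto simp: coef_form_at shift_def)

text \<open>Compare coefficients of x^12: no monomial of B divides it, and in A only x^12 itself
  does.\<close>

lemma formA_minimal_generator:
  assumes "holo2 a" "holo2 b" "a origin = 0"
    "eventually (\<lambda>z. formA z = a z * formA z + b z * formB z) (near 2 origin)"
  shows False
proof -
  have "coef 12 0 formA = 0"
    using coef_form_at[OF assms(1,2,4), of 12 0] assms(3) by (simp add: shift_def)
  moreover have "coef 12 0 formA = 13"
    using coef_form_at[of "\<lambda>_. 1" "\<lambda>_. 0" formA 12 0] by (simp add: shift_def holo_at_const)
  ultimately show False by simp
qed

section \<open>The ideal is primary to the maximal ideal\<close>

text \<open>The ring need not be local, so the conclusion holds only up to a factor u in 1 + m.
  Generators are eliminated one at a time; the relations carry such factors from the start because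
  the elimination multiplies them by further ones.\<close>

lemma nakayama:
  fixes v :: "'i \<Rightarrow> 'a::comm_ring_1"
  assumes "finite K"
    and I: "0 \<in> I" "\<And>a b. a \<in> I \<Longrightarrow> b \<in> I \<Longrightarrow> a + b \<in> I" "\<And>r a. a \<in> I \<Longrightarrow> r * a \<in> I"
    and m: "0 \<in> m" "\<And>a b. a \<in> m \<Longrightarrow> b \<in> m \<Longrightarrow> a + b \<in> m" "\<And>r a. a \<in> m \<Longrightarrow> r * a \<in> m"
    and rel: "\<And>k. k \<in> K \<Longrightarrow> \<exists>u w \<mu>. u - 1 \<in> m \<and> w \<in> I \<and> (\<forall>j\<in>K. \<mu> j \<in> m) \<and>
        u * v k = w + (\<Sum>j\<in>K. \<mu> j * v j)"
  shows "\<exists>u. u - 1 \<in> m \<and> (\<forall>k\<in>K. u * v k \<in> I)"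
  using assms(1) rel
proof (induction K rule: finite_induct)
  case empty
  then show ?case using m(1) by (intro exI[of _ 1]) auto
next
  case (insert k0 K)
  have m1: "x * y - 1 \<in> m" if "x - 1 \<in> m" "y - 1 \<in> m" for x y
  proof -
    have "x * y - 1 = y * (x - 1) + (y - 1)" by (simp add: algebra_simps)
    then show ?thesis using m(2)[OF m(3)[OF that(1)] that(2)] by metis
  qed
  have mneg: "- x \<in> m" if "x \<in> m" for x
    using m(3)[OF that, of "-1"] by simp
  obtain u0 w0 \<mu>0 where 0: "u0 - 1 \<in> m" "w0 \<in> I" "\<forall>j\<in>insert k0 K. \<mu>0 j \<in> m"
    "u0 * v k0 = w0 + (\<Sum>j\<in>insert k0 K. \<mu>0 j * v j)"
    using insert.prems[of k0] by auto
  \<comment> \<open>Moving the term of \<open>v k0\<close> to the left solves its relation for t * v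
    k0, with t still in 1 + m.\<close>
  define t where "t = u0 - \<mu>0 k0"
  have "(u0 - 1) + - \<mu>0 k0 \<in> m" using m(2)[OF 0(1) mneg] 0(3) by blast
  moreover have "t - 1 = (u0 - 1) + - \<mu>0 k0" by (simp add: t_def)
  ultimately have t: "t - 1 \<in> m" by (simp only:)
  have tv: "t * v k0 = w0 + (\<Sum>j\<in>K. \<mu>0 j * v j)"
    using 0(4) insert.hyps by (simp add: t_def algebra_simps)
  have "\<exists>u w \<mu>. u - 1 \<in> m \<and> w \<in> I \<and> (\<forall>j\<in>K. \<mu> j \<in> m) \<and> u * v k = w + (\<Sum>j\<in>K. \<mu> j * v j)"
    if k: "k \<in> K" for k
  proof -
    obtain u w \<mu> where *: "u - 1 \<in> m" "w \<in> I" "\<forall>j\<in>insert k0 K. \<mu> j \<in> m"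
      "u * v k = w + (\<Sum>j\<in>insert k0 K. \<mu> j * v j)"
      using insert.prems[of k] k by auto
    have "t * u * v k = t * w + \<mu> k0 * (t * v k0) + (\<Sum>j\<in>K. t * \<mu> j * v j)"
      using insert.hyps unfolding mult.assoc *(4) by (simp add: algebra_simps sum_distrib_left)
    also have "\<dots> = (t * w + \<mu> k0 * w0) + (\<Sum>j\<in>K. (\<mu> k0 * \<mu>0 j + t * \<mu> j) * v j)"
      unfolding tv by (simp add: algebra_simps sum_distrib_left sum.distrib)
    finally have "t * u * v k = (t * w + \<mu> k0 * w0) + (\<Sum>j\<in>K. (\<mu> k0 * \<mu>0 j + t * \<mu> j) * v j)" .
    moreover have "\<forall>j\<in>K. \<mu> k0 * \<mu>0 j + t * \<mu> j \<in> m"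
      using 0(3) *(3) m by auto
    moreover have "t * w + \<mu> k0 * w0 \<in> I" using *(2) 0(2) I by auto
    ultimately show ?thesis using m1[OF t *(1)]
      by (intro exI[of _ "t * u"] exI[of _ "t * w + \<mu> k0 * w0"] exI[of _ "\<lambda>j. \<mu> k0 * \<mu>0 j + t * \<mu> j"] conjI)
  qed
  from insert.IH[OF this] obtain u where u: "u - 1 \<in> m" "\<forall>k\<in>K. u * v k \<in> I"
    by blast
  have "u * t * v k0 = u * w0 + (\<Sum>j\<in>K. \<mu>0 j * (u * v j))"
    unfolding mult.assoc tv by (simp add: algebra_simps sum_distrib_left)
  moreover have "(\<Sum>j\<in>K. \<mu>0 j * (u * v j)) \<in> I"
    using insert.hyps(1) u(2) I by (induction K rule: finite_induct) auto
  ultimately have "u * t * v k0 \<in> I" using 0(2) I by auto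
  moreover have "u * t * v k \<in> I" if "k \<in> K" for k
    using I(3)[of "u * v k" t] u(2) that by (simp add: mult_ac)
  ultimately show ?case using m1[OF u(1) t] by blast
qed

lemma poly2_simps [simp]:
  "poly2 (P + Q) z = poly2 P z + poly2 Q z"
  "poly2 (P - Q) z = poly2 P z - poly2 Q z"
  "poly2 (P * Q) z = poly2 P z * poly2 Q z"
  "poly2 0 z = 0" "poly2 1 z = 1"
  "poly2 (monom (monom c i) j) z = c * (z 0 ^ i * z 1 ^ j)"
  by (simp_all add: poly2_def poly_monom)

definition polyA :: "complex poly poly" where
  "polyA = monom (monom 13 12) 0 + monom (monom 4 3) 10 + monom (monom 7 6) 7 + monom (monom 10 9) 4"

definition polyB :: "complex poly poly" where
  "polyB = monom (monom 13 0) 12 + monom (monom 10 4) 9 + monom (monom 7 7) 6 + monom (monom 4 10) 3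
    + monom (monom (- 13 / 14) 14) 0 + monom (monom (- 4 / 5) 5) 10
    + monom (monom (- 7 / 8) 8) 7 + monom (monom (- 10 / 11) 11) 4"

lemma poly2_polyA: "poly2 polyA = formA"
  by (simp add: fun_eq_iff polyA_def formA_def)

lemma poly2_polyB: "poly2 polyB = formB"
  by (simp add: fun_eq_iff polyB_def formB_def)

text \<open>A monomial of degree 23 = 12 + 12 - 1 is divisible by x^12 or y^12. Subtracting a
  multiple of A or B replaces it by terms of degree at least 24, since all other terms of A and B
  have degree at least 13; so m^23 lies in I + m m^23 and Nakayama applies. Polynomials are used
  instead of germs because h has to define a Zariski open set.\<close>

lemma monomials_in_ideal:
  obtains h where "poly2 h origin = 1"
    "\<And>k. k \<le> 23 \<Longrightarrow> \<exists>a b. h * monom (monom 1 k) (23 - k) = a * polyA + b * polyB"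
proof -
  define v :: "nat \<Rightarrow> complex poly poly" where "v k = monom (monom 1 k) (23 - k)" for k
  define m :: "complex poly poly set" where "m = {P. poly2 P origin = 0}"
  define I where "I = {a * polyA + b * polyB | a b. True}"
  \<comment> \<open>This is m times the ideal of the monomials of degree 23, so it contains every
    monomial of degree at least 24.\<close>
  define M where "M = {P. \<exists>\<mu>. (\<forall>j\<in>{..23}. \<mu> j \<in> m) \<and> P = (\<Sum>j\<in>{..23}. \<mu> j * v j)}"
  have m: "0 \<in> m" "a \<in> m \<Longrightarrow> b \<in> m \<Longrightarrow> a + b \<in> m" "a \<in> m \<Longrightarrow> r * a \<in> m" for a b r
    by (auto simp: m_def)
  have I: "0 \<in> I" "a \<in> I \<Longrightarrow> b \<in> I \<Longrightarrow> a + b \<in> I" "a \<in> I \<Longrightarrow> r * a \<in> I" for a b r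
  proof -
    have "0 = 0 * polyA + 0 * polyB" by simp
    then show "0 \<in> I" unfolding I_def by blast
    show "a + b \<in> I" if ab: "a \<in> I" "b \<in> I"
    proof -
      obtain a1 a2 b1 b2 where "a = a1 * polyA + a2 * polyB" "b = b1 * polyA + b2 * polyB"
        using ab unfolding I_def by blast
      then have "a + b = (a1 + b1) * polyA + (a2 + b2) * polyB" by (simp add: algebra_simps)
      then show ?thesis unfolding I_def by blast
    qed
    show "r * a \<in> I" if a: "a \<in> I"
    proof -
      obtain a1 a2 where "a = a1 * polyA + a2 * polyB"
        using a unfolding I_def by blast
      then have "r * a = (r * a1) * polyA + (r * a2) * polyB" by (simp add: algebra_simps)
      then show ?thesis unfolding I_def by blast
    qed
  qed
  have M_add: "P + Q \<in> M" if PQ: "P \<in> M" "Q \<in> M" for P Q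
  proof -
    obtain \<mu> \<nu> where "\<forall>j\<in>{..23}. \<mu> j \<in> m" "P = (\<Sum>j\<in>{..23}. \<mu> j * v j)"
      "\<forall>j\<in>{..23}. \<nu> j \<in> m" "Q = (\<Sum>j\<in>{..23}. \<nu> j * v j)"
      using PQ unfolding M_def by blast
    then show ?thesis
      unfolding M_def by (intro CollectI exI[of _ "\<lambda>j. \<mu> j + \<nu> j"]) (auto simp: m sum.distrib algebra_simps)
  qed
  have M_monom: "monom (monom c a) b \<in> M" if "a + b \<ge> 24" for a b c
  proof -
    \<comment> \<open>A degree 23 divisor with as much y as b permits; the truncated difference
      covers b > 23, where j = 0.\<close>
    define j where "j = 23 - b"
    have j: "j \<le> 23" "j \<le> a" "23 - j \<le> b" "a - j + (b - (23 - j)) \<noteq> 0"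
      using that by (auto simp: j_def)
    define w :: "complex poly poly" where "w = monom (monom c (a - j)) (b - (23 - j))"
    have "w * v j = monom (monom c a) b"
      unfolding w_def v_def using j by (simp add: mult_monom)
    moreover have "w \<in> m" using j(4) by (auto simp: w_def m_def)
    moreover have "(\<Sum>i\<in>{..23}. (if i = j then w else 0) * v i) = w * v j"
      using j(1) by (simp add: if_distrib[of "\<lambda>x. x * _"] cong: if_cong)
    ultimately show ?thesis
      unfolding M_def using m(1)
      by (intro CollectI exI[of _ "\<lambda>i. if i = j then w else 0"]) (auto simp del: mult_eq_0_iff)
  qed
  have rel: "\<exists>a b P. P \<in> M \<and> v k = (a * polyA + b * polyB) + P" if k: "k \<le> 23" for k
  proof (cases "k \<ge> 12")
    case True
    \<comment> \<open>The terms of A other than the leading one, multiplied by - x^(k-12) y^(23-k) /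
      13.\<close>
    let ?s = "\<lambda>c i j. monom (monom (- c / 13) (i + (k - 12))) (j + (23 - k)) :: complex poly poly"
    let ?P = "?s 4 3 10 + ?s 7 6 7 + ?s 10 9 4"
    have "v k = monom (monom (1 / 13) (k - 12)) (23 - k) * polyA + 0 * polyB + ?P"
      unfolding polyA_def v_def using True
      by (simp add: algebra_simps mult_monom flip: minus_monom)
    moreover have "?P \<in> M" using True k by (intro M_add M_monom) auto
    ultimately show ?thesis by blast
  next
    case False
    let ?s = "\<lambda>c i j. monom (monom (- c / 13) (i + k)) (j + (11 - k)) :: complex poly poly"
    let ?P = "?s 10 4 9 + ?s 7 7 6 + ?s 4 10 3 + ?s (- 13 / 14) 14 0 + ?s (- 4 / 5) 5 10
      + ?s (- 7 / 8) 8 7 + ?s (- 10 / 11) 11 4"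
    have "v k = 0 * polyA + monom (monom (1 / 13) k) (11 - k) * polyB + ?P"
      unfolding polyB_def v_def using False
      by (simp add: algebra_simps mult_monom flip: minus_monom)
    moreover have "?P \<in> M" using False k by (intro M_add M_monom) auto
    ultimately show ?thesis by blast
  qed
  have "\<exists>u. u - 1 \<in> m \<and> (\<forall>k\<in>{..23}. u * v k \<in> I)"
  proof (rule nakayama)
    show "\<exists>u w \<mu>. u - 1 \<in> m \<and> w \<in> I \<and> (\<forall>j\<in>{..23}. \<mu> j \<in> m) \<and> u * v k = w + (\<Sum>j\<in>{..23}. \<mu> j * v j)"
      if k: "k \<in> {..23}" for k
    proof -
      obtain a b \<mu> where "\<forall>j\<in>{..23}. \<mu> j \<in> m" "v k = (a * polyA + b * polyB) + (\<Sum>j\<in>{..23}. \<mu> j * v j)"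
        using rel[of k] k unfolding M_def by auto
      then show ?thesis
        using m(1) unfolding I_def
        by (intro exI[of _ 1] exI[of _ "a * polyA + b * polyB"] exI[of _ \<mu>]) auto
    qed
  qed (use I m in auto)
  then obtain u where "u - 1 \<in> m" "\<forall>k\<in>{..23}. u * v k \<in> I" by blast
  then show ?thesis
    using that[of u] by (auto simp: m_def I_def v_def)
qed

section \<open>Algebraic properties of the form\<close>

definition form :: form1 where
  "form = (\<lambda>i. if i = 0 then formA else formB)"

lemma holo_poly2: "p \<in> Cn n \<Longrightarrow> holo_at n p (poly2 P)"
proof (induction P rule: pCons_induct)
  case 0
  then show ?case by (simp add: poly2_def[abs_def] holo_at_const)
next
  case (pCons a P)
  have "holo_at n p (\<lambda>z. poly a (z 0))"
    using pCons.prems by (induction a rule: pCons_induct) (auto intro!: holo_intros)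
  moreover have "poly2 (pCons a P) = (\<lambda>z. poly a (z 0) + z 1 * poly2 P z)"
    by (simp add: poly2_def fun_eq_iff)
  ultimately show ?case using pCons by (auto intro!: holo_intros)
qed

lemma zariski_open_near:
  assumes "zariski_open N" "p \<in> N"
  shows "eventually (\<lambda>z. z \<in> N) (near 2 p)"
proof -
  obtain S where S: "N = Cn 2 - {z. \<forall>P\<in>S. poly2 P z = 0}"
    using assms unfolding zariski_open_def by blast
  then obtain P where P: "P \<in> S" "poly2 P p \<noteq> 0" "p \<in> Cn 2" using assms by blast
  have "eventually (\<lambda>z. poly2 P z \<noteq> 0) (near 2 p)"
    using tendsto_imp_eventually_ne[OF holo_at_tendsto[OF holo_poly2[OF P(3)]] P(2)] .
  moreover have "eventually (\<lambda>z. z \<in> Cn 2) (near 2 p)"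
    by (simp add: eventually_inf_principal)
  ultimately show ?thesis by eventually_elim (use S P in blast)
qed

lemma regular_imp_holo:
  assumes "regular N f" "p \<in> N" "p \<in> Cn 2"
  shows "holo_at 2 p f"
proof -
  obtain N' P Q where N: "zariski_open N'" "p \<in> N'"
    "\<forall>z\<in>N'. poly2 Q z \<noteq> 0 \<and> f z = poly2 P z / poly2 Q z"
    using assms unfolding regular_def by blast
  have "holo_at 2 p (\<lambda>z. poly2 P z * inverse (poly2 Q z))"
    using N assms(3) by (intro holo_at_mult holo_at_inverse holo_poly2) auto
  moreover have "eventually (\<lambda>z. poly2 P z * inverse (poly2 Q z) = f z) (near 2 p)"
    using zariski_open_near[OF N(1,2)] by eventually_elim (use N(3) in \<open>auto simp: divide_inverse\<close>)
  ultimately show ?thesis by (rule holo_at_cong)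
qed

lemma regular_quotient:
  assumes "zariski_open N" "\<And>z. z \<in> N \<Longrightarrow> poly2 Q z \<noteq> 0"
  shows "regular N (\<lambda>z. poly2 P z / poly2 Q z)"
  unfolding regular_def using assms by blast

lemma regular_poly2: "zariski_open N \<Longrightarrow> regular N (poly2 P)"
  using regular_quotient[of N 1 P] by simp

text \<open>Regular functions are holomorphic and Zariski neighbourhoods are Euclidean ones, so
  exclusion from the analytic ideal implies exclusion from the algebraic one.\<close>

lemma in_alg_ideal_imp_in_ideal:
  assumes "in_alg_ideal_at U form origin f"
  shows "in_ideal f"
proof -
  obtain N a b where N: "zariski_open N" "origin \<in> N" "regular N a" "regular N b"
    "\<forall>z\<in>N. f z = a z * form 0 z + b z * form 1 z"
    using assms unfolding in_alg_ideal_at_def by blast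
  have "eventually (\<lambda>z. f z = a z * formA z + b z * formB z) (near 2 origin)"
    using zariski_open_near[OF N(1,2)] by eventually_elim (use N(5) in \<open>auto simp: form_def\<close>)
  then show ?thesis
    unfolding in_ideal_def
    using regular_imp_holo[OF N(3,2) origin_Cn] regular_imp_holo[OF N(4,2) origin_Cn] by blast
qed

lemma form_almost_closed_eq: "partial 1 formA z - partial 0 formB z = z 0 * formA z"
proof -
  have "((\<lambda>t. formA (z(1 := t))) has_field_derivative
      (40 * z 0 ^ 3 * z 1 ^ 9 + 49 * z 0 ^ 6 * z 1 ^ 6 + 40 * z 0 ^ 9 * z 1 ^ 3)) (at (z 1))"
    unfolding formA_def by (auto intro!: derivative_eq_intros simp: algebra_simps)
  then have 1: "partial 1 formA z = 40 * z 0 ^ 3 * z 1 ^ 9 + 49 * z 0 ^ 6 * z 1 ^ 6 + 40 * z 0 ^ 9 * z 1 ^ 3"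
    unfolding partial_def by (rule DERIV_imp_deriv)
  have "((\<lambda>t. formB (z(0 := t))) has_field_derivative
      (40 * z 0 ^ 3 * z 1 ^ 9 + 49 * z 0 ^ 6 * z 1 ^ 6 + 40 * z 0 ^ 9 * z 1 ^ 3
       - (13 * z 0 ^ 13 + 4 * z 0 ^ 4 * z 1 ^ 10 + 7 * z 0 ^ 7 * z 1 ^ 7 + 10 * z 0 ^ 10 * z 1 ^ 4))) (at (z 0))"
    unfolding formB_def by (auto intro!: derivative_eq_intros simp: algebra_simps)
  then have 2: "partial 0 formB z = 40 * z 0 ^ 3 * z 1 ^ 9 + 49 * z 0 ^ 6 * z 1 ^ 6 + 40 * z 0 ^ 9 * z 1 ^ 3
       - (13 * z 0 ^ 13 + 4 * z 0 ^ 4 * z 1 ^ 10 + 7 * z 0 ^ 7 * z 1 ^ 7 + 10 * z 0 ^ 10 * z 1 ^ 4)"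
    unfolding partial_def by (rule DERIV_imp_deriv)
  show ?thesis unfolding 1 2 formA_def by (simp add: algebra_simps eval_nat_numeral)
qed

text \<open>U is the locus where h is nonzero. On it all monomials of degree 23 lie in the ideal,
  which removes every zero except the origin and makes x nilpotent. The last clause carries the same
  fact over to holomorphic germs.\<close>

lemma form_algebraic_properties:
  obtains U where "zariski_open U" "origin \<in> U" "algebraic_form U form" "almost_closed U form"
    "nonreduced_point U form origin" "\<And>i j. i + j \<ge> 23 \<Longrightarrow> in_ideal (\<lambda>z. z 0 ^ i * z 1 ^ j)"
proof -
  obtain h where h: "poly2 h origin = 1"
    "\<And>k. k \<le> 23 \<Longrightarrow> \<exists>a b. h * monom (monom 1 k) (23 - k) = a * polyA + b * polyB"
    using monomials_in_ideal by blast
  have h2: "\<exists>a b. \<forall>z. poly2 h z * (z 0 ^ k * z 1 ^ (23 - k)) = poly2 a z * formA z + poly2 b z * formB z"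
    if k: "k \<le> 23" for k
  proof -
    obtain a b where "h * monom (monom 1 k) (23 - k) = a * polyA + b * polyB"
      using h(2)[OF k] by blast
    then have "poly2 (h * monom (monom 1 k) (23 - k)) z = poly2 (a * polyA + b * polyB) z" for z
      by simp
    then show ?thesis by (auto simp: poly2_polyA poly2_polyB)
  qed
  define U where "U = Cn 2 - {z. \<forall>P\<in>{h}. poly2 P z = 0}"
  have U: "zariski_open U" "origin \<in> U" "\<And>z. z \<in> U \<Longrightarrow> poly2 h z \<noteq> 0" "\<And>z. z \<in> U \<Longrightarrow> z \<in> Cn 2"
    unfolding zariski_open_def U_def using h(1) by auto
  have fA: "regular U formA" and fB: "regular U formB"
    using regular_poly2[OF U(1)] poly2_polyA poly2_polyB by metis+
  have "algebraic_form U form"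
    using fA fB by (simp add: algebraic_form_def form_def)
  moreover have "almost_closed U form"
    unfolding almost_closed_def in_alg_ideal_at_def
  proof
    fix p assume p: "p \<in> U"
    have "(\<lambda>z. z 0) = poly2 (monom (monom 1 1) 0)" "(\<lambda>z. 0) = poly2 0" by auto
    then have "regular U (\<lambda>z. z 0)" "regular U (\<lambda>z. 0)" using regular_poly2[OF U(1)] by metis+
    then show "\<exists>N a b. zariski_open N \<and> p \<in> N \<and> N \<subseteq> U \<and> regular N a \<and> regular N b \<and>
       (\<forall>z\<in>N. partial 1 (form 0) z - partial 0 (form 1) z = a z * form 0 z + b z * form 1 z)"
      using U(1) p form_almost_closed_eq
      by (intro exI[of _ U] exI[of _ "\<lambda>z. z 0"] exI[of _ "\<lambda>z. 0"]) (auto simp: form_def)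
  qed
  moreover have "zero_set 2 U form = {origin}"
  proof -
    have zero_unique: "z = origin" if z: "z \<in> U" "formA z = 0" "formB z = 0" for z
    proof -
      have "poly2 h z * (z 0 ^ k * z 1 ^ (23 - k)) = 0" if k: "k \<le> 23" for k
      proof -
        obtain a b where "\<forall>z. poly2 h z * (z 0 ^ k * z 1 ^ (23 - k)) = poly2 a z * formA z + poly2 b z * formB z"
          using h2[OF k] by blast
        then show ?thesis using z(2,3) by (metis add_0 mult_zero_right)
      qed
      \<comment> \<open>These are the pure powers x^23 and y^23.\<close>
      from this[of 23] this[of 0] U(3)[OF z(1)] have zz: "z 0 = 0" "z 1 = 0" by auto
      have "z i = 0" if "i \<ge> 2" for i using U(4)[OF z(1)] that by (simp add: Cn_def)
      moreover have "i = 0 \<or> i = 1 \<or> i \<ge> 2" for i :: nat by linarith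
      ultimately show ?thesis using zz by (intro ext) metis
    qed
    have orig: "formA origin = 0" "formB origin = 0" by (simp_all add: formA_def formB_def)
    have all2: "(\<forall>i<2. form i z = 0) \<longleftrightarrow> formA z = 0 \<and> formB z = 0" for z
      by (auto simp: form_def numeral_2_eq_2 less_Suc_eq)
    show ?thesis
    proof (intro equalityI subsetI)
      fix z assume "z \<in> zero_set 2 U form"
      then have "z \<in> U" "formA z = 0" "formB z = 0" by (simp_all only: zero_set_def mem_Collect_eq all2)
      then have "z = origin" by (rule zero_unique)
      then show "z \<in> {origin}" by (simp only: singleton_iff)
    next
      fix z assume "z \<in> {origin}"
      then have "z = origin" by (simp only: singleton_iff)
      then show "z \<in> zero_set 2 U form" using U(2) orig by (simp only: zero_set_def mem_Collect_eq all2)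
    qed
  qed
  moreover have "nonreduced_at U form origin"
    unfolding nonreduced_at_def
  proof (intro exI conjI)
    have "(\<lambda>z. z 0) = poly2 (monom (monom 1 1) 0)" by auto
    then show "regular U (\<lambda>z. z 0)" using regular_poly2[OF U(1)] by metis
    have "coef 1 0 (\<lambda>z. z 0) = 1"
      using coef_coord0[of "\<lambda>_. 1" 1 0] by (simp add: holo_at_const)
    then show "\<not> in_alg_ideal_at U form origin (\<lambda>z. z 0)"
      using in_ideal_coef_10 in_alg_ideal_imp_in_ideal by fastforce
    obtain a b where ab: "\<And>z. poly2 h z * (z 0 ^ 23 * z 1 ^ (23 - 23)) = poly2 a z * formA z + poly2 b z * formB z"
      using h2[of 23] by auto
    have "z 0 ^ 23 = poly2 a z / poly2 h z * form 0 z + poly2 b z / poly2 h z * form 1 z" if "z \<in> U" for z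
      using ab[of z] U(3)[OF that] by (simp add: form_def field_simps)
    then show "in_alg_ideal_at U form origin (\<lambda>z. z 0 ^ 23)"
      unfolding in_alg_ideal_at_def using U regular_quotient[OF U(1,3)]
      by (intro exI[of _ U] exI[of _ "\<lambda>z. poly2 a z / poly2 h z"] exI[of _ "\<lambda>z. poly2 b z / poly2 h z"]) auto
  qed (use U in auto)
  moreover have "in_ideal (\<lambda>z. z 0 ^ i * z 1 ^ j)" if ij: "i + j \<ge> 23" for i j
  proof -
    \<comment> \<open>Splits off from x^i y^j a divisor of degree exactly 23.\<close>
    define k where "k = min i 23"
    have k: "k \<le> 23" "k \<le> i" "23 - k \<le> j" using ij by (auto simp: k_def)
    obtain a b where ab: "\<And>z. poly2 h z * (z 0 ^ k * z 1 ^ (23 - k)) = poly2 a z * formA z + poly2 b z * formB z"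
      using h2[OF k(1)] by auto
    let ?r = "\<lambda>z. z 0 ^ (i - k) * z 1 ^ (j - (23 - k)) * inverse (poly2 h z)"
    have r: "holo2 ?r"
      using h(1) by (intro holo_at_mult holo_at_power holo_at_coord holo_at_inverse holo_poly2) auto
    have "z 0 ^ i * z 1 ^ j = (?r z * poly2 a z) * formA z + (?r z * poly2 b z) * formB z" if "z \<in> U" for z
    proof -
      have "z 0 ^ i * z 1 ^ j = (z 0 ^ (i - k) * z 1 ^ (j - (23 - k))) * (z 0 ^ k * z 1 ^ (23 - k))"
        using k by (simp add: mult_ac flip: power_add)
      also have "\<dots> = ?r z * (poly2 h z * (z 0 ^ k * z 1 ^ (23 - k)))"
        using U(3)[OF that] by simp
      finally show ?thesis unfolding ab by (simp add: algebra_simps)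
    qed
    then have "eventually (\<lambda>z. z 0 ^ i * z 1 ^ j = (?r z * poly2 a z) * formA z + (?r z * poly2 b z) * formB z) (near 2 origin)"
      using zariski_open_near[OF U(1,2)] by (rule eventually_mono[rotated])
    then show ?thesis
      unfolding in_ideal_def using r by (blast intro: holo_at_mult holo_poly2 origin_Cn)
  qed
  ultimately show ?thesis
    using that[of U] U(1,2) by (auto simp: nonreduced_point_def)
qed

section \<open>Stalks of zero schemes\<close>

text \<open>Membership in the stalk of the ideal, expressed with functions instead of cosets; all
  later ideal computations are carried out at this level.\<close>

definition comb :: "nat \<Rightarrow> point \<Rightarrow> form1 \<Rightarrow> (point \<Rightarrow> complex) \<Rightarrow> bool" where
  "comb n p \<omega> f \<longleftrightarrow> (\<exists>q. (\<forall>i<n. holo_at n p (q i)) \<and>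
     eventually (\<lambda>z. f z = (\<Sum>i<n. q i z * \<omega> i z)) (near n p))"

lemma comb_cong:
  assumes "comb n p \<omega> f" "eventually (\<lambda>z. f z = g z) (near n p)"
  shows "comb n p \<omega> g"
proof -
  obtain q where q: "\<forall>i<n. holo_at n p (q i)" "eventually (\<lambda>z. f z = (\<Sum>i<n. q i z * \<omega> i z)) (near n p)"
    using assms unfolding comb_def by blast
  have "eventually (\<lambda>z. g z = (\<Sum>i<n. q i z * \<omega> i z)) (near n p)"
    using q(2) assms(2) by eventually_elim simp
  then show ?thesis using q(1) unfolding comb_def by blast
qed

lemma comb_add:
  assumes "comb n p \<omega> f" "comb n p \<omega> g"
  shows "comb n p \<omega> (\<lambda>z. f z + g z)"
proof -
  obtain q r where q: "\<forall>i<n. holo_at n p (q i)" "eventually (\<lambda>z. f z = (\<Sum>i<n. q i z * \<omega> i z)) (near n p)"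
    and r: "\<forall>i<n. holo_at n p (r i)" "eventually (\<lambda>z. g z = (\<Sum>i<n. r i z * \<omega> i z)) (near n p)"
    using assms unfolding comb_def by blast
  have "eventually (\<lambda>z. f z + g z = (\<Sum>i<n. (q i z + r i z) * \<omega> i z)) (near n p)"
    using q(2) r(2) by eventually_elim (simp add: sum.distrib algebra_simps)
  then show ?thesis using q(1) r(1) unfolding comb_def
    by (intro exI[of _ "\<lambda>i z. q i z + r i z"]) (auto intro: holo_at_add)
qed

lemma comb_mult:
  assumes "holo_at n p g" "comb n p \<omega> f"
  shows "comb n p \<omega> (\<lambda>z. g z * f z)"
proof -
  obtain q where q: "\<forall>i<n. holo_at n p (q i)" "eventually (\<lambda>z. f z = (\<Sum>i<n. q i z * \<omega> i z)) (near n p)"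
    using assms unfolding comb_def by blast
  have "eventually (\<lambda>z. g z * f z = (\<Sum>i<n. (g z * q i z) * \<omega> i z)) (near n p)"
    using q(2) by eventually_elim (simp add: sum_distrib_left algebra_simps)
  then show ?thesis using q(1) assms(1) unfolding comb_def
    by (intro exI[of _ "\<lambda>i z. g z * q i z"]) (auto intro: holo_at_mult)
qed

lemma comb_null:
  assumes "p \<in> Cn n" "eventually (\<lambda>z. f z = 0) (near n p)"
  shows "comb n p \<omega> f"
  unfolding comb_def using assms by (intro exI[of _ "\<lambda>i z. 0"]) (auto intro: holo_at_const)

lemma comb_generator:
  assumes "p \<in> Cn n" "i < n"
  shows "comb n p \<omega> (\<omega> i)"
  unfolding comb_def using assms
  by (intro exI[of _ "\<lambda>j z. if j = i then 1 else 0"])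
    (auto intro: holo_at_const simp: if_distrib[of "\<lambda>x. x * _"] cong: if_cong)

lemma comb_holo:
  assumes "p \<in> Cn n" "\<And>i. i < n \<Longrightarrow> holo_at n p (\<omega> i)" "comb n p \<omega> f"
  shows "holo_at n p f"
proof -
  obtain q where q: "\<forall>i<n. holo_at n p (q i)" "eventually (\<lambda>z. f z = (\<Sum>i<n. q i z * \<omega> i z)) (near n p)"
    using assms unfolding comb_def by blast
  have "holo_at n p (\<lambda>z. \<Sum>i<n. q i z * \<omega> i z)"
    using assms q by (intro holo_intros) auto
  then show ?thesis
    by (rule holo_at_cong) (use q(2) in eventually_elim, simp)
qed

section \<open>The ring of germs and its quotient by a zero ideal\<close>

lemma hol_near_simps:
  "f \<in> carrier (hol_near n p) \<longleftrightarrow> holo_at n p f"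
  "f \<oplus>\<^bsub>hol_near n p\<^esub> g = (\<lambda>z. f z + g z)"
  "f \<otimes>\<^bsub>hol_near n p\<^esub> g = (\<lambda>z. f z * g z)"
  "\<zero>\<^bsub>hol_near n p\<^esub> = (\<lambda>_. 0)" "\<one>\<^bsub>hol_near n p\<^esub> = (\<lambda>_. 1)"
  by (simp_all add: hol_near_def holo_at_def)

context
  fixes n p assumes p: "p \<in> Cn n"
begin

interpretation R: cring "hol_near n p"
proof (rule cringI)
  show "abelian_group (hol_near n p)"
  proof (rule abelian_groupI)
    show "\<exists>y\<in>carrier (hol_near n p). y \<oplus>\<^bsub>hol_near n p\<^esub> x = \<zero>\<^bsub>hol_near n p\<^esub>"
      if "x \<in> carrier (hol_near n p)" for x
      using that by (intro bexI[of _ "\<lambda>z. - x z"]) (auto simp: hol_near_simps intro: holo_at_uminus)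
  qed (use p in \<open>auto simp: hol_near_simps add_ac intro: holo_intros\<close>)
  show "comm_monoid (hol_near n p)"
    by (rule comm_monoidI) (use p in \<open>auto simp: hol_near_simps mult_ac intro: holo_intros\<close>)
qed (auto simp: hol_near_simps algebra_simps)

lemma hol_near_minus:
  assumes "holo_at n p f" "holo_at n p g"
  shows "f \<ominus>\<^bsub>hol_near n p\<^esub> g = (\<lambda>z. f z - g z)"
proof -
  have "\<ominus>\<^bsub>hol_near n p\<^esub> g = (\<lambda>z. - g z)"
    using assms by (intro R.minus_equality) (auto simp: hol_near_simps intro: holo_at_uminus)
  then show ?thesis by (simp add: a_minus_def hol_near_simps)
qed

lemma null_near_iff: "f \<in> null_near n p \<longleftrightarrow> eventually (\<lambda>z. f z = 0) (near n p)"
  by (simp add: null_near_def eventually_near[OF p])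

lemma ideal_hol_nearI:
  assumes "\<And>f. f \<in> I \<Longrightarrow> holo_at n p f" "(\<lambda>_. 0) \<in> I"
    "\<And>f g. f \<in> I \<Longrightarrow> g \<in> I \<Longrightarrow> (\<lambda>z. f z + g z) \<in> I"
    "\<And>f g. holo_at n p g \<Longrightarrow> f \<in> I \<Longrightarrow> (\<lambda>z. g z * f z) \<in> I"
  shows "ideal I (hol_near n p)"
proof (rule idealI[OF R.ring_axioms])
  have "(\<lambda>z. - f z) \<in> I" if "f \<in> I" for f
    using assms(4)[OF holo_at_const[OF p, of "-1"] that] by simp
  moreover have "\<ominus>\<^bsub>hol_near n p\<^esub> f = (\<lambda>z. - f z)" if "f \<in> I" for f
    using assms(1)[OF that] by (intro R.minus_equality) (auto simp: hol_near_simps intro: holo_at_uminus)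
  ultimately show "subgroup I (add_monoid (hol_near n p))"
    using assms(1-3)
    by (intro R.add.subgroupI) (auto simp: hol_near_simps simp flip: a_inv_def)
  show "x \<otimes>\<^bsub>hol_near n p\<^esub> f \<in> I" "f \<otimes>\<^bsub>hol_near n p\<^esub> x \<in> I"
    if "f \<in> I" "x \<in> carrier (hol_near n p)" for f x
    using assms(4)[of x f] that mult.commute[of "f _" "x _"] by (simp_all only: hol_near_simps)
qed

lemma ideal_null_near: "ideal (null_near n p) (hol_near n p)"
proof (rule ideal_hol_nearI)
  fix f assume "f \<in> null_near n p"
  then have "eventually (\<lambda>z. 0 = f z) (near n p)"
    unfolding null_near_iff by eventually_elim simp
  then show "holo_at n p f" by (rule holo_at_cong[OF holo_at_const[OF p]])
next
  fix f g assume "f \<in> null_near n p" "g \<in> null_near n p"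
  then show "(\<lambda>z. f z + g z) \<in> null_near n p"
    unfolding null_near_iff by eventually_elim simp
next
  fix f g assume "f \<in> null_near n p"
  then show "(\<lambda>z. g z * f z) \<in> null_near n p"
    unfolding null_near_iff by eventually_elim simp
qed (simp add: null_near_iff)

lemma germ_ring_cring: "cring (germ_ring n p)"
  unfolding germ_ring_def using ideal.quotient_is_cring[OF ideal_null_near R.is_cring] .

lemma germ_hom: "germ n p \<in> ring_hom (hol_near n p) (germ_ring n p)"
  unfolding germ_ring_def germ_def using ideal.rcos_ring_hom[OF ideal_null_near] .

lemma germ_simps:
  assumes "holo_at n p f" "holo_at n p g"
  shows "germ n p f \<in> carrier (germ_ring n p)"
    "germ n p f \<oplus>\<^bsub>germ_ring n p\<^esub> germ n p g = germ n p (\<lambda>z. f z + g z)"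
    "germ n p f \<otimes>\<^bsub>germ_ring n p\<^esub> germ n p g = germ n p (\<lambda>z. f z * g z)"
  using ring_hom_memE[OF germ_hom] assms by (auto simp: hol_near_simps)

lemma carrier_germ_ring: "carrier (germ_ring n p) = germ n p ` {f. holo_at n p f}"
  unfolding germ_ring_def FactRing_def A_RCOSETS_def' germ_def by (auto simp: hol_near_simps)

lemma germ_eq_iff:
  assumes "holo_at n p f" "holo_at n p g"
  shows "germ n p f = germ n p g \<longleftrightarrow> eventually (\<lambda>z. f z = g z) (near n p)"
  using R.quotient_eq_iff_same_a_r_cos[OF ideal_null_near, of f g] assms
  by (simp add: germ_def hol_near_simps hol_near_minus null_near_iff)

lemma germ_minus:
  assumes "holo_at n p f" "holo_at n p g"
  shows "germ n p f \<ominus>\<^bsub>germ_ring n p\<^esub> germ n p g = germ n p (\<lambda>z. f z - g z)"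
proof -
  interpret G: cring "germ_ring n p" by (rule germ_ring_cring)
  have c: "germ n p f \<in> carrier (germ_ring n p)" "germ n p g \<in> carrier (germ_ring n p)"
    "germ n p (\<lambda>z. f z - g z) \<in> carrier (germ_ring n p)"
    using germ_simps(1) assms holo_at_diff by blast+
  have eq: "germ n p f = germ n p (\<lambda>z. f z - g z) \<oplus>\<^bsub>germ_ring n p\<^esub> germ n p g"
    using germ_simps(2)[OF holo_at_diff[OF assms] assms(2)] by simp
  show ?thesis
    unfolding eq using c by (simp add: G.minus_eq G.a_assoc G.r_neg)
qed

context
  fixes \<omega> assumes holo_all: "\<forall>i<n. holo_at n p (\<omega> i)"
begin

lemma holo_coefficient: "i < n \<Longrightarrow> holo_at n p (\<omega> i)"
  using holo_all by blast

lemma ideal_comb: "ideal {f. comb n p \<omega> f} (hol_near n p)"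
  using comb_holo[OF p holo_coefficient] comb_add comb_mult comb_null[OF p]
  by (intro ideal_hol_nearI) auto

lemma ideal_zero_ideal: "ideal (zero_ideal n \<omega> p) (germ_ring n p)"
  unfolding zero_ideal_def
  using germ_simps(1) holo_coefficient by (intro ring.genideal_ideal cring.axioms(1)[OF germ_ring_cring]) auto

text \<open>In one direction, the germs of combinations form an ideal containing the generators, and
  the generated ideal is the smallest such. In the other, a combination is assembled term by term
  inside the ideal.\<close>

lemma germ_in_zero_ideal_iff:
  assumes f: "holo_at n p f"
  shows "germ n p f \<in> zero_ideal n \<omega> p \<longleftrightarrow> comb n p \<omega> f"
proof
  interpret G: cring "germ_ring n p" by (rule germ_ring_cring)
  assume "germ n p f \<in> zero_ideal n \<omega> p"
  moreover have "zero_ideal n \<omega> p \<subseteq> germ n p ` {f. comb n p \<omega> f}"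
    unfolding zero_ideal_def
  proof (rule G.genideal_minimal)
    show "ideal (germ n p ` {f. comb n p \<omega> f}) (germ_ring n p)"
      using R.ring_ideal_imp_quot_ideal[OF ideal_null_near ideal_comb]
      by (simp add: germ_ring_def germ_def[abs_def])
  qed (use comb_generator[OF p] in auto)
  ultimately obtain g where g: "comb n p \<omega> g" "germ n p f = germ n p g" by auto
  then have "eventually (\<lambda>z. g z = f z) (near n p)"
    using germ_eq_iff f comb_holo[OF p holo_coefficient g(1)] by (auto simp: eq_commute)
  then show "comb n p \<omega> f" using comb_cong[OF g(1)] by blast
next
  interpret G: cring "germ_ring n p" by (rule germ_ring_cring)
  assume "comb n p \<omega> f"
  then obtain q where q: "\<And>i. i < n \<Longrightarrow> holo_at n p (q i)"
    "eventually (\<lambda>z. f z = (\<Sum>i<n. q i z * \<omega> i z)) (near n p)"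
    unfolding comb_def by blast
  interpret Z: ideal "zero_ideal n \<omega> p" "germ_ring n p" by (rule ideal_zero_ideal)
  have h: "holo_at n p (\<lambda>z. \<Sum>i<m. q i z * \<omega> i z)" if "m \<le> n" for m
    using that q holo_coefficient p by (intro holo_intros) auto
  have gen: "germ n p (\<omega> i) \<in> zero_ideal n \<omega> p" if "i < n" for i
  proof -
    have "{germ n p (\<omega> i) | i. i < n} \<subseteq> carrier (germ_ring n p)"
      using germ_simps(1)[OF holo_coefficient] holo_coefficient by blast
    then show ?thesis unfolding zero_ideal_def using G.genideal_self that by blast
  qed
  have "germ n p (\<lambda>z. \<Sum>i<m. q i z * \<omega> i z) \<in> zero_ideal n \<omega> p" if "m \<le> n" for m
    using that
  proof (induction m)
    case 0
    have "germ n p (\<lambda>_. 0) = \<zero>\<^bsub>germ_ring n p\<^esub>"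
      using ring_hom_zero[OF germ_hom R.ring_axioms G.ring_axioms] by (simp add: hol_near_simps)
    then show ?case using Z.zero_closed by simp
  next
    case (Suc m)
    have m: "m < n" using Suc by simp
    have "germ n p (q m) \<otimes>\<^bsub>germ_ring n p\<^esub> germ n p (\<omega> m) \<in> zero_ideal n \<omega> p"
      using gen[OF m] germ_simps(1)[OF q(1)[OF m] q(1)[OF m]] by (rule Z.I_l_closed)
    then have "germ n p (\<lambda>z. q m z * \<omega> m z) \<in> zero_ideal n \<omega> p"
      using germ_simps(3)[OF q(1)[OF m] holo_coefficient[OF m]] by simp
    with Suc have "germ n p (\<lambda>z. \<Sum>i<m. q i z * \<omega> i z) \<oplus>\<^bsub>germ_ring n p\<^esub> germ n p (\<lambda>z. q m z * \<omega> m z) \<in> zero_ideal n \<omega> p"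
      by (intro Z.a_closed) auto
    then show ?case
      using germ_simps(2)[OF h[of m] holo_at_mult[OF q(1)[OF m] holo_coefficient[OF m]]] m by simp
  qed
  from this[of n] show "germ n p f \<in> zero_ideal n \<omega> p"
    using germ_eq_iff[OF f h[of n]] q(2) by simp
qed

lemma stalk_class_hom:
  assumes "holo_at n p f" "holo_at n p g"
  shows "stalk_class n \<omega> p f \<in> carrier (zero_stalk n \<omega> p)"
    "stalk_class n \<omega> p f \<oplus>\<^bsub>zero_stalk n \<omega> p\<^esub> stalk_class n \<omega> p g = stalk_class n \<omega> p (\<lambda>z. f z + g z)"
    "stalk_class n \<omega> p f \<otimes>\<^bsub>zero_stalk n \<omega> p\<^esub> stalk_class n \<omega> p g = stalk_class n \<omega> p (\<lambda>z. f z * g z)"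
proof -
  note hom = ideal.rcos_ring_hom[OF ideal_zero_ideal]
  note c = germ_simps(1)[OF assms] germ_simps(1)[OF assms(2,2)]
  show "stalk_class n \<omega> p f \<in> carrier (zero_stalk n \<omega> p)"
    unfolding stalk_class_def zero_stalk_def by (rule ring_hom_memE(1)[OF hom c(1)])
  show "stalk_class n \<omega> p f \<oplus>\<^bsub>zero_stalk n \<omega> p\<^esub> stalk_class n \<omega> p g = stalk_class n \<omega> p (\<lambda>z. f z + g z)"
    unfolding stalk_class_def zero_stalk_def germ_simps(2)[OF assms, symmetric]
    by (rule ring_hom_memE(3)[OF hom c, symmetric])
  show "stalk_class n \<omega> p f \<otimes>\<^bsub>zero_stalk n \<omega> p\<^esub> stalk_class n \<omega> p g = stalk_class n \<omega> p (\<lambda>z. f z * g z)"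
    unfolding stalk_class_def zero_stalk_def germ_simps(3)[OF assms, symmetric]
    by (rule ring_hom_memE(2)[OF hom c, symmetric])
qed

lemma carrier_zero_stalk: "carrier (zero_stalk n \<omega> p) = stalk_class n \<omega> p ` {f. holo_at n p f}"
  unfolding zero_stalk_def FactRing_def A_RCOSETS_def' stalk_class_def carrier_germ_ring by auto

lemma stalk_class_eq_iff:
  assumes "holo_at n p f" "holo_at n p g"
  shows "stalk_class n \<omega> p f = stalk_class n \<omega> p g \<longleftrightarrow> comb n p \<omega> (\<lambda>z. f z - g z)"
proof -
  interpret G: cring "germ_ring n p" by (rule germ_ring_cring)
  show ?thesis
    using G.quotient_eq_iff_same_a_r_cos[OF ideal_zero_ideal, of "germ n p f" "germ n p g"]
      germ_simps(1)[OF assms] germ_simps(1)[OF assms(2,2)]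
    by (simp add: stalk_class_def germ_minus[OF assms] germ_in_zero_ideal_iff[OF holo_at_diff[OF assms]])
qed

end

end

lemma holo_form: "p \<in> Cn n \<Longrightarrow> holo_at n p (form i)"
  by (simp add: form_def holo_formA holo_formB)

lemma comb_form_iff: "comb 2 origin form f \<longleftrightarrow> in_ideal f"
proof
  assume "comb 2 origin form f"
  then obtain q where "\<forall>i<2. holo2 (q i)" "eventually (\<lambda>z. f z = (\<Sum>i<2. q i z * form i z)) (near 2 origin)"
    unfolding comb_def by blast
  then show "in_ideal f"
    unfolding in_ideal_def by (intro exI[of _ "q 0"] exI[of _ "q 1"]) (auto simp: form_def numeral_2_eq_2)
next
  assume "in_ideal f"
  then obtain a b where "holo2 a" "holo2 b" "eventually (\<lambda>z. f z = a z * formA z + b z * formB z) (near 2 origin)"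
    unfolding in_ideal_def by blast
  then show "comb 2 origin form f"
    unfolding comb_def by (intro exI[of _ "\<lambda>i. if i = 0 then a else b"]) (auto simp: form_def numeral_2_eq_2)
qed

section \<open>Ideal membership\<close>

lemma in_ideal_cong:
  "in_ideal f \<Longrightarrow> eventually (\<lambda>z. f z = g z) (near 2 origin) \<Longrightarrow> in_ideal g"
  using comb_cong unfolding comb_form_iff[symmetric] by blast

lemma in_ideal_add: "in_ideal f \<Longrightarrow> in_ideal g \<Longrightarrow> in_ideal (\<lambda>z. f z + g z)"
  using comb_add unfolding comb_form_iff[symmetric] by blast

lemma in_ideal_mult: "holo2 g \<Longrightarrow> in_ideal f \<Longrightarrow> in_ideal (\<lambda>z. g z * f z)"
  using comb_mult unfolding comb_form_iff[symmetric] by blast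

lemma in_ideal_holo: "in_ideal f \<Longrightarrow> holo2 f"
  using comb_holo[of origin 2 form f] unfolding comb_form_iff[symmetric] by (simp add: holo_form)

lemma in_ideal_zero: "in_ideal (\<lambda>_. 0)"
  using comb_null[of origin 2 "\<lambda>_. 0" form] unfolding comb_form_iff[symmetric] by simp

lemma in_ideal_generators: "in_ideal formA" "in_ideal formB"
  using comb_generator[of origin 2 0 form] comb_generator[of origin 2 1 form]
  unfolding comb_form_iff by (auto simp: form_def)

lemma in_ideal_origin: "in_ideal f \<Longrightarrow> f origin = 0"
  unfolding in_ideal_def
  by (auto dest!: near_self[rotated] simp: formA_def formB_def)

lemma in_ideal_monomial: "i + j \<ge> 23 \<Longrightarrow> in_ideal (\<lambda>z. z 0 ^ i * z 1 ^ j)"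
  by (rule form_algebraic_properties) blast

lemma in_ideal_power_diff:
  assumes "holo2 f" "holo2 g" "in_ideal (\<lambda>z. f z - g z)"
  shows "in_ideal (\<lambda>z. f z ^ k - g z ^ k)"
proof (induction k)
  case (Suc k)
  have "in_ideal (\<lambda>z. f z * (f z ^ k - g z ^ k) + g z ^ k * (f z - g z))"
    using assms Suc by (intro in_ideal_add in_ideal_mult holo_at_power)
  then show ?case by (simp add: algebra_simps)
qed (simp add: in_ideal_zero)

text \<open>This is the ideal m I. Modulo it only the values at the origin of the coefficients of A
  and B matter.\<close>

definition in_max_mult_ideal :: "(point \<Rightarrow> complex) \<Rightarrow> bool" where
  "in_max_mult_ideal f \<longleftrightarrow> (\<exists>a b. holo2 a \<and> holo2 b \<and> a origin = 0 \<and> b origin = 0 \<and>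
     eventually (\<lambda>z. f z = a z * formA z + b z * formB z) (near 2 origin))"

lemma in_max_mult_ideal_cong:
  assumes "in_max_mult_ideal f" "eventually (\<lambda>z. f z = g z) (near 2 origin)"
  shows "in_max_mult_ideal g"
proof -
  obtain a b where ab: "holo2 a" "holo2 b" "a origin = 0" "b origin = 0"
     "eventually (\<lambda>z. f z = a z * formA z + b z * formB z) (near 2 origin)"
    using assms(1) unfolding in_max_mult_ideal_def by blast
  have "eventually (\<lambda>z. g z = a z * formA z + b z * formB z) (near 2 origin)"
    using ab(5) assms(2) by eventually_elim simp
  then show ?thesis using ab unfolding in_max_mult_ideal_def by blast
qed

lemma in_max_mult_ideal_add:
  assumes "in_max_mult_ideal f" "in_max_mult_ideal g"
  shows "in_max_mult_ideal (\<lambda>z. f z + g z)"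
proof -
  obtain a b where ab: "holo2 a" "holo2 b" "a origin = 0" "b origin = 0"
     "eventually (\<lambda>z. f z = a z * formA z + b z * formB z) (near 2 origin)"
    using assms(1) unfolding in_max_mult_ideal_def by blast
  obtain c d where cd: "holo2 c" "holo2 d" "c origin = 0" "d origin = 0"
     "eventually (\<lambda>z. g z = c z * formA z + d z * formB z) (near 2 origin)"
    using assms(2) unfolding in_max_mult_ideal_def by blast
  have "eventually (\<lambda>z. f z + g z = (a z + c z) * formA z + (b z + d z) * formB z) (near 2 origin)"
    using ab(5) cd(5) by eventually_elim (simp add: algebra_simps)
  then show ?thesis using ab cd unfolding in_max_mult_ideal_def
    by (intro exI[of _ "\<lambda>z. a z + c z"] exI[of _ "\<lambda>z. b z + d z"]) (auto intro: holo_at_add)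
qed

lemma in_max_mult_ideal_ideal:
  assumes "holo2 g" "g origin = 0" "in_ideal f"
  shows "in_max_mult_ideal (\<lambda>z. g z * f z)"
proof -
  obtain a b where ab: "holo2 a" "holo2 b"
     "eventually (\<lambda>z. f z = a z * formA z + b z * formB z) (near 2 origin)"
    using assms(3) unfolding in_ideal_def by blast
  have "eventually (\<lambda>z. g z * f z = (g z * a z) * formA z + (g z * b z) * formB z) (near 2 origin)"
    using ab(3) by eventually_elim (simp add: algebra_simps)
  then show ?thesis using ab assms unfolding in_max_mult_ideal_def
    by (intro exI[of _ "\<lambda>z. g z * a z"] exI[of _ "\<lambda>z. g z * b z"]) (auto intro: holo_at_mult)
qed

lemma in_max_mult_ideal_mult:
  assumes "holo2 g" "in_max_mult_ideal f"
  shows "in_max_mult_ideal (\<lambda>z. g z * f z)"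
proof -
  obtain a b where ab: "holo2 a" "holo2 b" "a origin = 0" "b origin = 0"
     "eventually (\<lambda>z. f z = a z * formA z + b z * formB z) (near 2 origin)"
    using assms(2) unfolding in_max_mult_ideal_def by blast
  have "eventually (\<lambda>z. g z * f z = (g z * a z) * formA z + (g z * b z) * formB z) (near 2 origin)"
    using ab(5) by eventually_elim (simp add: algebra_simps)
  then show ?thesis using ab assms unfolding in_max_mult_ideal_def
    by (intro exI[of _ "\<lambda>z. g z * a z"] exI[of _ "\<lambda>z. g z * b z"]) (auto intro: holo_at_mult)
qed

lemma in_max_mult_ideal_zero: "in_max_mult_ideal (\<lambda>_. 0)"
  unfolding in_max_mult_ideal_def
  by (intro exI[of _ "\<lambda>_. 0"]) (auto intro: holo_at_const)

lemma in_max_mult_ideal_sum: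
  "(\<And>i. i \<in> I \<Longrightarrow> in_max_mult_ideal (f i)) \<Longrightarrow> in_max_mult_ideal (\<lambda>z. \<Sum>i\<in>I. f i z)"
  by (induction I rule: infinite_finite_induct) (auto intro: in_max_mult_ideal_zero in_max_mult_ideal_add)

text \<open>f f' - g g' = f (f' - g') + g' (f - g), where f and g' lie in m. Hence changing
  coordinates modulo I changes a monomial of degree at least 2 only modulo m I.\<close>

lemma in_max_mult_ideal_mult_diff:
  assumes "holo2 f" "holo2 f'" "holo2 g" "holo2 g'" "f origin = 0" "g' origin = 0"
    "in_ideal (\<lambda>z. f z - g z)" "in_ideal (\<lambda>z. f' z - g' z)"
  shows "in_max_mult_ideal (\<lambda>z. f z * f' z - g z * g' z)"
proof -
  have "in_max_mult_ideal (\<lambda>z. f z * (f' z - g' z) + g' z * (f z - g z))"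
    using assms by (intro in_max_mult_ideal_add in_max_mult_ideal_ideal)
  then show ?thesis by (simp add: algebra_simps)
qed

lemma formA_not_in_max_mult_ideal: "\<not> in_max_mult_ideal formA"
  unfolding in_max_mult_ideal_def using formA_minimal_generator by blast

text \<open>Membership in $I + m^k$, where $I$ is the ideal of the form and $m$ the maximal ideal at the origin.\<close>

primrec in_power :: "nat \<Rightarrow> (point \<Rightarrow> complex) \<Rightarrow> bool" where
  "in_power 0 f \<longleftrightarrow> holo2 f"
| "in_power (Suc k) f \<longleftrightarrow> (\<exists>u v w. in_power k u \<and> in_power k v \<and> in_ideal w \<and>
     eventually (\<lambda>z. f z = z 0 * u z + z 1 * v z + w z) (near 2 origin))"

lemma in_power_cong:
  assumes "in_power k f" "eventually (\<lambda>z. f z = g z) (near 2 origin)"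
  shows "in_power k g"
proof (cases k)
  case 0
  then show ?thesis using assms holo_at_cong by auto
next
  case (Suc k')
  then obtain u v w where uvw: "in_power k' u" "in_power k' v" "in_ideal w"
     "eventually (\<lambda>z. f z = z 0 * u z + z 1 * v z + w z) (near 2 origin)"
    using assms by auto
  have "eventually (\<lambda>z. g z = z 0 * u z + z 1 * v z + w z) (near 2 origin)"
    using uvw(4) assms(2) by eventually_elim simp
  then show ?thesis using uvw Suc by auto
qed

lemma in_power_ideal: "in_ideal f \<Longrightarrow> in_power k f"
proof (induction k arbitrary: f)
  case (Suc k)
  show ?case
    unfolding in_power.simps using Suc.IH[OF in_ideal_zero] Suc.prems
    by (intro exI[of _ "\<lambda>_. 0"] exI[of _ f]) auto
qed (simp add: in_ideal_holo)

lemma in_power_add: "in_power k f \<Longrightarrow> in_power k g \<Longrightarrow> in_power k (\<lambda>z. f z + g z)"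
proof (induction k arbitrary: f g)
  case (Suc k)
  obtain u v w where 1: "in_power k u" "in_power k v" "in_ideal w"
     "eventually (\<lambda>z. f z = z 0 * u z + z 1 * v z + w z) (near 2 origin)"
    using Suc.prems by auto
  obtain u' v' w' where 2: "in_power k u'" "in_power k v'" "in_ideal w'"
     "eventually (\<lambda>z. g z = z 0 * u' z + z 1 * v' z + w' z) (near 2 origin)"
    using Suc.prems by auto
  have "eventually (\<lambda>z. f z + g z = z 0 * (u z + u' z) + z 1 * (v z + v' z) + (w z + w' z)) (near 2 origin)"
    using 1(4) 2(4) by eventually_elim (simp add: algebra_simps)
  then show ?case
    unfolding in_power.simps using Suc.IH[OF 1(1) 2(1)] Suc.IH[OF 1(2) 2(2)] in_ideal_add[OF 1(3) 2(3)] by blast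
qed (auto intro: holo_at_add)

lemma in_power_mult: "holo2 g \<Longrightarrow> in_power k f \<Longrightarrow> in_power k (\<lambda>z. g z * f z)"
proof (induction k arbitrary: f)
  case (Suc k)
  obtain u v w where 1: "in_power k u" "in_power k v" "in_ideal w"
     "eventually (\<lambda>z. f z = z 0 * u z + z 1 * v z + w z) (near 2 origin)"
    using Suc.prems by auto
  have "eventually (\<lambda>z. g z * f z = z 0 * (g z * u z) + z 1 * (g z * v z) + g z * w z) (near 2 origin)"
    using 1(4) by eventually_elim (simp add: algebra_simps)
  then show ?case
    unfolding in_power.simps
    using Suc.IH[OF Suc.prems(1) 1(1)] Suc.IH[OF Suc.prems(1) 1(2)] in_ideal_mult[OF Suc.prems(1) 1(3)] by blast
qed (auto intro: holo_at_mult)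

lemma in_power_sum:
  "(\<And>i. i \<in> I \<Longrightarrow> in_power k (f i)) \<Longrightarrow> in_power k (\<lambda>z. \<Sum>i\<in>I. f i z)"
  by (induction I rule: infinite_finite_induct) (auto intro: in_power_add in_power_ideal in_ideal_zero)

lemma hadamard2:
  assumes "holo2 f"
  obtains u v where "holo2 u" "holo2 v" "u origin = partial 0 f origin" "v origin = partial 1 f origin"
    "eventually (\<lambda>z. f z = f origin + z 0 * u z + z 1 * v z) (near 2 origin)"
proof -
  obtain h where h: "\<And>i. i < 2 \<Longrightarrow> holo2 (h i)"
    "eventually (\<lambda>z. f z = f origin + (\<Sum>i<2. (z i - 0) * h i z)) (near 2 origin)"
    by (rule hadamard[OF assms]) (rule that)
  have "partial i f origin = h i origin" if "i < 2" for i
    using partial_hadamard[OF origin_Cn h(1) that h(2)] by simp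
  moreover have "eventually (\<lambda>z. f z = f origin + z 0 * h 0 z + z 1 * h 1 z) (near 2 origin)"
    using h(2) by (simp add: numeral_2_eq_2 add.assoc)
  ultimately show ?thesis using that[of "h 0" "h 1"] h(1) by auto
qed

text \<open>Hadamard's lemma writes a germ vanishing at the origin as x u + y v.\<close>

lemma in_power_mult_max:
  assumes "holo2 g" "g origin = 0" "in_power k f"
  shows "in_power (Suc k) (\<lambda>z. g z * f z)"
proof -
  obtain u v where uv: "holo2 u" "holo2 v"
    "eventually (\<lambda>z. g z = g origin + z 0 * u z + z 1 * v z) (near 2 origin)"
    by (rule hadamard2[OF assms(1)]) (rule that)
  have "eventually (\<lambda>z. g z * f z = z 0 * (u z * f z) + z 1 * (v z * f z) + 0) (near 2 origin)"
    using uv(3) by eventually_elim (simp add: assms(2) algebra_simps)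
  then show ?thesis
    unfolding in_power.simps
    using in_power_mult[OF uv(1) assms(3)] in_power_mult[OF uv(2) assms(3)] in_ideal_zero by blast
qed

text \<open>Unfolding the recursion collects 23 coordinate factors, and m^23 lies in I. The
  induction carries the factors already collected as x^i y^j.\<close>

lemma in_power_imp_in_ideal:
  assumes "in_power 23 f"
  shows "in_ideal f"
proof -
  have "in_ideal (\<lambda>z. (z 0 ^ i * z 1 ^ j) * f z)" if "in_power k f" "i + j + k \<ge> 23" for i j k f
    using that
  proof (induction k arbitrary: i j f)
    case 0
    then show ?case using in_ideal_mult[of f "\<lambda>z. z 0 ^ i * z 1 ^ j"] in_ideal_monomial[of i j]
      by (simp add: mult.commute)
  next
    case (Suc k)
    obtain u v w where uvw: "in_power k u" "in_power k v" "in_ideal w"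
     "eventually (\<lambda>z. f z = z 0 * u z + z 1 * v z + w z) (near 2 origin)"
      using Suc.prems by auto
    have "in_ideal (\<lambda>z. (z 0 ^ Suc i * z 1 ^ j) * u z + (z 0 ^ i * z 1 ^ Suc j) * v z + (z 0 ^ i * z 1 ^ j) * w z)"
      using Suc.prems by (intro in_ideal_add in_ideal_mult[OF _ uvw(3)] Suc.IH uvw holo_intros) auto
    then show ?case
      by (rule in_ideal_cong) (use uvw(4) in eventually_elim, simp add: algebra_simps)
  qed
  from this[of 23 f 0 0] assms show ?thesis by simp
qed

section \<open>Isomorphisms with stalks of critical loci\<close>

text \<open>One point of the critical locus is enough for both assertions of the theorem.
  \<open>const\<close> makes \<phi> linear over the complex numbers, excluding twists by field
  automorphisms.\<close>

locale critical_stalk_iso =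
  fixes n :: nat and p :: point and \<Phi> :: "point \<Rightarrow> complex" and \<phi> :: "germ set \<Rightarrow> germ set"
  assumes p: "p \<in> Cn n" and holo_Phi: "holo_at n p \<Phi>"
    and iso: "\<phi> \<in> ring_iso (zero_stalk n (diff \<Phi>) p) (zero_stalk 2 form origin)"
    and const: "\<And>c. \<phi> (stalk_class n (diff \<Phi>) p (\<lambda>_. c)) = stalk_class 2 form origin (\<lambda>_. c)"
begin

lemma holo_diff: "i < n \<Longrightarrow> holo_at n p (diff \<Phi> i)"
  by (simp add: diff_def holo_at_partial holo_Phi)

text \<open>\<open>u\<close> is a lift to the plane of the image of \<open>f\<close> under \<phi>.
  Lifts are unique only modulo I; this relation turns computations in quotient rings into
  computations with functions.\<close>

definition rep :: "(point \<Rightarrow> complex) \<Rightarrow> (point \<Rightarrow> complex) \<Rightarrow> bool" where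
  "rep f u \<longleftrightarrow> holo_at n p f \<and> holo2 u \<and>
     \<phi> (stalk_class n (diff \<Phi>) p f) = stalk_class 2 form origin u"

lemma holo_diff_all: "\<forall>i<n. holo_at n p (diff \<Phi> i)"
  by (simp add: holo_diff)

lemma holo_form_all: "\<forall>i<2. holo2 (form i)"
  by (simp add: holo_form)

lemma class_eq:
  "holo_at n p f \<Longrightarrow> holo_at n p g \<Longrightarrow>
    stalk_class n (diff \<Phi>) p f = stalk_class n (diff \<Phi>) p g \<longleftrightarrow> comb n p (diff \<Phi>) (\<lambda>z. f z - g z)"
  using stalk_class_eq_iff[of p n "diff \<Phi>" f g] p holo_diff by blast

lemma class_eq2:
  "holo2 f \<Longrightarrow> holo2 g \<Longrightarrow>
    stalk_class 2 form origin f = stalk_class 2 form origin g \<longleftrightarrow> in_ideal (\<lambda>z. f z - g z)"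
  using stalk_class_eq_iff[of origin 2 form f g] holo_form by (simp add: comb_form_iff)

lemma phi_hom: "\<phi> \<in> ring_hom (zero_stalk n (diff \<Phi>) p) (zero_stalk 2 form origin)"
  using iso by (simp add: ring_iso_def)

lemma phi_bij: "bij_betw \<phi> (carrier (zero_stalk n (diff \<Phi>) p)) (carrier (zero_stalk 2 form origin))"
  using iso by (simp add: ring_iso_def)

lemma rep_exists:
  assumes "holo_at n p f" obtains u where "rep f u"
proof -
  have "\<phi> (stalk_class n (diff \<Phi>) p f) \<in> carrier (zero_stalk 2 form origin)"
    using ring_hom_memE(1)[OF phi_hom] stalk_class_hom(1)[OF p holo_diff_all assms assms] by auto
  then show ?thesis
    using that assms unfolding carrier_zero_stalk[of origin 2 form, OF origin_Cn holo_form_all] rep_def by auto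
qed

lemma rep_surj:
  assumes "holo2 u" obtains f where "rep f u"
proof -
  have "stalk_class 2 form origin u \<in> \<phi> ` carrier (zero_stalk n (diff \<Phi>) p)"
    using stalk_class_hom(1)[OF origin_Cn holo_form_all assms assms] phi_bij by (simp add: bij_betw_def)
  then obtain f where "holo_at n p f" "stalk_class 2 form origin u = \<phi> (stalk_class n (diff \<Phi>) p f)"
    unfolding carrier_zero_stalk[of p n "diff \<Phi>", OF p holo_diff_all] by auto
  then show ?thesis using that[of f] assms by (simp add: rep_def)
qed

lemma rep_add:
  assumes "rep f u" "rep g v"
  shows "rep (\<lambda>z. f z + g z) (\<lambda>z. u z + v z)"
proof -
  have h: "holo_at n p f" "holo_at n p g" "holo2 u" "holo2 v" using assms by (auto simp: rep_def)
  have "\<phi> (stalk_class n (diff \<Phi>) p (\<lambda>z. f z + g z)) =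
     \<phi> (stalk_class n (diff \<Phi>) p f) \<oplus>\<^bsub>zero_stalk 2 form origin\<^esub> \<phi> (stalk_class n (diff \<Phi>) p g)"
    using stalk_class_hom(2)[OF p holo_diff_all h(1,2)] ring_hom_memE(3)[OF phi_hom stalk_class_hom(1)[OF p holo_diff_all h(1,2)] stalk_class_hom(1)[OF p holo_diff_all h(2,1)]]
    by simp
  also have "\<dots> = stalk_class 2 form origin (\<lambda>z. u z + v z)"
    using assms stalk_class_hom(2)[OF origin_Cn holo_form_all h(3,4)] by (simp add: rep_def)
  finally show ?thesis using h by (simp add: rep_def holo_at_add)
qed

lemma rep_mult:
  assumes "rep f u" "rep g v"
  shows "rep (\<lambda>z. f z * g z) (\<lambda>z. u z * v z)"
proof -
  have h: "holo_at n p f" "holo_at n p g" "holo2 u" "holo2 v" using assms by (auto simp: rep_def)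
  have "\<phi> (stalk_class n (diff \<Phi>) p (\<lambda>z. f z * g z)) =
     \<phi> (stalk_class n (diff \<Phi>) p f) \<otimes>\<^bsub>zero_stalk 2 form origin\<^esub> \<phi> (stalk_class n (diff \<Phi>) p g)"
    using stalk_class_hom(3)[OF p holo_diff_all h(1,2)] ring_hom_memE(2)[OF phi_hom stalk_class_hom(1)[OF p holo_diff_all h(1,2)] stalk_class_hom(1)[OF p holo_diff_all h(2,1)]]
    by simp
  also have "\<dots> = stalk_class 2 form origin (\<lambda>z. u z * v z)"
    using assms stalk_class_hom(3)[OF origin_Cn holo_form_all h(3,4)] by (simp add: rep_def)
  finally show ?thesis using h by (simp add: rep_def holo_at_mult)
qed

lemma rep_const: "rep (\<lambda>_. c) (\<lambda>_. c)"
  using const p by (simp add: rep_def holo_at_const)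

lemma rep_power: "rep f u \<Longrightarrow> rep (\<lambda>z. f z ^ k) (\<lambda>z. u z ^ k)"
  by (induction k) (auto intro: rep_const rep_mult)

lemma rep_sum: "(\<And>i. i \<in> I \<Longrightarrow> rep (f i) (u i)) \<Longrightarrow> rep (\<lambda>z. \<Sum>i\<in>I. f i z) (\<lambda>z. \<Sum>i\<in>I. u i z)"
  by (induction I rule: infinite_finite_induct) (auto intro: rep_const rep_add)

lemma rep_diff:
  assumes "rep f u" "rep g v"
  shows "rep (\<lambda>z. f z - g z) (\<lambda>z. u z - v z)"
  using rep_add[OF assms(1) rep_mult[OF rep_const[of "-1"] assms(2)]] by simp

lemma rep_cong:
  assumes "rep f u" "eventually (\<lambda>z. f z = g z) (near n p)"
  shows "rep g u"
proof -
  have g: "holo_at n p g" using assms holo_at_cong by (auto simp: rep_def)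
  have "comb n p (diff \<Phi>) (\<lambda>z. f z - g z)"
    by (rule comb_null[OF p]) (use assms(2) in eventually_elim, simp)
  then show ?thesis using class_eq[of f g] g assms(1) by (simp add: rep_def)
qed

lemma rep_change: "rep f u \<Longrightarrow> holo2 v \<Longrightarrow> in_ideal (\<lambda>z. u z - v z) \<Longrightarrow> rep f v"
  using class_eq2[of u v] by (simp add: rep_def)

lemma rep_unique: "rep f u \<Longrightarrow> rep f v \<Longrightarrow> in_ideal (\<lambda>z. u z - v z)"
  using class_eq2[of u v] by (simp add: rep_def)

text \<open>Injectivity of \<phi>. Both directions matter: the derivatives of \<Phi> are carried
  into I, and A comes back as a combination of these derivatives.\<close>

lemma rep_in_ideal_iff:
  assumes "rep f u"
  shows "in_ideal u \<longleftrightarrow> comb n p (diff \<Phi>) f"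
proof -
  have h: "holo_at n p f" "holo2 u" using assms by (auto simp: rep_def)
  have c: "stalk_class n (diff \<Phi>) p f \<in> carrier (zero_stalk n (diff \<Phi>) p)"
    "stalk_class n (diff \<Phi>) p (\<lambda>_. 0) \<in> carrier (zero_stalk n (diff \<Phi>) p)"
    using stalk_class_hom(1)[OF p holo_diff_all h(1,1)] stalk_class_hom(1)[OF p holo_diff_all holo_at_const[OF p] h(1)] by auto
  have "in_ideal u \<longleftrightarrow> stalk_class 2 form origin u = stalk_class 2 form origin (\<lambda>_. 0)"
    using class_eq2[OF h(2) holo_at_const] by simp
  also have "\<dots> \<longleftrightarrow> \<phi> (stalk_class n (diff \<Phi>) p f) = \<phi> (stalk_class n (diff \<Phi>) p (\<lambda>_. 0))"
    using assms const by (simp add: rep_def)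
  also have "\<dots> \<longleftrightarrow> stalk_class n (diff \<Phi>) p f = stalk_class n (diff \<Phi>) p (\<lambda>_. 0)"
    using phi_bij c by (auto simp: bij_betw_def inj_on_def)
  also have "\<dots> \<longleftrightarrow> comb n p (diff \<Phi>) f"
    using class_eq[OF h(1) holo_at_const[OF p], of 0] by simp
  finally show ?thesis .
qed

text \<open>A ring isomorphism of local algebras is local: if the values differed, f - c with c =
  u(0) would be invertible, yet its lift vanishes at the origin, and so would a lift of 1.\<close>

lemma rep_value:
  assumes "rep f u"
  shows "u origin = f p"
proof (rule ccontr)
  assume ne: "u origin \<noteq> f p"
  define c where "c = u origin"
  have h: "holo_at n p (\<lambda>z. f z - c)"
    using assms p by (auto simp: rep_def intro!: holo_intros)
  then have i: "holo_at n p (\<lambda>z. inverse (f z - c))"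
    by (rule holo_at_inverse) (use ne in \<open>auto simp: c_def\<close>)
  obtain w where w: "rep (\<lambda>z. inverse (f z - c)) w" using rep_exists[OF i] .
  have "rep (\<lambda>z. inverse (f z - c) * (f z - c)) (\<lambda>z. w z * (u z - c))"
    by (intro rep_mult w rep_diff assms rep_const)
  moreover have "eventually (\<lambda>z. f z - c \<noteq> 0) (near n p)"
    by (rule tendsto_imp_eventually_ne[OF holo_at_tendsto[OF h]]) (use ne in \<open>auto simp: c_def\<close>)
  then have "eventually (\<lambda>z. inverse (f z - c) * (f z - c) = 1) (near n p)"
    by eventually_elim simp
  ultimately have "rep (\<lambda>_. 1) (\<lambda>z. w z * (u z - c))" by (rule rep_cong)
  from in_ideal_origin[OF rep_unique[OF this rep_const]] show False
    by (simp add: c_def)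
qed

text \<open>Composition with \<gamma> and \<phi> agree on the coordinates. By repeated Hadamard
  expansion they agree modulo I + m^k for each k, hence modulo I at k = 23; no continuity of \<phi>
  is assumed.\<close>

lemma rep_compose:
  assumes \<gamma>: "\<And>i. i < n \<Longrightarrow> rep (\<lambda>z. z i) (\<gamma> i)" and f: "holo_at n p f"
  shows "rep f (\<lambda>z. f (subst n \<gamma> z))" "subst n \<gamma> origin = p"
proof -
  have g: "holo2 (\<gamma> i)" "\<gamma> i origin = p i" if "i < n" for i
    using \<gamma>[OF that] rep_value[OF \<gamma>[OF that]] by (auto simp: rep_def)
  show s: "subst n \<gamma> origin = p"
    using g(2) p by (auto simp: subst_def Cn_def fun_eq_iff)
  have comp: "holo2 (\<lambda>z. f (subst n \<gamma> z))" if "holo_at n p f" for f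
    using holo_at_compose[of n 2 origin \<gamma> f] g s that by auto
  have "in_power k (\<lambda>z. u z - f (subst n \<gamma> z))" if "rep f u" for k f u
    using that
  proof (induction k arbitrary: f u)
    case 0
    then show ?case using comp by (auto simp: rep_def intro: holo_at_diff)
  next
    case (Suc k)
    have hf: "holo_at n p f" using Suc.prems by (simp add: rep_def)
    obtain h where h: "\<And>i. i < n \<Longrightarrow> holo_at n p (h i)"
      "eventually (\<lambda>z. f z = f p + (\<Sum>i<n. (z i - p i) * h i z)) (near n p)"
      by (rule hadamard[OF hf]) (rule that)
    have "\<forall>i. \<exists>v. i < n \<longrightarrow> rep (h i) v" using rep_exists h(1) by metis
    then obtain v where v: "\<And>i. i < n \<Longrightarrow> rep (h i) (v i)" by metis
    let ?t = "\<lambda>z. f p + (\<Sum>i<n. (\<gamma> i z - p i) * v i z)"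
    have "rep (\<lambda>z. f p + (\<Sum>i<n. (z i - p i) * h i z)) ?t"
      by (intro rep_add rep_sum rep_mult rep_diff rep_const \<gamma> v) auto
    then have "rep f ?t"
      by (rule rep_cong) (use h(2) in eventually_elim, simp)
    then have 1: "in_power (Suc k) (\<lambda>z. u z - ?t z)"
      by (intro in_power_ideal rep_unique[OF Suc.prems])
    have "filterlim (subst n \<gamma>) (near n p) (near 2 origin)"
      using filterlim_subst[of n 2 origin \<gamma>] g(1) unfolding s by blast
    then have "eventually (\<lambda>z. f (subst n \<gamma> z) = f p + (\<Sum>i<n. (subst n \<gamma> z i - p i) * h i (subst n \<gamma> z))) (near 2 origin)"
      by (rule eventually_compose_filterlim[OF h(2)])
    then have 2: "eventually (\<lambda>z. f (subst n \<gamma> z) = f p + (\<Sum>i<n. (\<gamma> i z - p i) * h i (subst n \<gamma> z))) (near 2 origin)"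
      by eventually_elim (simp add: subst_def)
    \<comment> \<open>The factor \<gamma>_i - p_i vanishes at the origin and gains one order over
      the induction hypothesis for h_i.\<close>
    have "in_power (Suc k) (\<lambda>z. \<Sum>i<n. (\<gamma> i z - p i) * (v i z - h i (subst n \<gamma> z)))"
      by (intro in_power_sum in_power_mult_max Suc.IH v holo_at_diff holo_at_const g origin_Cn)
        (use g(2) in auto)
    from in_power_add[OF 1 this] show ?case
      by (rule in_power_cong)
        (use 2 in eventually_elim, simp add: algebra_simps sum_subtractf sum.distrib)
  qed
  from in_power_imp_in_ideal[OF this] obtain u where "rep f u" "in_ideal (\<lambda>z. u z - f (subst n \<gamma> z))"
    using rep_exists[OF f] by metis
  then show "rep f (\<lambda>z. f (subst n \<gamma> z))"
    using rep_change comp[OF f] by blast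
qed

lemma stalk_iso_contradiction: False
proof -
  let ?P = "\<lambda>i. partial i \<Phi>"
  have "\<forall>i. \<exists>u. rep (\<lambda>z. z i) u" using rep_exists holo_at_coord[OF p] by metis
  then obtain \<gamma> where \<gamma>: "\<And>i. rep (\<lambda>z. z i) (\<gamma> i)" by metis
  have h\<gamma>: "holo2 (\<gamma> i)" for i using \<gamma>[of i] by (simp add: rep_def)
  have v\<gamma>: "\<gamma> i origin = p i" for i by (rule rep_value[OF \<gamma>])
  have hP: "holo_at n p (?P i)" if "i < n" for i using holo_Phi that by (rule holo_at_partial)
  have critical: "in_ideal u" if "rep (?P i) u" "i < n" for i u
    using rep_in_ideal_iff[OF that(1)] comb_generator[OF p that(2), of "diff \<Phi>"] by (simp add: diff_def)

  let ?G = "subst n \<gamma>"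
  have G: "rep f (\<lambda>z. f (?G z))" if "holo_at n p f" for f
    by (rule rep_compose(1)) (use \<gamma> that in auto)
  have G0: "?G origin = p" by (rule rep_compose(2)[OF \<gamma> holo_Phi])
  \<comment> \<open>The derivatives of \<Phi> vanish in the source algebra, so their lifts lie in
    I.\<close>
  have "\<forall>i. \<exists>a b. i < n \<longrightarrow> holo2 a \<and> holo2 b \<and>
      eventually (\<lambda>z. ?P i (?G z) = a z * formA z + b z * formB z) (near 2 origin)"
    using critical[OF G[OF hP]] unfolding in_ideal_def by meson
  from choice[OF this] obtain a where "\<forall>i. \<exists>b. i < n \<longrightarrow> holo2 (a i) \<and> holo2 b \<and>
      eventually (\<lambda>z. ?P i (?G z) = a i z * formA z + b z * formB z) (near 2 origin)" ..
  from choice[OF this] obtain b where "\<forall>i. i < n \<longrightarrow> holo2 (a i) \<and> holo2 (b i) \<and>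
      eventually (\<lambda>z. ?P i (?G z) = a i z * formA z + b i z * formB z) (near 2 origin)" ..
  then have ab: "\<And>i. i < n \<Longrightarrow> holo2 (a i)" "\<And>i. i < n \<Longrightarrow> holo2 (b i)"
    "\<And>i. i < n \<Longrightarrow> eventually (\<lambda>z. ?P i (?G z) = a i z * formA z + b i z * formB z) (near 2 origin)"
    by blast+
  have P0: "?P i p = 0" if "i < n" for i
    using in_ideal_origin[OF critical[OF G[OF hP[OF that]] that]] G0 by simp

  \<comment> \<open>The pullback of \<Phi> to the plane. By the chain rule its differential is a
    matrix times (A, B), so the result on exact forms applies, although n is arbitrary.\<close>
  let ?\<psi> = "\<lambda>z. \<Phi> (?G z)"
  have h\<psi>: "holo2 ?\<psi>" using G[OF holo_Phi] by (simp add: rep_def)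
  have d\<psi>: "eventually (\<lambda>z. partial k ?\<psi> z = (\<Sum>i<n. a i z * partial k (\<gamma> i) z) * formA z
      + (\<Sum>i<n. b i z * partial k (\<gamma> i) z) * formB z) (near 2 origin)" if k: "k < 2" for k
  proof -
    have "eventually (\<lambda>z. partial k ?\<psi> z = (\<Sum>i<n. ?P i (?G z) * partial k (\<gamma> i) z)) (near 2 origin)"
      by (rule partial_compose) (use h\<gamma> holo_Phi G0 k in auto)
    moreover have "eventually (\<lambda>z. \<forall>i\<in>{..<n}. ?P i (?G z) = a i z * formA z + b i z * formB z) (near 2 origin)"
      using ab(3) by (intro eventually_ball_finite) auto
    ultimately show ?thesis
      by eventually_elim (simp add: sum_distrib_left sum.distrib algebra_simps)
  qed
  have hsum: "holo2 (\<lambda>z. \<Sum>i<n. c i z * partial k (\<gamma> i) z)" if "\<And>i. i < n \<Longrightarrow> holo2 (c i)" "k < 2" for c k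
    using that by (intro holo_intros holo_at_partial h\<gamma>) auto
  \<comment> \<open>At the origin the vectors (a_i) and (b_i) are orthogonal to both vectors of
    partial derivatives of \<gamma>.\<close>
  note exact = exact_in_ideal_imp_zero[OF hsum[OF ab(1)] hsum[OF ab(2)] hsum[OF ab(1)] hsum[OF ab(2)] h\<psi>
      d\<psi>[of 0] d\<psi>[of 1], simplified]

  \<comment> \<open>Lifts in the opposite direction: germs on C^n that correspond to the coordinates
    of the plane.\<close>
  obtain X where X: "rep X (\<lambda>z. z 0)" using rep_surj[OF holo_at_coord[OF origin_Cn]] .
  obtain Y where Y: "rep Y (\<lambda>z. z 1)" using rep_surj[OF holo_at_coord[OF origin_Cn]] .
  have X0: "X p = 0" using rep_value[OF X] by simp
  have Y0: "Y p = 0" using rep_value[OF Y] by simp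
  have hXY: "holo_at n p X" "holo_at n p Y" using X Y by (auto simp: rep_def)
  define H where "H j k = partial k (?P j) p" for j k
  have H_sym: "H j k = H k j" if "j < n" "k < n" for j k
    unfolding H_def by (rule partial_commute[OF holo_Phi that(2,1)])

  text \<open>The cotangent space of the critical locus at \<open>p\<close> is the cokernel of the Hessian \<open>H\<close>, so
    modulo the image of \<open>H\<close> the identity matrix factors through the two coordinates of the plane.\<close>
  have "\<exists>q. \<forall>k<n. (if i = k then 1 else 0) = partial k X p * partial 0 (\<gamma> i) origin +
      partial k Y p * partial 1 (\<gamma> i) origin + (\<Sum>j<n. q j * H j k)" if i: "i < n" for i
  proof -
    obtain r s where rs: "holo2 r" "holo2 s" "r origin = partial 0 (\<gamma> i) origin" "s origin = partial 1 (\<gamma> i) origin"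
      "eventually (\<lambda>z. \<gamma> i z = \<gamma> i origin + z 0 * r z + z 1 * s z) (near 2 origin)"
      by (rule hadamard2[OF h\<gamma>]) (rule that)
    obtain R where R: "rep R r" using rep_surj[OF rs(1)] .
    obtain S where S: "rep S s" using rep_surj[OF rs(2)] .
    have hRS: "holo_at n p R" "holo_at n p S" using R S by (auto simp: rep_def)
    \<comment> \<open>The Hadamard expansion of \<gamma>_i transported back to C^n. Its defect ?f is
      killed by \<phi>, hence is a combination of the derivatives of \<Phi>; differentiating this at
      p gives the claim.\<close>
    let ?f = "\<lambda>z. z i - (p i + X z * R z + Y z * S z)"
    have "rep ?f (\<lambda>z. \<gamma> i z - (p i + z 0 * r z + z 1 * s z))"
      by (intro rep_diff rep_add rep_mult rep_const \<gamma> X Y R S)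
    moreover have "in_ideal (\<lambda>z. \<gamma> i z - (p i + z 0 * r z + z 1 * s z))"
      by (rule in_ideal_cong[OF in_ideal_zero]) (use rs(5) in eventually_elim, simp add: v\<gamma>)
    ultimately obtain q where q: "\<And>j. j < n \<Longrightarrow> holo_at n p (q j)"
      "eventually (\<lambda>z. ?f z = (\<Sum>j<n. q j z * ?P j z)) (near n p)"
      using rep_in_ideal_iff unfolding comb_def diff_def by blast
    have "(if i = k then 1 else 0) = partial k X p * partial 0 (\<gamma> i) origin +
      partial k Y p * partial 1 (\<gamma> i) origin + (\<Sum>j<n. q j p * H j k)" if k: "k < n" for k
    proof -
      have "eventually (\<lambda>z. z i = p i + X z * R z + Y z * S z + (\<Sum>j<n. q j z * ?P j z)) (near n p)"
        using q(2) by eventually_elim (simp add: algebra_simps)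
      then have "partial k (\<lambda>z. z i) p = partial k (\<lambda>z. p i + X z * R z + Y z * S z + (\<Sum>j<n. q j z * ?P j z)) p"
        by (rule partial_cong_near[OF p k])
      \<comment> \<open>X, Y and all derivatives of \<Phi> vanish at p, so the product rule leaves
        one term for each product.\<close>
      also have "\<dots> = partial k (\<lambda>z. X z * R z) p + partial k (\<lambda>z. Y z * S z) p + (\<Sum>j<n. partial k (\<lambda>z. q j z * ?P j z) p)"
        using p k q(1) hP hXY hRS
        by (subst partial_add[of n] partial_sum[of _ n], auto intro!: holo_intros simp: partial_const)+
      also have "partial k (\<lambda>z. X z * R z) p = partial k X p * R p"
        using partial_mult[OF hXY(1) hRS(1) k] X0 by simp
      also have "partial k (\<lambda>z. Y z * S z) p = partial k Y p * S p"
        using partial_mult[OF hXY(2) hRS(2) k] Y0 by simp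
      also have "(\<Sum>j<n. partial k (\<lambda>z. q j z * ?P j z) p) = (\<Sum>j<n. q j p * H j k)"
        using partial_mult[OF q(1) hP k] P0 by (intro sum.cong refl) (simp add: H_def)
      finally show ?thesis
        using rep_value[OF R] rep_value[OF S] rs(3,4) by (simp add: partial_coord eq_commute)
    qed
    then show ?thesis by (intro exI[of _ "\<lambda>j. q j p"]) blast
  qed
  then have "\<forall>i. \<exists>q. i < n \<longrightarrow> (\<forall>k<n. (if i = k then 1 else 0) = partial k X p * partial 0 (\<gamma> i) origin +
      partial k Y p * partial 1 (\<gamma> i) origin + (\<Sum>j<n. q j * H j k))" by blast
  then obtain Q where Q: "\<And>i k. i < n \<Longrightarrow> k < n \<Longrightarrow> (if i = k then 1 else 0) =
      partial k X p * partial 0 (\<gamma> i) origin + partial k Y p * partial 1 (\<gamma> i) origin + (\<Sum>j<n. Q i j * H j k)"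
    by metis
  \<comment> \<open>Multiplying the factorization of the identity by a row vector orthogonal to both
    derivatives of \<gamma> leaves only the part in the image of H.\<close>
  have image: "c k = (\<Sum>j<n. (\<Sum>i<n. c i * Q i j) * H j k)"
    if c: "(\<Sum>i<n. c i * partial 0 (\<gamma> i) origin) = 0" "(\<Sum>i<n. c i * partial 1 (\<gamma> i) origin) = 0" and k: "k < n"
    for c k
  proof -
    have "c k = (\<Sum>i<n. c i * (if i = k then 1 else 0))"
      using k by (simp add: if_distrib[of "\<lambda>x. _ * x"] cong: if_cong)
    also have "\<dots> = (\<Sum>i<n. c i * (partial k X p * partial 0 (\<gamma> i) origin
        + partial k Y p * partial 1 (\<gamma> i) origin + (\<Sum>j<n. Q i j * H j k)))"
      using Q[OF _ k] by (intro sum.cong) auto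
    also have "\<dots> = partial k X p * (\<Sum>i<n. c i * partial 0 (\<gamma> i) origin) +
       partial k Y p * (\<Sum>i<n. c i * partial 1 (\<gamma> i) origin) + (\<Sum>i<n. \<Sum>j<n. c i * Q i j * H j k)"
      by (simp add: sum.distrib sum_distrib_left algebra_simps)
    also have "(\<Sum>i<n. \<Sum>j<n. c i * Q i j * H j k) = (\<Sum>j<n. (\<Sum>i<n. c i * Q i j) * H j k)"
      by (subst sum.swap) (simp add: sum_distrib_right)
    finally show ?thesis using c by simp
  qed
  define t where "t j = (\<Sum>i<n. a i origin * Q i j)" for j
  define s where "s j = (\<Sum>i<n. b i origin * Q i j)" for j
  have at: "a k origin = (\<Sum>j<n. t j * H j k)" if "k < n" for k
    unfolding t_def by (rule image[OF _ _ that]) (use exact in auto)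
  have bs: "b k origin = (\<Sum>j<n. s j * H j k)" if "k < n" for k
    unfolding s_def by (rule image[OF _ _ that]) (use exact in auto)

  text \<open>A Newton step for the lift of the coordinates makes all derivatives of \<open>\<Phi>\<close> vanish
    modulo the product of the ideal with the maximal ideal.\<close>
  define \<delta> where "\<delta> j z = t j * formA z + s j * formB z" for j z
  have \<delta>: "in_ideal (\<delta> j)" for j
    unfolding \<delta>_def[abs_def] by (intro in_ideal_add in_ideal_mult in_ideal_generators holo_at_const) auto
  define \<gamma>' where "\<gamma>' j z = \<gamma> j z - \<delta> j z" for j z
  have \<gamma>': "rep (\<lambda>z. z j) (\<gamma>' j)" for j
    by (rule rep_change[OF \<gamma>]) (use \<delta> h\<gamma> in \<open>auto simp: \<gamma>'_def[abs_def] intro: holo_at_diff in_ideal_holo\<close>)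
  let ?G' = "subst n \<gamma>'"
  have G': "rep f (\<lambda>z. f (?G' z))" if "holo_at n p f" for f
    by (rule rep_compose(1)) (use \<gamma>' that in auto)
  have G'0: "?G' origin = p" by (rule rep_compose(2)[OF \<gamma>' holo_Phi])
  have holo_G: "holo2 (\<lambda>z. f (?G z))" "holo2 (\<lambda>z. f (?G' z))" if "holo_at n p f" for f
    using G[OF that] G'[OF that] by (simp_all add: rep_def)
  have ev_G: "eventually (\<lambda>z. P (?G z)) (near 2 origin)" "eventually (\<lambda>z. P (?G' z)) (near 2 origin)"
    if "eventually P (near n p)" for P
    using eventually_compose_filterlim[OF that, of "subst n \<gamma>" "near 2 origin"]
      eventually_compose_filterlim[OF that, of "subst n \<gamma>'" "near 2 origin"]
      filterlim_subst[of n 2 origin \<gamma>] filterlim_subst[of n 2 origin \<gamma>'] G0 G'0 h\<gamma> \<gamma>'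
    by (auto simp: rep_def)
  have small: "in_max_mult_ideal (\<lambda>z. ?P i (?G' z))" if i: "i < n" for i
  proof -
    obtain K where K: "\<And>j. j < n \<Longrightarrow> holo_at n p (K j)"
      "eventually (\<lambda>z. ?P i z = ?P i p + (\<Sum>j<n. (z j - p j) * K j z)) (near n p)"
      by (rule hadamard[OF hP[OF i]]) (rule that)
    have KH: "K j p = H j i" if "j < n" for j
      using partial_hadamard[OF p K(1) that K(2)] H_sym[OF i that] by (simp add: H_def)
    \<comment> \<open>The coefficients of A and B after the Newton step, up to the error treated in
      2. At the origin K_j is the Hessian entry, so the choice of t and s makes them vanish.\<close>
    let ?c = "\<lambda>z. a i z - (\<Sum>j<n. t j * K j (?G' z))" and ?d = "\<lambda>z. b i z - (\<Sum>j<n. s j * K j (?G' z))"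
    have "holo2 ?c" "holo2 ?d"
      using i p by (auto intro!: holo_intros holo_G K ab)
    moreover have "?c origin = 0" "?d origin = 0"
      using at[OF i] bs[OF i] by (simp_all add: G'0 KH)
    moreover have "eventually (\<lambda>z. ?c z * formA z + ?d z * formB z = ?c z * formA z + ?d z * formB z) (near 2 origin)"
      by simp
    ultimately have 1: "in_max_mult_ideal (\<lambda>z. ?c z * formA z + ?d z * formB z)"
      unfolding in_max_mult_ideal_def by blast
    \<comment> \<open>The error of the Newton step: K_j composed with either lift represents the
      same class, so the difference lies in I, and \<gamma>_j - p_j lies in m.\<close>
    have 2: "in_max_mult_ideal (\<lambda>z. \<Sum>j<n. (\<gamma> j z - p j) * (K j (?G' z) - K j (?G z)))"
      by (intro in_max_mult_ideal_sum in_max_mult_ideal_ideal rep_unique[OF G' G] holo_at_diff h\<gamma> holo_at_const origin_Cn K)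
        (auto simp: v\<gamma>)
    have e: "eventually (\<lambda>z. ?P i (?G z) = (\<Sum>j<n. (\<gamma> j z - p j) * K j (?G z))) (near 2 origin)"
      using ev_G(1)[OF K(2)] by eventually_elim (simp add: P0[OF i] subst_def)
    have e': "eventually (\<lambda>z. ?P i (?G' z) = (\<Sum>j<n. (\<gamma>' j z - p j) * K j (?G' z))) (near 2 origin)"
      using ev_G(2)[OF K(2)] by eventually_elim (simp add: P0[OF i] subst_def)
    show ?thesis
    proof (rule in_max_mult_ideal_cong[OF in_max_mult_ideal_add[OF 1 2]], use e e' ab(3)[OF i] in eventually_elim)
      case (elim z)
      have "?P i (?G' z) = (\<Sum>j<n. (\<gamma> j z - p j) * K j (?G' z)) - (\<Sum>j<n. \<delta> j z * K j (?G' z))"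
        unfolding elim(2) \<gamma>'_def by (simp add: algebra_simps sum_subtractf sum.distrib)
      also have "(\<Sum>j<n. \<delta> j z * K j (?G' z)) =
          (\<Sum>j<n. t j * K j (?G' z)) * formA z + (\<Sum>j<n. s j * K j (?G' z)) * formB z"
        unfolding \<delta>_def by (simp add: algebra_simps sum_distrib_left sum_distrib_right sum.distrib)
      also have "(\<Sum>j<n. (\<gamma> j z - p j) * K j (?G' z)) =
          ?P i (?G z) + (\<Sum>j<n. (\<gamma> j z - p j) * (K j (?G' z) - K j (?G z)))"
        unfolding elim(1) by (simp add: right_diff_distrib sum_subtractf)
      finally show ?case unfolding elim(3) by (simp add: algebra_simps)
    qed
  qed

  \<comment> \<open>The polynomial A evaluated at X and Y, hence a germ on C^n whose lift is
    A.\<close>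
  let ?F = "\<lambda>z. 13 * (X z ^ 12 * Y z ^ 0) + 4 * (X z ^ 3 * Y z ^ 10) + 7 * (X z ^ 6 * Y z ^ 7) + 10 * (X z ^ 9 * Y z ^ 4)"
  have "rep ?F formA"
    unfolding formA_def[abs_def] by (intro rep_add rep_mult rep_const rep_power X Y)
  then have "comb n p (diff \<Phi>) ?F"
    using rep_in_ideal_iff in_ideal_generators(1) by blast
  then obtain q where q: "\<And>i. i < n \<Longrightarrow> holo_at n p (q i)"
    "eventually (\<lambda>z. ?F z = (\<Sum>i<n. q i z * ?P i z)) (near n p)"
    unfolding comb_def diff_def by blast
  have "in_max_mult_ideal (\<lambda>z. \<Sum>i<n. q i (?G' z) * ?P i (?G' z))"
    by (intro in_max_mult_ideal_sum in_max_mult_ideal_mult small holo_G q) auto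
  then have F: "in_max_mult_ideal (\<lambda>z. ?F (?G' z))"
    by (rule in_max_mult_ideal_cong) (use ev_G(2)[OF q(2)] in eventually_elim, simp)
  let ?X = "\<lambda>z. X (?G' z)" and ?Y = "\<lambda>z. Y (?G' z)"
  have hX: "holo2 ?X" "holo2 ?Y" "?X origin = 0" "?Y origin = 0"
    using holo_G(2)[OF hXY(1)] holo_G(2)[OF hXY(2)] X0 Y0 G'0 by auto
  have dX: "in_ideal (\<lambda>z. z 0 - ?X z)" "in_ideal (\<lambda>z. z 1 - ?Y z)"
    using rep_unique[OF X G'[OF hXY(1)]] rep_unique[OF Y G'[OF hXY(2)]] by auto
  have mono: "in_max_mult_ideal (\<lambda>z. c * (z 0 ^ k * z 1 ^ l - ?X z ^ k * ?Y z ^ l))" if "k > 0" "l > 0" for c k l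
    by (intro in_max_mult_ideal_mult in_max_mult_ideal_mult_diff in_ideal_power_diff dX hX holo_intros)
      (use that hX in auto)
  \<comment> \<open>The term x^12 has no factor y, so it is split as x^11 x to provide two factors
    vanishing at the origin.\<close>
  have pure: "in_max_mult_ideal (\<lambda>z. 13 * (z 0 ^ 11 * z 0 ^ 1 - ?X z ^ 11 * ?X z ^ 1))"
    by (intro in_max_mult_ideal_mult in_max_mult_ideal_mult_diff in_ideal_power_diff dX hX holo_intros)
      (use hX in auto)
  \<comment> \<open>The four corrections exchange the monomials in X and Y along G' for those in x
    and y; the sum is A.\<close>
  have "in_max_mult_ideal (\<lambda>z. ?F (?G' z) + (13 * (z 0 ^ 11 * z 0 ^ 1 - ?X z ^ 11 * ?X z ^ 1) +
      4 * (z 0 ^ 3 * z 1 ^ 10 - ?X z ^ 3 * ?Y z ^ 10) + 7 * (z 0 ^ 6 * z 1 ^ 7 - ?X z ^ 6 * ?Y z ^ 7)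
      + 10 * (z 0 ^ 9 * z 1 ^ 4 - ?X z ^ 9 * ?Y z ^ 4)))"
    by (intro in_max_mult_ideal_add F mono pure) auto
  then have "in_max_mult_ideal formA"
    by (rule in_max_mult_ideal_cong) (simp add: formA_def algebra_simps flip: power_Suc)
  then show False using formA_not_in_max_mult_ideal by blast
qed

end

theorem mainTheorem1:
  "\<exists>U \<omega>. zariski_open U \<and> origin \<in> U \<and>
     algebraic_form U \<omega> \<and> almost_closed U \<omega> \<and> nonreduced_point U \<omega> origin \<and>
     (\<nexists>W \<Phi>. Cn_open 2 W \<and> origin \<in> W \<and> W \<subseteq> U \<and> holomorphic 2 W \<Phi> \<and>
        same_zero_scheme_on 2 W (diff \<Phi>) \<omega>) \<and>
     (\<forall>n. \<nexists>V \<Phi>. Cn_open n V \<and> holomorphic n V \<Phi> \<and>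
        zero_schemes_iso 2 U \<omega> n V (diff \<Phi>))"
proof -
  obtain U where U: "zariski_open U" "origin \<in> U" "algebraic_form U form" "almost_closed U form"
    "nonreduced_point U form origin"
    by (rule form_algebraic_properties) (rule that)
  have "False" if W: "Cn_open 2 W" "origin \<in> W" "holomorphic 2 W \<Phi>"
    "same_zero_scheme_on 2 W (diff \<Phi>) form" for W \<Phi>
  proof -
    have eq: "zero_ideal 2 (diff \<Phi>) origin = zero_ideal 2 form origin"
      using W by (auto simp: same_zero_scheme_on_def)
    \<comment> \<open>Equal ideals make the two stalks literally the same ring.\<close>
    have "id \<in> ring_iso (zero_stalk 2 (diff \<Phi>) origin) (zero_stalk 2 form origin)"
      unfolding zero_stalk_def eq by (rule ring_iso_set_refl)
    moreover have "id (stalk_class 2 (diff \<Phi>) origin (\<lambda>_. c)) = stalk_class 2 form origin (\<lambda>_. c)" for c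
      unfolding stalk_class_def eq by simp
    moreover have "holo_at 2 origin \<Phi>" using W unfolding holo_at_def by blast
    ultimately have "critical_stalk_iso 2 origin \<Phi> id"
      by unfold_locales auto
    then show False by (rule critical_stalk_iso.stalk_iso_contradiction)
  qed
  moreover have "False" if V: "Cn_open n V" "holomorphic n V \<Phi>" "zero_schemes_iso 2 U form n V (diff \<Phi>)"
    for n V \<Phi>
  proof -
    \<comment> \<open>The source is a single point, so h selects one critical point of \<Phi>, and
      the isomorphism of stalks there is the required datum.\<close>
    have Z: "zero_set 2 U form = {origin}" using U(5) by (simp add: nonreduced_point_def)
    obtain h k \<phi> where h: "homeomorphism {origin} (zero_set n V (diff \<Phi>)) h k"
      "\<phi> origin \<in> ring_iso (zero_stalk n (diff \<Phi>) (h origin)) (zero_stalk 2 form origin)"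
      "\<And>c. \<phi> origin (stalk_class n (diff \<Phi>) (h origin) (\<lambda>_. c)) = stalk_class 2 form origin (\<lambda>_. c)"
      using V(3) unfolding zero_schemes_iso_def Z Let_def by auto
    have "h origin \<in> zero_set n V (diff \<Phi>)"
      using h(1) unfolding homeomorphism_def by blast
    then have "h origin \<in> V" by (simp add: zero_set_def)
    then have "holo_at n (h origin) \<Phi>" using V unfolding holo_at_def by blast
    then have "critical_stalk_iso n (h origin) \<Phi> (\<phi> origin)"
      using h(2,3) holo_at_Cn by unfold_locales auto
    then show False by (rule critical_stalk_iso.stalk_iso_contradiction)
  qed
  ultimately show ?thesis using U by (intro exI[of _ U] exI[of _ form]) blast
qed

end
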